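(* Let $N\ge 2$ be an integer and let $\lambda\in(0,N)$ be real. Let $$m_* = \Big( \frac{2^{1/N}-1}{1-2^{(\lambda-N)/N}} \cdot \frac{\operatorname{Per} B_1 }{D(B_1)}\Big)^{N/(N+1-\lambda)} |B_1|,$$ where $B_1$ is the unit ball in $\mathbb{R}^N$. Then for every $0<m<m_*$ we have $$E(m) < E(m_1)+E(m-m_1)\qquad \text{for all } 0<m_1<m.$$
   Context: For $N\ge2$, $\lambda\in(0,N)$ and a measurable set $\Omega\subset\mathbb{R}^N$, $|\Omega|$ denotes its Lebesgue measure. The perimeter (in the sense of De Giorgi) is $$\operatorname{Per}\Omega=\sup\Big\{\int_\Omega \operatorname{div}F(x)\,dx \;:\; F\in C_0^1(\mathbb{R}^N,\mathbb{R}^N),\ |F|\le 1\Big\},$$ where $C^1_0$ denotes compactly supported $C^1$ vector fields (the value $+\infty$ is allowed). Set $$D(\Omega)=\frac12\iint_{\Omega\times\Omega}\frac{dx\,dy}{|x-y|^\lambda},\qquad \mathcal{E}(\Omega)=\operatorname{Per}\Omega+D(\Omega).$$ For $m>0$ let $E(m)=\inf\{\mathcal{E}(\Omega): \Omega\subset\mathbb{R}^N \text{ measurable},\ |\Omega|=m\}$. *)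

theory Defs
  imports "HOL-Analysis.Analysis"
begin

definition C1_compact_support :: "(real^'n \<Rightarrow> real^'n) \<Rightarrow> bool" where
  "C1_compact_support F \<longleftrightarrow>
     (\<forall>x. F differentiable (at x)) \<and>
     continuous_on UNIV (\<lambda>x. jacobian F (at x)) \<and>
     compact (closure {x. F x \<noteq> 0})"

definition divergence :: "(real^'n \<Rightarrow> real^'n) \<Rightarrow> real^'n \<Rightarrow> real" where
  "divergence F x = trace (jacobian F (at x))"

definition perimeter :: "(real^'n) set \<Rightarrow> ereal" where
  "perimeter \<Omega> =
     (SUP F \<in> {F. C1_compact_support F \<and> (\<forall>x. norm (F x) \<le> 1)}.
        ereal (LINT x:\<Omega>|lebesgue. divergence F x))"

(* On the diagonal x = y the integrand evaluates to 0 (0 powr lam = 0 and 1 / 0 = 0);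
   the diagonal is a null set of the product measure, so the integral is not affected. *)
definition riesz_energy :: "real \<Rightarrow> (real^'n) set \<Rightarrow> ennreal" where
  "riesz_energy lam \<Omega> =
     (1/2) * (\<integral>\<^sup>+p\<in>\<Omega> \<times> \<Omega>. ennreal (1 / norm (fst p - snd p) powr lam)
        \<partial>(lebesgue \<Otimes>\<^sub>M lebesgue))"

definition drop_energy :: "real \<Rightarrow> (real^'n) set \<Rightarrow> ereal" where
  "drop_energy lam \<Omega> = perimeter \<Omega> + enn2ereal (riesz_energy lam \<Omega>)"

(* The type argument records the ambient space R^N with N = CARD('n). *)
definition min_energy :: "'n::finite itself \<Rightarrow> real \<Rightarrow> real \<Rightarrow> ereal" where
  "min_energy _ lam m =
     (INF \<Omega> \<in> {\<Omega> :: (real^'n) set. \<Omega> \<in> sets lebesgue \<and> emeasure lebesgue \<Omega> = ennreal m}.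
        drop_energy lam \<Omega>)"

(* For 0 < lam < N the perimeter and the Riesz energy of the unit ball are finite and
   positive, so the conversions to real lose nothing. *)
definition critical_mass :: "'n::finite itself \<Rightarrow> real \<Rightarrow> real" where
  "critical_mass _ lam =
     (let N = real CARD('n); B = ball 0 1 :: (real^'n) set in
        ((2 powr (1 / N) - 1) / (1 - 2 powr ((lam - N) / N))
           * (real_of_ereal (perimeter B) / enn2real (riesz_energy lam B)))
          powr (N / (N + 1 - lam))
        * measure lebesgue B)"

end

theory Submission
  imports Defs
begin

text \<open>
  The Riesz rearrangement inequality is not needed: in bounding \<open>E(m1)\<close> from below it suffices to
  consider competitors \<open>\<Omega>\<close> whose energy does not exceed that of the ball of the same measure, and since
  the ball minimises the perimeter, such an \<open>\<Omega>\<close> satisfies \<open>D(\<Omega>) \<le> D(ball)\<close>. Put \<open>\<theta> = m1 / m\<close>,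
  \<open>a = (N - 1) / N\<close>, \<open>b = (2 N - lam) / N\<close>. Rescaling \<open>\<Omega>\<close> to measure \<open>m\<close> bounds \<open>\<theta> E(m)\<close> by
  \<open>\<theta> powr (1 - a) * Per \<Omega> + \<theta> powr (1 - b) * D(\<Omega>)\<close>. Adding the same bound for \<open>1 - \<theta>\<close> leaves
  the inequality between \<open>\<theta> powr a + (1 - \<theta>) powr a - 1\<close> and \<open>1 - \<theta> powr b - (1 - \<theta>) powr b\<close>,
  whose quotient is smallest at \<open>\<theta> = 1/2\<close>; this is where the value of the critical mass comes from.

  For the isoperimetric inequality, convolve the indicator function of \<open>\<Omega>\<close> with a kernel of class
  \<open>C\<^sup>1\<close>. The integral of the norm of the gradient of the smoothed function \<open>u\<close> is at most \<open>Per \<Omega>\<close>, because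
  smoothing a bounded field with compact support gives an admissible test field. This
  integral in turn controls the growth of the level sets
  \<open>{u > t} + ball 0 \<delta>\<close>, which the Brunn--Minkowski inequality bounds from below.
\<close>

section \<open>One-dimensional inequality\<close>

text \<open>Blowing a competitor of mass \<open>\<theta> * m\<close> up to mass \<open>m\<close>
  multiplies its perimeter by \<open>\<theta> powr (- a)\<close> and its Riesz energy by
  \<open>\<theta> powr (- b)\<close>. After multiplication by \<theta> the first coefficient is
  below 1 and the second above 1, so the energy of the competitor exceeds \<theta> E(m) by a
  nonnegative multiple of its perimeter minus a nonnegative multiple of its Riesz energy, or more.
  Comparison with the ball bounds the first from below and the second from above. The resulting
  surplus is the same for all competitors, hence survives the infimum; strictness comes from there.
  As the critical mass contains the perimeter of the ball itself, the isoperimetric constant has to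
  be sharp, while the perimeter is a supremum over C^1 fields and gives access to a measurable set
  only through test fields. Smoothing replaces the set by open level sets, to which Brunn-Minkowski
  applies, and their first-order growth in \<delta> carries the factor
  \<open>n * w powr (1 / n)\<close>. For the unit ball this gives N |B_1|, the number that also
  bounds Per B_1 from above.\<close>

lemma powr_sum_quotient_mono:
  fixes \<alpha> \<beta> s t :: real
  assumes "0 \<le> \<beta>" "\<beta> \<le> \<alpha>" "0 \<le> s" "s \<le> t" "t < 1/2"
  defines "A \<equiv> \<lambda>\<gamma> s. (1/2 - s) powr (- \<gamma>) + (1/2 + s) powr (- \<gamma>)"
  shows "A \<alpha> s * A \<beta> t \<le> A \<alpha> t * A \<beta> s"
proof -
  have Apos: "A \<gamma> s > 0" if "0 \<le> s" "s < 1/2" for \<gamma> s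
    using that by (auto simp: A_def intro!: add_pos_pos)
  define A' where "A' = (\<lambda>\<gamma> s. \<gamma> * ((1/2 - s) powr (- \<gamma> - 1) - (1/2 + s) powr (- \<gamma> - 1)) :: real)"
  have dA: "(A \<gamma> has_real_derivative A' \<gamma> s) (at s)" if "0 \<le> s" "s < 1/2" for \<gamma> s
    unfolding A_def A'_def using that by (auto intro!: derivative_eq_intros simp: algebra_simps)
  \<comment> \<open>This is the numerator of the derivative of the quotient. With x <= y the two
    distances to the endpoints, each \<open>A'\<close> is its exponent times a bracket. The brackets
    are compared first: the difference of the cross products factors through \<open>cross\<close>
    and 1/x + 1/y. Then the exponents are compared by \<beta> \<le> \<alpha>.\<close>
  have key: "0 \<le> A' \<alpha> s * A \<beta> s - A \<alpha> s * A' \<beta> s" if s: "0 \<le> s" "s < 1/2" for s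
  proof -
    define x where "x = 1/2 - s"
    define y where "y = 1/2 + s"
    have xy: "0 < x" "x \<le> y" using s by (auto simp: x_def y_def)
    have B: "A \<gamma> s = x powr (- \<gamma>) + y powr (- \<gamma>)" for \<gamma> by (simp add: A_def x_def y_def)
    have B': "A' \<gamma> s = \<gamma> * (x powr (- \<gamma>) / x - y powr (- \<gamma>) / y)" for \<gamma>
      using xy by (simp add: A'_def x_def[symmetric] y_def[symmetric] powr_diff)
    have n: "0 \<le> x powr (- \<gamma>) / x - y powr (- \<gamma>) / y" if "0 \<le> \<gamma>" for \<gamma>
    proof -
      have "y powr (- \<gamma>) \<le> x powr (- \<gamma>)" using xy that by (intro powr_mono2') auto
      then show ?thesis using xy by (auto intro!: frac_le)
    qed
    have cross: "x powr (- \<beta>) * y powr (- \<alpha>) \<le> x powr (- \<alpha>) * y powr (- \<beta>)"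
    proof -
      have "y powr - (\<alpha> - \<beta>) \<le> x powr - (\<alpha> - \<beta>)" using xy assms by (intro powr_mono2') auto
      then have "x powr (- \<beta>) * y powr (-\<beta>) * y powr - (\<alpha> - \<beta>) \<le> x powr (- \<beta>) * y powr (-\<beta>) * x powr - (\<alpha> - \<beta>)"
        by (intro mult_left_mono) auto
      moreover have "z powr (-\<beta>) * z powr - (\<alpha> - \<beta>) = z powr (- \<alpha>)" for z :: real
        by (simp add: powr_add[symmetric])
      ultimately show ?thesis by (metis mult.assoc mult.commute)
    qed
    have "(x powr (- \<beta>) / x - y powr (- \<beta>) / y) * A \<alpha> s \<le> (x powr (- \<alpha>) / x - y powr (- \<alpha>) / y) * A \<beta> s"
    proof -
      have "(x powr (- \<alpha>) / x - y powr (- \<alpha>) / y) * A \<beta> s - (x powr (- \<beta>) / x - y powr (- \<beta>) / y) * A \<alpha> s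
         = (x powr (- \<alpha>) * y powr (- \<beta>) - x powr (- \<beta>) * y powr (- \<alpha>)) * (1 / x + 1 / y)"
        unfolding B using xy by (simp add: field_simps)
      also have "\<dots> \<ge> 0" using cross xy by (intro mult_nonneg_nonneg) auto
      finally show ?thesis by simp
    qed
    then have "\<beta> * ((x powr (- \<beta>) / x - y powr (- \<beta>) / y) * A \<alpha> s) \<le> \<beta> * ((x powr (- \<alpha>) / x - y powr (- \<alpha>) / y) * A \<beta> s)"
      using assms(1) by (rule mult_left_mono)
    also have "\<dots> \<le> \<alpha> * ((x powr (- \<alpha>) / x - y powr (- \<alpha>) / y) * A \<beta> s)"
      using assms(1,2) n[of \<alpha>] less_imp_le[OF Apos[OF s, of \<beta>]]
      by (intro mult_right_mono mult_nonneg_nonneg) linarith+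
    finally have "\<beta> * ((x powr (- \<beta>) / x - y powr (- \<beta>) / y) * A \<alpha> s) \<le> \<alpha> * ((x powr (- \<alpha>) / x - y powr (- \<alpha>) / y) * A \<beta> s)" .
    then show ?thesis unfolding B' by (simp add: mult_ac)
  qed
  have "A \<alpha> s / A \<beta> s \<le> A \<alpha> t / A \<beta> t"
  proof (rule DERIV_nonneg_imp_nondecreasing[OF assms(4)])
    fix u assume u: "s \<le> u" "u \<le> t"
    then have u': "0 \<le> u" "u < 1/2" using assms by auto
    show "\<exists>y. ((\<lambda>s. A \<alpha> s / A \<beta> s) has_real_derivative y) (at u) \<and> 0 \<le> y"
    proof (intro exI conjI)
      show "((\<lambda>s. A \<alpha> s / A \<beta> s) has_real_derivative
          (A' \<alpha> u * A \<beta> u - A \<alpha> u * A' \<beta> u) / (A \<beta> u * A \<beta> u)) (at u)"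
        using Apos[OF u'] by (intro DERIV_divide dA u') (auto simp: less_imp_neq[symmetric])
      show "0 \<le> (A' \<alpha> u * A \<beta> u - A \<alpha> u * A' \<beta> u) / (A \<beta> u * A \<beta> u)"
        using key[OF u'] by simp
    qed
  qed
  then show ?thesis using Apos[of s \<beta>] Apos[of t \<beta>] assms(3-5) by (simp add: field_simps)
qed

text \<open>For a = (N - 1) / N and b = (2 N - lam) / N the values at \<theta> = 1/2 are the
  numerator and the denominator of the constant in the critical mass. This is what makes the
  function \<open>K\<close> below vanish at 0.\<close>

lemma two_powr_facts:
  fixes a b :: real
  assumes "0 < a" "a < 1" "1 < b"
  shows "(1/2) powr a + (1/2) powr a - 1 = 2 powr (1 - a) - 1"
    "1 - (1/2) powr b - (1/2) powr b = 1 - 2 powr (1 - b)"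
    "0 < 2 powr (1 - a) - 1" "0 < 1 - 2 powr (1 - b)"
proof -
  have *: "(1/2) powr p + (1/2) powr p = 2 powr (1 - p)" for p :: real
    by (simp add: powr_diff powr_divide)
  show "(1/2) powr a + (1/2) powr a - 1 = 2 powr (1 - a) - 1" "1 - (1/2) powr b - (1/2) powr b = 1 - 2 powr (1 - b)"
    using *[of a] *[of b] by auto
  show "0 < 2 powr (1 - a) - 1" using assms by simp
  have "2 powr (1 - b) < 2 powr 0" using assms by (intro powr_less_mono) auto
  then show "0 < 1 - 2 powr (1 - b)" by simp
qed

text \<open>Written in terms of \<open>s = 1/2 - \<theta>\<close>, the difference \<open>K\<close> of the two sides vanishes at \<open>0\<close> and
  \<open>1/2\<close>, and \<open>K''\<close> can change sign only from positive to negative; a negative value of \<open>K\<close> would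
  force the opposite change of sign.\<close>
lemma half_split_extremal:
  fixes a b s :: real
  assumes ab: "0 < a" "a < 1" "1 < b" "b \<le> 2" and s: "0 \<le> s" "s \<le> 1/2"
  shows "(2 powr (1 - a) - 1) * (1 - (1/2 - s) powr b - (1/2 + s) powr b)
       \<le> (1 - 2 powr (1 - b)) * ((1/2 - s) powr a + (1/2 + s) powr a - 1)"
proof (rule ccontr)
  define p where "p = 1 - 2 powr (1 - b)"
  define q where "q = (2 powr (1 - a) - 1 :: real)"
  have pq: "p > 0" "q > 0" using two_powr_facts[OF ab(1-3)] by (auto simp: p_def q_def)
  define K where "K s = p * ((1/2 - s) powr a + (1/2 + s) powr a - 1) - q * (1 - (1/2 - s) powr b - (1/2 + s) powr b)" for s :: real
  define K1 where "K1 s = p * a * ((1/2 + s) powr (a - 1) - (1/2 - s) powr (a - 1))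
      + q * b * ((1/2 + s) powr (b - 1) - (1/2 - s) powr (b - 1))" for s :: real
  define A where "A \<gamma> s = (1/2 - s) powr (- \<gamma>) + (1/2 + s) powr (- \<gamma>)" for \<gamma> s :: real
  define K2 where "K2 s = q * b * (b - 1) * A (2 - b) s - p * a * (1 - a) * A (2 - a) s" for s
  assume "\<not> ?thesis"
  then have neg: "K s < 0" by (simp add: K_def p_def q_def)
  have K0: "K 0 = 0" "K (1/2) = 0"
    using two_powr_facts[OF ab(1-3)] ab by (simp_all add: K_def p_def q_def mult.commute)
  have "s \<noteq> 0" "s \<noteq> 1/2" using neg K0 by (metis less_irrefl)+
  then have s': "0 < s" "s < 1/2" using s by auto
  have K1: "(K has_real_derivative K1 u) (at u)" if "0 \<le> u" "u < 1/2" for u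
    unfolding K_def K1_def using that by (auto intro!: derivative_eq_intros simp: algebra_simps)
  have K2: "(K1 has_real_derivative K2 u) (at u)" if "0 \<le> u" "u < 1/2" for u
    unfolding K1_def K2_def A_def using that by (auto intro!: derivative_eq_intros simp: algebra_simps)
  have contK: "continuous_on {0..1/2} K"
    unfolding K_def using ab by (intro continuous_intros continuous_on_powr') auto
  obtain s1 where s1: "0 < s1" "s1 < s" "K s - K 0 = (s - 0) * K1 s1"
    using MVT2[of 0 s K K1] K1 s' by auto
  have n1: "K1 s1 < 0" using s1 neg K0 s' by (simp add: mult_less_0_iff)
  \<comment> \<open>The mean value theorem with mere continuity at the right end:
    \<open>(1/2 - s) powr a\<close> has no derivative at s = 1/2, because a < 1.\<close>
  obtain l s2 where s2: "s < s2" "s2 < 1/2" "(K has_real_derivative l) (at s2)" "K (1/2) - K s = (1/2 - s) * l"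
    using MVT[of s "1/2" K] s' continuous_on_subset[OF contK, of "{s..1/2}"] K1
    by (auto simp: real_differentiable_def) (meson dual_order.strict_trans less_imp_le)
  have "l = K1 s2" using DERIV_unique[OF s2(3) K1[of s2]] s2 s' by auto
  moreover have "(1/2 - s) * l > 0" using s2(4) neg K0 by auto
  ultimately have p2: "K1 s2 > 0" using s' by (simp add: zero_less_mult_iff)
  \<comment> \<open>By symmetry \<open>K1\<close> vanishes at 0; it is negative at \<open>s1\<close>
    and positive at \<open>s2\<close>. So \<open>K2\<close> is negative at some \<open>t1\<close>
    and positive at a later \<open>t2\<close>.\<close>
  obtain t1 where t1: "0 < t1" "t1 < s1" "K1 s1 - K1 0 = (s1 - 0) * K2 t1"
    using MVT2[of 0 s1 K1 K2] K2 s1 s' by auto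
  have "K1 0 = 0" by (simp add: K1_def)
  then have nt1: "K2 t1 < 0" using t1 n1 s1 by (simp add: mult_less_0_iff)
  obtain t2 where t2: "s1 < t2" "t2 < s2" "K1 s2 - K1 s1 = (s2 - s1) * K2 t2"
    using MVT2[of s1 s2 K1 K2] K2 s1 s2 s' by auto
  have "(s2 - s1) * K2 t2 > 0" using t2 n1 p2 by auto
  then have pt2: "K2 t2 > 0" using s1 s2 by (simp add: zero_less_mult_iff)
  have Apos: "A \<gamma> u > 0" if "0 \<le> u" "u < 1/2" for \<gamma> u
    using that by (auto simp: A_def intro!: add_pos_pos)
  \<comment> \<open>The quotient of \<open>A (2 - a)\<close> by \<open>A (2 - b)\<close> does not
    decrease, so the negative term of \<open>K2\<close>, dominant at \<open>t1\<close>, is still at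
    least as large at \<open>t2\<close>. The bound b <= 2 keeps the exponent 2 - b nonnegative
    here.\<close>
  have mono: "A (2 - a) t1 * A (2 - b) t2 \<le> A (2 - a) t2 * A (2 - b) t1"
    unfolding A_def by (rule powr_sum_quotient_mono) (use ab t1 t2 s1 s2 in auto)
  define k where "k = q * b * (b - 1)"
  define l where "l = p * a * (1 - a)"
  have kl: "k \<ge> 0" "l \<ge> 0" using ab pq by (auto simp: k_def l_def)
  have 1: "k * A (2 - b) t1 < l * A (2 - a) t1" using nt1 by (simp add: K2_def k_def l_def)
  have 2: "k * A (2 - b) t2 > l * A (2 - a) t2" using pt2 by (simp add: K2_def k_def l_def)
  have P: "A (2 - b) t1 > 0" "A (2 - b) t2 > 0" using t1 t2 s1 s2 by (auto intro!: Apos)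
  have "k * A (2 - b) t1 * A (2 - b) t2 < l * (A (2 - a) t1 * A (2 - b) t2)"
    using mult_strict_right_mono[OF 1 P(2)] by (simp add: mult_ac)
  also have "\<dots> \<le> l * (A (2 - a) t2 * A (2 - b) t1)"
    using mono kl by (intro mult_left_mono) auto
  also have "\<dots> \<le> k * A (2 - b) t2 * A (2 - b) t1"
    using mult_strict_right_mono[OF 2 P(1)] by (simp add: mult_ac)
  finally show False by (simp add: mult_ac)
qed

section \<open>Brunn--Minkowski inequality for open sets\<close>

text \<open>The lower bound of Brunn-Minkowski raised to the n-th power, so that it is a volume. In
  this form it is homogeneous of degree 1 in the pair of volumes, and the induction step rests on
  that.\<close>

definition bm_fun :: "nat \<Rightarrow> real \<Rightarrow> real \<Rightarrow> real" where
  "bm_fun n a b = (a powr (1 / real n) + b powr (1 / real n)) ^ n"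

lemma bm_fun_commute: "bm_fun n a b = bm_fun n b a"
  by (simp add: bm_fun_def add.commute)

lemma powr_inverse_power:
  assumes "n > 0" "a \<ge> 0"
  shows "(a powr (1 / real n)) ^ n = a"
proof (cases "a = 0")
  case False
  with assms show ?thesis
    by (simp add: powr_realpow[symmetric] powr_powr)
qed (use assms in auto)

lemma bm_fun_scale:
  assumes "n > 0" "s \<ge> 0" "a \<ge> 0" "b \<ge> 0"
  shows "bm_fun n (s * a) (s * b) = s * bm_fun n a b"
proof -
  have "bm_fun n (s * a) (s * b) = (s powr (1 / real n) * (a powr (1 / real n) + b powr (1 / real n))) ^ n"
    using assms by (simp add: bm_fun_def powr_mult algebra_simps)
  also have "\<dots> = s * bm_fun n a b"
    using assms by (simp add: power_mult_distrib powr_inverse_power bm_fun_def)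
  finally show ?thesis .
qed

lemma bm_fun_mono:
  assumes "a \<ge> 0" "b \<ge> 0" "a \<le> a'" "b \<le> b'"
  shows "bm_fun n a b \<le> bm_fun n a' b'"
  unfolding bm_fun_def using assms by (intro power_mono add_mono powr_mono2) auto

lemma sumset_box:
  fixes a b c d :: "'a::euclidean_space"
  assumes "box a b \<noteq> {}" "box c d \<noteq> {}"
  shows "box a b + box c d = box (a + c) (b + d)"
proof (intro equalityI subsetI)
  fix z assume "z \<in> box a b + box c d"
  then show "z \<in> box (a + c) (b + d)"
    by (auto simp: set_plus_def mem_box inner_add_left intro!: add_strict_mono)
next
  fix z assume z: "z \<in> box (a + c) (b + d)"
  \<comment> \<open>\<open>t i\<close> is the relative position of \<open>z\<close> within the i-th
    side of the sum box. The summand \<open>x\<close> takes the same relative position in the first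
    box, and then \<open>z - x\<close> takes it in the second.\<close>
  define t where "t i = (z \<bullet> i - a \<bullet> i - c \<bullet> i) / ((b \<bullet> i - a \<bullet> i) + (d \<bullet> i - c \<bullet> i))" for i
  define x where "x = (\<Sum>i\<in>Basis. (a \<bullet> i + t i * (b \<bullet> i - a \<bullet> i)) *\<^sub>R i)"
  have ab: "a \<bullet> i < b \<bullet> i" "c \<bullet> i < d \<bullet> i" if "i \<in> Basis" for i
    using assms that by (auto simp: box_ne_empty)
  have zi: "a \<bullet> i + c \<bullet> i < z \<bullet> i" "z \<bullet> i < b \<bullet> i + d \<bullet> i" if "i \<in> Basis" for i
    using z that by (auto simp: mem_box inner_add_left)
  have t: "0 < t i" "t i < 1" if "i \<in> Basis" for i
    using ab[OF that] zi[OF that] by (auto simp: t_def field_simps)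
  have zt: "z \<bullet> i = a \<bullet> i + c \<bullet> i + t i * ((b \<bullet> i - a \<bullet> i) + (d \<bullet> i - c \<bullet> i))" if "i \<in> Basis" for i
    using ab[OF that] by (simp add: t_def)
  have xi: "x \<bullet> i = a \<bullet> i + t i * (b \<bullet> i - a \<bullet> i)" if "i \<in> Basis" for i
    using that by (simp add: x_def)
  have "x \<in> box a b"
    unfolding mem_box
  proof
    fix i :: 'a assume i: "i \<in> Basis"
    define v where "v = t i * (b \<bullet> i - a \<bullet> i)"
    have "v < 1 * (b \<bullet> i - a \<bullet> i)"
      unfolding v_def using t[OF i] ab[OF i] by (intro mult_strict_right_mono) auto
    moreover have "0 < v"
      unfolding v_def using t[OF i] ab[OF i] by simp
    ultimately show "a \<bullet> i < x \<bullet> i \<and> x \<bullet> i < b \<bullet> i"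
      unfolding xi[OF i] v_def[symmetric] by auto
  qed
  moreover have "z - x \<in> box c d"
    unfolding mem_box
  proof
    fix i :: 'a assume i: "i \<in> Basis"
    have "t i * (d \<bullet> i - c \<bullet> i) < 1 * (d \<bullet> i - c \<bullet> i)"
      using t[OF i] ab[OF i] by (intro mult_strict_right_mono) auto
    moreover have "0 < t i * (d \<bullet> i - c \<bullet> i)"
      using t[OF i] ab[OF i] by simp
    ultimately show "c \<bullet> i < (z - x) \<bullet> i \<and> (z - x) \<bullet> i < d \<bullet> i"
      using xi[OF i] zt[OF i] by (simp add: inner_diff_left algebra_simps)
  qed
  ultimately show "z \<in> box a b + box c d"
    by (metis add.commute diff_add_cancel set_plus_intro)
qed

text \<open>The inequality of arithmetic and geometric means, applied to the ratios l / (l + m) and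
  to the ratios m / (l + m) of the side lengths: in each coordinate the two ratios add up to 1, so
  the two means do as well.\<close>

lemma bm_box:
  fixes a b c d :: "'a::euclidean_space"
  assumes ne: "box a b \<noteq> {}" "box c d \<noteq> {}"
  shows "bm_fun DIM('a) (measure lborel (box a b)) (measure lborel (box c d))
           \<le> measure lborel (box a b + box c d)"
proof -
  define l where "l i = b \<bullet> i - a \<bullet> i" for i
  define m where "m i = d \<bullet> i - c \<bullet> i" for i
  let ?n = "DIM('a)"
  have pos: "l i > 0" "m i > 0" if "i \<in> Basis" for i
    using ne that by (auto simp: box_ne_empty l_def m_def)
  have 1: "measure lborel (box a b) = (\<Prod>i\<in>Basis. l i)"
    using pos(1) by (auto simp: measure_lborel_box_eq l_def inner_diff_left less_imp_le)
  have 2: "measure lborel (box c d) = (\<Prod>i\<in>Basis. m i)"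
    using pos(2) by (auto simp: measure_lborel_box_eq m_def inner_diff_left less_imp_le)
  have 3: "measure lborel (box a b + box c d) = (\<Prod>i\<in>Basis. l i + m i)"
  proof -
    have "\<forall>i\<in>Basis. (a + c) \<bullet> i \<le> (b + d) \<bullet> i"
      using pos by (fastforce simp: l_def m_def inner_add_left intro: add_mono less_imp_le)
    then show ?thesis
      unfolding sumset_box[OF ne] measure_lborel_box_eq
      by (auto simp: l_def m_def inner_simps intro!: prod.cong)
  qed
  define S where "S = (\<Prod>i\<in>Basis. l i + m i)"
  have S: "S > 0" unfolding S_def using pos by (intro prod_pos) (auto intro: add_pos_pos)
  have frac: "(\<Prod>i\<in>Basis. f i) powr (1 / ?n) \<le> S powr (1 / ?n) * (\<Sum>i\<in>Basis. f i / (l i + m i) / ?n)"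
    if f: "\<And>i. i \<in> Basis \<Longrightarrow> f i > 0" for f :: "'a \<Rightarrow> real"
  proof -
    have "S \<noteq> 0" using S by simp
    then have "(\<Prod>i\<in>Basis. f i) = S * (\<Prod>i\<in>Basis. f i / (l i + m i))"
      by (simp add: prod_dividef S_def)
    moreover have "(\<Prod>i\<in>Basis. f i / (l i + m i)) powr (1 / ?n) \<le> (\<Sum>i\<in>Basis. f i / (l i + m i) / ?n)"
      using f pos by (intro arith_geom_mean) (fastforce intro: divide_nonneg_pos less_imp_le add_pos_pos)+
    ultimately show ?thesis
      using S by (simp add: powr_mult mult_left_mono prod_nonneg less_imp_le pos f add_nonneg_nonneg)
  qed
  have "(\<Prod>i\<in>Basis. l i) powr (1 / ?n) + (\<Prod>i\<in>Basis. m i) powr (1 / ?n)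
      \<le> S powr (1 / ?n) * ((\<Sum>i\<in>Basis. l i / (l i + m i) / ?n) + (\<Sum>i\<in>Basis. m i / (l i + m i) / ?n))"
    using frac[of l] frac[of m] pos by (simp add: distrib_left)
  also have "(\<Sum>i\<in>Basis. l i / (l i + m i) / ?n) + (\<Sum>i\<in>Basis. m i / (l i + m i) / ?n)
      = (\<Sum>i\<in>(Basis::'a set). 1 / ?n)"
    unfolding sum.distrib[symmetric]
  proof (rule sum.cong)
    fix i :: 'a assume "i \<in> Basis"
    then have "l i + m i \<noteq> 0" using pos[of i] by auto
    then show "l i / (l i + m i) / ?n + m i / (l i + m i) / ?n = 1 / ?n"
      by (metis add_divide_distrib divide_self)
  qed simp
  also have "\<dots> = 1" by simp
  finally have "bm_fun ?n (\<Prod>i\<in>Basis. l i) (\<Prod>i\<in>Basis. m i) \<le> (S powr (1 / ?n)) ^ ?n"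
    unfolding bm_fun_def by (intro power_mono) auto
  also have "\<dots> = S" using S by (simp add: powr_inverse_power)
  finally show ?thesis unfolding 1 2 3 S_def .
qed

section \<open>Finite families of disjoint open boxes and their cuts by hyperplanes\<close>

lemma fmeasurable_lborel_bounded:
  "S \<in> sets borel \<Longrightarrow> bounded S \<Longrightarrow> S \<in> fmeasurable lborel"
  using emeasure_bounded_finite[of S] by (simp add: fmeasurableI)

text \<open>Empty boxes are excluded so that the union has positive volume and any two members can
  be separated by a coordinate hyperplane; the number of members serves as the measure of the
  induction.\<close>

definition box_family :: "'a::euclidean_space set set \<Rightarrow> bool" where
  "box_family \<A> \<longleftrightarrow> finite \<A> \<and> \<A> \<noteq> {} \<and> disjoint \<A> \<and> (\<forall>X\<in>\<A>. X \<noteq> {} \<and> (\<exists>a b. X = box a b))"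

lemma box_family_Union:
  assumes "box_family \<A>"
  shows "open (\<Union>\<A>)" "bounded (\<Union>\<A>)" "\<Union>\<A> \<noteq> {}" "\<Union>\<A> \<in> fmeasurable lborel" "0 < measure lborel (\<Union>\<A>)"
proof -
  have box: "\<exists>a b. X = box a b" if "X \<in> \<A>" for X
    using assms that by (auto simp: box_family_def)
  show o: "open (\<Union>\<A>)"
    using box by (intro open_Union) (metis open_box)
  show b: "bounded (\<Union>\<A>)"
    using assms box by (intro bounded_Union) (auto simp: box_family_def, metis bounded_box)
  show ne: "\<Union>\<A> \<noteq> {}"
    using assms by (auto simp: box_family_def)
  from o b ne show f: "\<Union>\<A> \<in> fmeasurable lborel"
    by (intro fmeasurable_lborel_bounded) auto
  obtain X a b where X: "X \<in> \<A>" "X = box a b" "X \<noteq> {}"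
    using assms unfolding box_family_def by (metis ex_in_conv)
  have "0 < measure lborel X"
    using X by (auto simp: measure_lborel_box_eq box_ne_empty inner_diff_left less_imp_le intro!: prod_pos)
  also have "\<dots> \<le> measure lborel (\<Union>\<A>)"
    using X f by (intro measure_mono_fmeasurable) auto
  finally show "0 < measure lborel (\<Union>\<A>)" .
qed

lemma box_Int_halfspace:
  fixes a b :: "'a::euclidean_space"
  assumes "i \<in> Basis"
  shows "box a b \<inter> {x. c < x \<bullet> i} = box (\<Sum>j\<in>Basis. (if j = i then max (a \<bullet> i) c else a \<bullet> j) *\<^sub>R j) b"
    and "box a b \<inter> {x. x \<bullet> i < c} = box a (\<Sum>j\<in>Basis. (if j = i then min (b \<bullet> i) c else b \<bullet> j) *\<^sub>R j)"
  using assms by (auto simp: set_eq_iff mem_box)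

text \<open>Discarding the empty set keeps the result a \<open>box_family\<close>, and makes the
  number of boxes drop as soon as one of them misses \<open>H\<close>.\<close>

definition cut_family :: "'a set \<Rightarrow> 'a set set \<Rightarrow> 'a set set" where
  "cut_family H \<A> = ((\<lambda>X. X \<inter> H) ` \<A>) - {{}}"

lemma Union_cut_family: "\<Union>(cut_family H \<A>) = \<Union>\<A> \<inter> H"
  by (auto simp: cut_family_def)

lemma card_cut_family: "finite \<A> \<Longrightarrow> card (cut_family H \<A>) \<le> card \<A>"
  unfolding cut_family_def
  by (meson Diff_subset card_image_le card_mono finite_imageI le_trans)

lemma card_cut_family_less:
  assumes "finite \<A>" "X \<in> \<A>" "X \<inter> H = {}"
  shows "card (cut_family H \<A>) < card \<A>"
proof -
  have "cut_family H \<A> \<subseteq> (\<lambda>X. X \<inter> H) ` (\<A> - {X})"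
    using assms by (auto simp: cut_family_def)
  then have "card (cut_family H \<A>) \<le> card (\<A> - {X})"
    using assms by (meson card_image_le card_mono finite_Diff finite_imageI le_trans)
  also have "\<dots> < card \<A>" using assms by (intro card_Diff1_less) auto
  finally show ?thesis .
qed

lemma box_family_cut:
  fixes \<A> :: "'a::euclidean_space set set"
  assumes "box_family \<A>" "i \<in> Basis" "H = {x. c < x \<bullet> i} \<or> H = {x. x \<bullet> i < c}" "\<Union>\<A> \<inter> H \<noteq> {}"
  shows "box_family (cut_family H \<A>)"
  unfolding box_family_def
proof (intro conjI ballI)
  show "finite (cut_family H \<A>)" using assms by (auto simp: cut_family_def box_family_def)
  show "cut_family H \<A> \<noteq> {}" using assms by (auto simp: cut_family_def)
  show "disjoint (cut_family H \<A>)"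
    using assms(1) unfolding box_family_def disjoint_def cut_family_def by blast
  fix X assume X: "X \<in> cut_family H \<A>"
  then show "X \<noteq> {}" by (auto simp: cut_family_def)
  from X obtain Y where "Y \<in> \<A>" "X = Y \<inter> H" by (auto simp: cut_family_def)
  then obtain a b where "X = box a b \<inter> H" using assms(1) unfolding box_family_def by blast
  then show "\<exists>a b. X = box a b"
    using assms(3) box_Int_halfspace[OF assms(2)] by (elim disjE) (blast+)
qed

lemma disjoint_boxes_separated:
  fixes a b c d :: "'a::euclidean_space"
  assumes "box a b \<noteq> {}" "box c d \<noteq> {}" "box a b \<inter> box c d = {}"
  obtains i where "i \<in> Basis" "b \<bullet> i \<le> c \<bullet> i \<or> d \<bullet> i \<le> a \<bullet> i"
proof -
  have "\<exists>i\<in>Basis. b \<bullet> i \<le> c \<bullet> i \<or> d \<bullet> i \<le> a \<bullet> i"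
    using assms(3) assms(1,2) by (auto simp: disjoint_interval box_ne_empty)
  then show ?thesis using that by blast
qed

text \<open>Prepares the intermediate value argument that places the second hyperplane in
  \<open>minkowski_step\<close>. A change of \<open>c\<close> alters the volume by at most the part
  of an enclosing box in a thin slab, which \<open>content_doublesplit\<close> makes small.\<close>

lemma continuous_on_measure_halfspace:
  fixes U :: "'a::euclidean_space set"
  assumes "bounded U" "open U" "i \<in> Basis"
  shows "continuous_on UNIV (\<lambda>c. measure lborel (U \<inter> {x. c < x \<bullet> i}))"
proof -
  obtain a b where U: "U \<subseteq> cbox a b" using bounded_subset_cbox_symmetric[OF assms(1)] by blast
  let ?h = "\<lambda>c. measure lborel (U \<inter> {x. c < x \<bullet> i})"
  have [measurable]: "U \<in> sets borel" using assms by simp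
  have meas: "U \<inter> {x. c < x \<bullet> i} \<in> fmeasurable lborel" for c
    using assms(1) by (intro fmeasurable_lborel_bounded) (auto intro: bounded_subset)
  have diff: "?h c - ?h c' \<le> measure lborel (cbox a b \<inter> {x. \<bar>x \<bullet> i - p\<bar> \<le> e})"
    if "c \<le> c'" "\<bar>c - p\<bar> \<le> e" "\<bar>c' - p\<bar> \<le> e" for c c' p e
  proof -
    have m: "cbox a b \<inter> {x. \<bar>x \<bullet> i - p\<bar> \<le> e} \<in> fmeasurable lborel"
      using bounded_cbox[of a b] by (intro fmeasurable_lborel_bounded) (auto intro: bounded_subset)
    have "?h c \<le> measure lborel ((U \<inter> {x. c' < x \<bullet> i}) \<union> (cbox a b \<inter> {x. \<bar>x \<bullet> i - p\<bar> \<le> e}))"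
      using U that meas m by (intro measure_mono_fmeasurable fmeasurable.Un) auto
    also have "\<dots> \<le> ?h c' + measure lborel (cbox a b \<inter> {x. \<bar>x \<bullet> i - p\<bar> \<le> e})"
      using meas m by (intro measure_Un_le) auto
    finally show ?thesis by simp
  qed
  have mono: "?h c' \<le> ?h c" if "c \<le> c'" for c c'
    using meas that by (intro measure_mono_fmeasurable) auto
  show ?thesis
    unfolding continuous_on_iff
  proof (intro ballI allI impI)
    fix p e :: real assume e: "0 < e"
    obtain d where d: "0 < d" "measure lborel (cbox a b \<inter> {x. \<bar>x \<bullet> i - p\<bar> \<le> d}) < e"
      using content_doublesplit[OF e assms(3)] by metis
    show "\<exists>d>0. \<forall>x'\<in>UNIV. dist x' p < d \<longrightarrow> dist (?h x') (?h p) < e"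
    proof (intro exI[of _ d] conjI ballI impI)
      fix x' assume "dist x' p < d"
      then have x': "\<bar>x' - p\<bar> \<le> d" by (simp add: dist_real_def)
      show "dist (?h x') (?h p) < e"
      proof (cases "x' \<le> p")
        case True
        then show ?thesis using diff[of x' p p d] x' d mono[of x' p] by (simp add: dist_real_def)
      next
        case False
        then show ?thesis using diff[of p x' p d] x' d mono[of p x'] by (simp add: dist_real_def)
      qed
    qed (use d in auto)
  qed
qed

lemma measure_split_hyperplane:
  fixes U :: "'a::euclidean_space set"
  assumes "bounded U" "open U" "i \<in> Basis"
  shows "measure lborel U = measure lborel (U \<inter> {x. c < x \<bullet> i}) + measure lborel (U \<inter> {x. x \<bullet> i < c})"
proof -
  have [measurable]: "U \<in> sets borel" using assms by simp
  have s: "U \<inter> {x. c < x \<bullet> i} \<in> sets lborel" "U \<inter> {x. x \<bullet> i < c} \<in> sets lborel" by measurable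
  have m: "U \<inter> {x. c < x \<bullet> i} \<in> fmeasurable lborel" "U \<inter> {x. x \<bullet> i < c} \<in> fmeasurable lborel"
    using s assms(1) by (auto intro!: fmeasurable_lborel_bounded intro: bounded_subset)
  have "AE x in lborel. x \<notin> {x. x \<bullet> i = c}"
    using negligible_standard_hyperplane[OF assms(3), of c]
    by (intro AE_not_in) (auto simp: negligible_iff_null_sets null_sets_completion_iff)
  then have "measure lborel U = measure lborel ((U \<inter> {x. c < x \<bullet> i}) \<union> (U \<inter> {x. x \<bullet> i < c}))"
    using s by (intro measure_eq_AE) auto
  also have "\<dots> = measure lborel (U \<inter> {x. c < x \<bullet> i}) + measure lborel (U \<inter> {x. x \<bullet> i < c})"
    using m by (intro measure_Union) (auto simp: fmeasurable_def)
  finally show ?thesis .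
qed

lemma set_plus_UN: "A + B = (\<Union>x\<in>A. \<Union>y\<in>B. {x + y})"
  by (auto simp: set_plus_def)

lemma open_set_plus:
  fixes A B :: "'a::real_normed_vector set"
  shows "open A \<Longrightarrow> open (A + B)"
  unfolding set_plus_UN by (rule open_sums) simp

lemma bounded_set_plus:
  fixes A B :: "'a::real_normed_vector set"
  shows "bounded A \<Longrightarrow> bounded B \<Longrightarrow> bounded (A + B)"
  unfolding set_plus_UN by (rule bounded_sums)

text \<open>The induction step of Hadwiger and Ohmann: a hyperplane separating two of the boxes of \<open>\<A>\<close> leaves
  fewer boxes on either side, and a parallel hyperplane divides \<open>\<Union>\<B>\<close> in the same ratio of volumes.\<close>
lemma minkowski_step:
  fixes \<A> \<B> :: "'a::euclidean_space set set"
  assumes A: "box_family \<A>" and B: "box_family \<B>" and two: "2 \<le> card \<A>"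
    and IH: "\<And>\<A>' \<B>' :: 'a set set. box_family \<A>' \<Longrightarrow> box_family \<B>' \<Longrightarrow> card \<A>' < card \<A> \<Longrightarrow> card \<B>' \<le> card \<B> \<Longrightarrow>
        bm_fun DIM('a) (measure lborel (\<Union>\<A>')) (measure lborel (\<Union>\<B>')) \<le> measure lborel (\<Union>\<A>' + \<Union>\<B>')"
  shows "bm_fun DIM('a) (measure lborel (\<Union>\<A>)) (measure lborel (\<Union>\<B>)) \<le> measure lborel (\<Union>\<A> + \<Union>\<B>)"
proof -
  have finA: "finite \<A>" and finB: "finite \<B>" using A B by (auto simp: box_family_def)
  define U where "U = \<Union>\<A>"
  define W where "W = \<Union>\<B>"
  have U: "open U" "bounded U" "U \<in> fmeasurable lborel" "0 < measure lborel U"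
    and W: "open W" "bounded W" "W \<in> fmeasurable lborel" "0 < measure lborel W"
    using box_family_Union[OF A] box_family_Union[OF B] by (auto simp: U_def W_def)
  obtain X Y where XY: "X \<in> \<A>" "Y \<in> \<A>" "X \<noteq> Y"
    using two by (metis card_le_Suc0_iff_eq finA not_less_eq_eq numeral_2_eq_2)
  obtain a b c d where bx: "X = box a b" "Y = box c d"
    using XY A unfolding box_family_def by metis
  have ne: "X \<noteq> {}" "Y \<noteq> {}" "X \<inter> Y = {}"
    using XY A unfolding box_family_def disjoint_def by auto
  obtain i where i: "i \<in> Basis" "b \<bullet> i \<le> c \<bullet> i \<or> d \<bullet> i \<le> a \<bullet> i"
    using disjoint_boxes_separated ne unfolding bx by metis
  obtain p where "X \<inter> {x. p < x \<bullet> i} = {} \<and> Y \<inter> {x. x \<bullet> i < p} = {} \<or>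
                  Y \<inter> {x. p < x \<bullet> i} = {} \<and> X \<inter> {x. x \<bullet> i < p} = {}"
    using i(2)
  proof
    assume "b \<bullet> i \<le> c \<bullet> i"
    then show thesis using i(1) by (intro that[of "b \<bullet> i"]) (force simp: bx mem_box)
  next
    assume "d \<bullet> i \<le> a \<bullet> i"
    then show thesis using i(1) by (intro that[of "d \<bullet> i"]) (force simp: bx mem_box)
  qed
  then obtain X1 X2 where X12: "X1 \<in> \<A>" "X2 \<in> \<A>" "X1 \<noteq> {}" "X2 \<noteq> {}"
     "X1 \<inter> {x. p < x \<bullet> i} = {}" "X2 \<inter> {x. x \<bullet> i < p} = {}"
    using XY ne by blast
  define Hp where "Hp c = {x::'a. c < x \<bullet> i}" for c
  define Hm where "Hm c = {x::'a. x \<bullet> i < c}" for c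
  have opH: "open (Hp c)" "open (Hm c)" for c
    by (auto simp: Hp_def Hm_def open_halfspace_component_gt open_halfspace_component_lt)
  \<comment> \<open>Used to see that both halves are nonempty: the box on one side of the separating
    hyperplane is open, so it cannot be contained in the hyperplane itself.\<close>
  have hyp: "\<not> (open V \<and> V \<noteq> {} \<and> V \<subseteq> {x. x \<bullet> i = c})" for V :: "'a set" and c
    using negligible_standard_hyperplane[OF i(1)] negligible_subset open_not_negligible by metis
  have UHp: "U \<inter> Hp p \<noteq> {}"
  proof
    assume "U \<inter> Hp p = {}"
    then have "\<not> p < x \<bullet> i" "\<not> x \<bullet> i < p" if "x \<in> X2" for x
      using X12 that unfolding U_def Hp_def by blast+
    then have "X2 \<subseteq> {x. x \<bullet> i = p}" by (auto intro: antisym simp: not_less)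
    moreover have "open X2" using X12 A unfolding box_family_def by (metis open_box)
    ultimately show False using hyp X12 by blast
  qed
  have UHm: "U \<inter> Hm p \<noteq> {}"
  proof
    assume "U \<inter> Hm p = {}"
    then have "\<not> p < x \<bullet> i" "\<not> x \<bullet> i < p" if "x \<in> X1" for x
      using X12 that unfolding U_def Hm_def by blast+
    then have "X1 \<subseteq> {x. x \<bullet> i = p}" by (auto intro: antisym simp: not_less)
    moreover have "open X1" using X12 A unfolding box_family_def by (metis open_box)
    ultimately show False using hyp X12 by blast
  qed
  define \<A>p where "\<A>p = cut_family (Hp p) \<A>"
  define \<A>m where "\<A>m = cut_family (Hm p) \<A>"
  have bAp: "box_family \<A>p" and bAm: "box_family \<A>m"
    using UHp UHm unfolding \<A>p_def \<A>m_def U_def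
    by (auto intro!: box_family_cut[OF A i(1)] simp: Hp_def Hm_def)
  have cA: "card \<A>p < card \<A>" "card \<A>m < card \<A>"
    using card_cut_family_less[OF finA X12(1), of "Hp p"] card_cut_family_less[OF finA X12(2), of "Hm p"] X12
    unfolding \<A>p_def \<A>m_def by (auto simp: Hp_def Hm_def)
  have UA: "\<Union>\<A>p = U \<inter> Hp p" "\<Union>\<A>m = U \<inter> Hm p"
    by (auto simp: \<A>p_def \<A>m_def Union_cut_family U_def)
  define u where "u = measure lborel U"
  define w where "w = measure lborel W"
  define up where "up = measure lborel (U \<inter> Hp p)"
  define um where "um = measure lborel (U \<inter> Hm p)"
  have u: "u = up + um" "up > 0" "um > 0" "w > 0" "u > 0"
    using measure_split_hyperplane[OF U(2,1) i(1), of p] box_family_Union(5)[OF bAp]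
      box_family_Union(5)[OF bAm] U W UA
    by (auto simp: u_def up_def um_def w_def Hp_def Hm_def)
  let ?h = "\<lambda>c. measure lborel (W \<inter> Hp c)"
  \<comment> \<open>The hyperplane in \<open>W\<close> is placed so that the upper part of
    \<open>W\<close> has the same share of its volume as the upper part of \<open>U\<close> has of
    that of \<open>U\<close>. The intermediate value theorem runs between -R, where the upper part
    is all of \<open>W\<close>, and R, where it is empty.\<close>
  obtain q where q: "?h q = w * (up / u)"
  proof -
    obtain R where R: "W \<subseteq> ball 0 R" using bounded_subset_ballD[OF W(2), of 0] by auto
    have inR: "- R < x \<bullet> i \<and> x \<bullet> i < R" if "x \<in> W" for x
      using R that Basis_le_norm[OF i(1), of x] by (force simp: abs_le_iff)
    have eqs: "W \<inter> Hp (-R) = W" "W \<inter> Hp R = {}" using inR by (auto simp: Hp_def) force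
    have cont: "continuous_on {-R..R} ?h"
      using continuous_on_subset[OF continuous_on_measure_halfspace[OF W(2,1) i(1)]]
      unfolding Hp_def by blast
    have ivt: "\<exists>x. -R \<le> x \<and> x \<le> R \<and> ?h x = w * (up / u)"
    proof (rule IVT2'[of ?h])
      show "?h R \<le> w * (up / u)" using u by (simp add: eqs)
      show "w * (up / u) \<le> ?h (-R)" using u by (simp add: eqs w_def field_simps)
      have "W \<noteq> {}" using W by auto
      then show "-R \<le> R" using inR by fastforce
    qed (rule cont)
    then show thesis using that by blast
  qed
  have W_split: "w = ?h q + measure lborel (W \<inter> Hm q)"
    using measure_split_hyperplane[OF W(2,1) i(1), of q] by (simp add: w_def Hp_def Hm_def)
  have q': "measure lborel (W \<inter> Hm q) = w * (um / u)"
    using W_split q u by (simp add: field_simps)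
  have pos: "0 < w * (up / u)" "0 < w * (um / u)" using u by auto
  have WHp: "W \<inter> Hp q \<noteq> {}" and WHm: "W \<inter> Hm q \<noteq> {}"
    using pos q q' by (metis less_irrefl measure_empty)+
  define \<B>p where "\<B>p = cut_family (Hp q) \<B>"
  define \<B>m where "\<B>m = cut_family (Hm q) \<B>"
  have bBp: "box_family \<B>p" and bBm: "box_family \<B>m"
    using WHp WHm unfolding \<B>p_def \<B>m_def W_def
    by (auto intro!: box_family_cut[OF B i(1)] simp: Hp_def Hm_def)
  have cB: "card \<B>p \<le> card \<B>" "card \<B>m \<le> card \<B>"
    unfolding \<B>p_def \<B>m_def by (auto intro!: card_cut_family[OF finB])
  have WB: "\<Union>\<B>p = W \<inter> Hp q" "\<Union>\<B>m = W \<inter> Hm q"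
    by (auto simp: \<B>p_def \<B>m_def Union_cut_family W_def)
  let ?P = "(U \<inter> Hp p) + (W \<inter> Hp q)" and ?M = "(U \<inter> Hm p) + (W \<inter> Hm q)"
  have opPM: "open ?P" "open ?M" "open (U + W)"
    using U W opH by (auto intro!: open_set_plus open_Int)
  have bdPM: "bounded ?P" "bounded ?M" "bounded (U + W)"
    using U W by (auto intro!: bounded_set_plus intro: bounded_subset)
  \<comment> \<open>The two partial sums lie strictly on opposite sides of the hyperplane at height
    p + q, so their volumes add up inside U + W.\<close>
  have dPM: "?P \<inter> ?M = {}"
  proof -
    have "x \<bullet> i > p + q" if "x \<in> ?P" for x
      using that by (auto elim!: set_plus_elim simp: Hp_def inner_add_left)
    moreover have "x \<bullet> i < p + q" if "x \<in> ?M" for x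
      using that by (auto elim!: set_plus_elim simp: Hm_def inner_add_left)
    ultimately show ?thesis by force
  qed
  \<comment> \<open>Both volumes are split in the ratio up : um, so homogeneity splits
    \<open>bm_fun\<close> exactly in that ratio; the induction hypothesis then treats each
    half.\<close>
  have "bm_fun DIM('a) u w = (up / u) * bm_fun DIM('a) u w + (um / u) * bm_fun DIM('a) u w"
    using u by (simp add: add_divide_distrib[symmetric] distrib_right[symmetric])
  also have "(up / u) * bm_fun DIM('a) u w = bm_fun DIM('a) up (w * (up / u))"
    using u bm_fun_scale[of "DIM('a)" "up / u" u w] by (simp add: mult.commute)
  also have "(um / u) * bm_fun DIM('a) u w = bm_fun DIM('a) um (w * (um / u))"
    using u bm_fun_scale[of "DIM('a)" "um / u" u w] by (simp add: mult.commute)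
  also have "bm_fun DIM('a) up (w * (up / u)) \<le> measure lborel ?P"
    using IH[OF bAp bBp cA(1) cB(1)] unfolding UA WB q up_def .
  also have "bm_fun DIM('a) um (w * (um / u)) \<le> measure lborel ?M"
    using IH[OF bAm bBm cA(2) cB(2)] unfolding UA WB q' um_def .
  also have "measure lborel ?P + measure lborel ?M = measure lborel (?P \<union> ?M)"
    using opPM bdPM dPM fmeasurable_lborel_bounded[of ?P] fmeasurable_lborel_bounded[of ?M]
    by (intro measure_Union[symmetric]) (auto simp: fmeasurable_def)
  also have "\<dots> \<le> measure lborel (U + W)"
    using opPM bdPM by (intro measure_mono_fmeasurable fmeasurable_lborel_bounded) (auto simp: set_plus_def)
  finally show ?thesis by (simp add: u_def w_def U_def W_def add_mono)
qed

text \<open>Induction on the total number of boxes. A family with at least two boxes is cut so that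
  it loses boxes on both sides, and the other family gains none; by symmetry the roles may be
  exchanged. The case of two single boxes is \<open>bm_box\<close>.\<close>

lemma brunn_minkowski_boxes:
  fixes \<A> \<B> :: "'a::euclidean_space set set"
  assumes "box_family \<A>" "box_family \<B>"
  shows "bm_fun DIM('a) (measure lborel (\<Union>\<A>)) (measure lborel (\<Union>\<B>)) \<le> measure lborel (\<Union>\<A> + \<Union>\<B>)"
  using assms
proof (induction "card \<A> + card \<B>" arbitrary: \<A> \<B> rule: less_induct)
  case less
  have fin: "finite \<A>" "finite \<B>" "\<A> \<noteq> {}" "\<B> \<noteq> {}"
    using less.prems by (auto simp: box_family_def)
  consider "2 \<le> card \<A>" | "2 \<le> card \<B>" | "card \<A> = 1" "card \<B> = 1"
    using fin by (metis One_nat_def Suc_leI card_gt_0_iff le_antisym not_less_eq_eq numeral_2_eq_2)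
  then show ?case
  proof cases
    case 1
    show ?thesis
      by (rule minkowski_step[OF less.prems 1]) (rule less.hyps; simp)
  next
    case 2
    have "bm_fun DIM('a) (measure lborel (\<Union>\<B>)) (measure lborel (\<Union>\<A>)) \<le> measure lborel (\<Union>\<B> + \<Union>\<A>)"
    proof (rule minkowski_step[OF less.prems(2,1) 2])
      fix \<A>' \<B>' :: "'a set set"
      assume *: "box_family \<A>'" "box_family \<B>'" "card \<A>' < card \<B>" "card \<B>' \<le> card \<A>"
      then show "bm_fun DIM('a) (measure lborel (\<Union>\<A>')) (measure lborel (\<Union>\<B>')) \<le> measure lborel (\<Union>\<A>' + \<Union>\<B>')"
        using less.hyps[of \<B>' \<A>'] by (simp add: bm_fun_commute add.commute)
    qed
    then show ?thesis by (simp add: bm_fun_commute add.commute)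
  next
    case 3
    obtain a b c d where "\<A> = {box a b}" "\<B> = {box c d}" "box a b \<noteq> {}" "box c d \<noteq> {}"
      using 3 less.prems unfolding box_family_def by (metis card_1_singletonE insertI1)
    then show ?thesis using bm_box[of a b c d] by simp
  qed
qed

text \<open>The closed boxes exhausting \<open>U\<close> may overlap. A finite union of them is
  divided again into boxes with disjoint interiors, and passing to those interiors discards only a
  null set.\<close>

lemma open_inner_box_family:
  fixes U :: "'a::euclidean_space set"
  assumes "open U" "emeasure lborel U > ennreal s" "s \<ge> 0"
  obtains \<A> where "box_family \<A>" "\<Union>\<A> \<subseteq> U" "s < measure lborel (\<Union>\<A>)"
proof -
  obtain \<D> where D: "countable \<D>" "\<D> \<subseteq> Pow U" "\<And>X. X \<in> \<D> \<Longrightarrow> \<exists>a b. X = cbox a b" "\<Union>\<D> = U"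
    using open_countable_Union_open_cbox[OF assms(1)] by metis
  have "\<D> \<noteq> {}" using D(4) assms by auto
  define f where "f = from_nat_into \<D>"
  have f: "range f = \<D>" using D(1) \<open>\<D> \<noteq> {}\<close> by (simp add: f_def range_from_nat_into)
  have fc: "\<exists>a b. f n = cbox a b" for n using D(3) f by auto
  have fm: "f n \<in> sets lborel" for n using fc[of n] by auto
  have "(\<lambda>n. emeasure lborel (\<Union>k\<in>{..n}. f k)) \<longlonglongrightarrow> emeasure lborel (\<Union>n. \<Union>k\<in>{..n}. f k)"
  proof (rule Lim_emeasure_incseq)
    show "range (\<lambda>n. \<Union>k\<in>{..n}. f k) \<subseteq> sets lborel" using fm by auto
    show "incseq (\<lambda>n. \<Union>k\<in>{..n}. f k)" by (force simp: incseq_def)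
  qed
  moreover have "(\<Union>n. \<Union>k\<in>{..n}. f k) = U" using f D(4) by auto
  ultimately have "eventually (\<lambda>n. ennreal s < emeasure lborel (\<Union>k\<in>{..n}. f k)) sequentially"
    using assms(2) by (auto intro: order_tendstoD(1))
  then obtain n where n: "ennreal s < emeasure lborel (\<Union>k\<in>{..n}. f k)"
    using eventually_happens'[OF sequentially_bot] by blast
  obtain p where p: "p division_of (\<Union>(f ` {..n}))"
  proof -
    have "\<exists>a b. s = cbox a b" if "s \<in> f ` {..n}" for s using that fc by blast
    then show thesis using elementary_unions_intervals[of "f ` {..n}"] that by blast
  qed
  define \<A> where "\<A> = interior ` p - {{}}"
  have pc: "\<exists>a b. K = cbox a b" "K \<subseteq> \<Union>(f ` {..n})" if "K \<in> p" for K
    using p that by (auto simp: division_of_def)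
  have finp: "finite p" using p by auto
  have sub: "\<Union>\<A> \<subseteq> U"
  proof -
    have "\<Union>(f ` {..n}) \<subseteq> U" using f D(4) by auto
    then have "interior K \<subseteq> U" if "K \<in> p" for K
      using pc(2)[OF that] interior_subset[of K] by blast
    then show ?thesis by (auto simp: \<A>_def)
  qed
  have Aprop: "X \<noteq> {} \<and> (\<exists>a b. X = box a b)" if X: "X \<in> \<A>" for X
  proof -
    obtain K where "K \<in> p" "X = interior K" "X \<noteq> {}" using X by (auto simp: \<A>_def)
    then show ?thesis using pc(1)[of K] interior_cbox by metis
  qed
  have djA: "disjoint \<A>"
    unfolding disjoint_def
  proof (intro ballI impI)
    fix X Y assume "X \<in> \<A>" "Y \<in> \<A>" "X \<noteq> Y"
    then obtain K L where "K \<in> p" "L \<in> p" "X = interior K" "Y = interior L" "K \<noteq> L"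
      by (auto simp: \<A>_def)
    then show "X \<inter> Y = {}" using division_ofD(5)[OF p] by blast
  qed
  have "AE x in lborel. \<forall>K\<in>p. x \<notin> K - interior K"
  proof (rule AE_finite_allI[OF finp])
    fix K assume "K \<in> p"
    then obtain a b where "K = cbox a b" using pc by blast
    then have "K - interior K \<in> null_sets lborel" by (simp add: null_sets_cbox_Diff_box)
    then show "AE x in lborel. x \<notin> K - interior K" by (rule AE_not_in)
  qed
  then have ae: "AE x in lborel. x \<in> (\<Union>k\<in>{..n}. f k) \<longleftrightarrow> x \<in> \<Union>\<A>"
  proof (eventually_elim)
    case (elim x)
    have 1: "\<Union>(f ` {..n}) = \<Union>p" using p by (auto simp: division_of_def)
    have 2: "\<Union>\<A> = (\<Union>K\<in>p. interior K)" by (auto simp: \<A>_def)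
    show ?case unfolding 1 2 using elim by (auto dest: interior_subset[THEN subsetD])
  qed
  have op: "open (\<Union>\<A>)" using Aprop by (intro open_Union) (metis open_box)
  have "emeasure lborel (\<Union>k\<in>{..n}. f k) = emeasure lborel (\<Union>\<A>)"
    using op fm by (intro emeasure_eq_AE ae) auto
  with n have em: "ennreal s < emeasure lborel (\<Union>\<A>)" by simp
  then have "\<A> \<noteq> {}" by auto
  then have bf: "box_family \<A>"
    using finp djA Aprop unfolding box_family_def by (auto simp: \<A>_def)
  moreover have "s < measure lborel (\<Union>\<A>)"
  proof -
    have "emeasure lborel (\<Union>\<A>) = ennreal (measure lborel (\<Union>\<A>))"
      using box_family_Union(4)[OF bf] by (intro emeasure_eq_measure2) simp
    with em assms(3) show ?thesis by (simp add: ennreal_less_iff)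
  qed
  ultimately show thesis using that sub by blast
qed

text \<open>Inner approximation by boxes reaches every volume strictly below the given ones, hence
  the factor r < 1; the claim follows as r tends to 1, because \<open>bm_fun\<close> is continuous
  at positive volumes.\<close>

theorem brunn_minkowski_open:
  fixes U W :: "'a::euclidean_space set"
  assumes "open U" "open W" "U \<noteq> {}" "W \<noteq> {}"
    and "U \<in> fmeasurable lborel" "W \<in> fmeasurable lborel" "U + W \<in> fmeasurable lborel"
  shows "bm_fun DIM('a) (measure lborel U) (measure lborel W) \<le> measure lborel (U + W)"
proof -
  have pos: "0 < measure lborel V" if "open V" "V \<noteq> {}" "V \<in> fmeasurable lborel" for V :: "'a set"
  proof -
    have "\<not> negligible V" using that open_not_negligible by blast
    then have "V \<notin> null_sets lborel" by (auto simp: negligible_iff_null_sets null_sets_completionI)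
    then show ?thesis using that
      by (metis emeasure_eq_measure2 ennreal_0 fmeasurableD measure_nonneg null_setsI zero_less_measure_iff)
  qed
  have *: "bm_fun DIM('a) (r * measure lborel U) (r * measure lborel W) \<le> measure lborel (U + W)"
    if r: "0 < r" "r < 1" for r
  proof -
    have "ennreal (r * measure lborel V) < emeasure lborel V" if "open V" "V \<noteq> {}" "V \<in> fmeasurable lborel" for V :: "'a set"
      using pos[OF that] r that by (simp add: emeasure_eq_measure2 ennreal_less_iff)
    then obtain \<A> \<B> where
      A: "box_family \<A>" "\<Union>\<A> \<subseteq> U" "r * measure lborel U < measure lborel (\<Union>\<A>)" and
      B: "box_family \<B>" "\<Union>\<B> \<subseteq> W" "r * measure lborel W < measure lborel (\<Union>\<B>)"
      using open_inner_box_family[OF assms(1), of "r * measure lborel U"]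
        open_inner_box_family[OF assms(2), of "r * measure lborel W"] assms r
      by (metis less_imp_le measure_nonneg mult_nonneg_nonneg)
    have "bm_fun DIM('a) (r * measure lborel U) (r * measure lborel W)
        \<le> bm_fun DIM('a) (measure lborel (\<Union>\<A>)) (measure lborel (\<Union>\<B>))"
      using A B r by (intro bm_fun_mono) auto
    also have "\<dots> \<le> measure lborel (\<Union>\<A> + \<Union>\<B>)"
      by (rule brunn_minkowski_boxes[OF A(1) B(1)])
    also have "\<dots> \<le> measure lborel (U + W)"
      using A B assms box_family_Union[OF A(1)] box_family_Union[OF B(1)]
      by (intro measure_mono_fmeasurable) (use set_plus_mono2[OF A(2) B(2)] in \<open>auto intro!: borel_open open_set_plus\<close>)
    finally show ?thesis .
  qed
  have "eventually (\<lambda>r. bm_fun DIM('a) (r * measure lborel U) (r * measure lborel W) \<le> measure lborel (U + W)) (at_left (1::real))"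
    using eventually_at_left[of 0 "1::real"] * by (auto intro!: exI[of _ 0])
  moreover have "((\<lambda>r. bm_fun DIM('a) (r * measure lborel U) (r * measure lborel W)) \<longlongrightarrow>
      bm_fun DIM('a) (1 * measure lborel U) (1 * measure lborel W)) (at_left (1::real))"
    unfolding bm_fun_def using pos assms by (intro tendsto_intros) auto
  ultimately show ?thesis
    by (intro tendsto_upperbound[of _ "bm_fun DIM('a) (measure lborel U) (measure lborel W)" "at_left (1::real)"]) auto
qed

section \<open>Perimeter of the unit ball\<close>

lemma C1_compact_supportD:
  fixes F :: "real^'n \<Rightarrow> real^'n"
  assumes "C1_compact_support F"
  shows "(F has_derivative (\<lambda>h. jacobian F (at x) *v h)) (at x)"
    and "((\<lambda>x. F x $ i) has_derivative (\<lambda>h. (jacobian F (at x) *v h) $ i)) (at x)"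
    and "continuous_on UNIV F"
    and "continuous_on UNIV (\<lambda>x. jacobian F (at x))"
    and "continuous_on UNIV (divergence F)"
proof -
  show 1: "(F has_derivative (\<lambda>h. jacobian F (at x) *v h)) (at x)" for x
    using assms jacobian_works[of F] by (auto simp: C1_compact_support_def)
  then show "((\<lambda>x. F x $ i) has_derivative (\<lambda>h. (jacobian F (at x) *v h) $ i)) (at x)"
    by (rule bounded_linear.has_derivative[OF bounded_linear_vec_nth])
  show "continuous_on UNIV F"
    using 1 by (auto intro!: continuous_at_imp_continuous_on intro: has_derivative_continuous)
  show c: "continuous_on UNIV (\<lambda>x. jacobian F (at x))"
    using assms by (simp add: C1_compact_support_def)
  show "continuous_on UNIV (divergence F)"
    unfolding divergence_def trace_def by (intro continuous_intros c)
qed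

lemma C1_compact_support_bounds:
  fixes F :: "real^'n \<Rightarrow> real^'n"
  assumes "C1_compact_support F"
  obtains M R where "0 < R" "\<And>x. norm x > R \<Longrightarrow> F x = 0 \<and> jacobian F (at x) = 0"
    "0 \<le> M" "\<And>x i j. \<bar>jacobian F (at x) $ i $ j\<bar> \<le> M"
proof -
  define S where "S = closure {x. F x \<noteq> 0}"
  have S: "compact S" using assms by (simp add: C1_compact_support_def S_def)
  obtain R where R: "0 < R" "S \<subseteq> ball 0 R"
    using bounded_subset_ballD[OF compact_imp_bounded[OF S], of 0] by blast
  have out: "F x = 0 \<and> jacobian F (at x) = 0" if "norm x > R" for x
  proof -
    have x: "x \<in> - S" using R that by force
    have F0: "F y = 0" if "y \<in> - S" for y
      using that closure_subset[of "{x. F x \<noteq> 0}"] by (auto simp: S_def)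
    have "((\<lambda>_. 0) has_derivative (\<lambda>_. 0)) (at x)" by simp
    then have "(F has_derivative (\<lambda>_. 0)) (at x)"
      by (rule has_derivative_transform_within_open[of _ _ _ _ "- S"])
        (use x F0 S in \<open>auto simp: compact_imp_closed open_Compl\<close>)
    then have "frechet_derivative F (at x) = (\<lambda>_. 0)"
      by (metis frechet_derivative_at)
    then show ?thesis using F0[OF x] by (simp add: jacobian_def matrix_def vec_eq_iff)
  qed
  have c: "continuous_on UNIV (\<lambda>x. jacobian F (at x))"
    using C1_compact_supportD(4)[OF assms] .
  have "bounded ((\<lambda>x. jacobian F (at x)) ` cball 0 R)"
    by (intro compact_imp_bounded compact_continuous_image continuous_on_subset[OF c]) auto
  then obtain M where M: "0 < M" "\<And>x. x \<in> cball 0 R \<Longrightarrow> norm (jacobian F (at x)) \<le> M"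
    by (auto simp: bounded_pos)
  have "\<bar>jacobian F (at x) $ i $ j\<bar> \<le> M" for x i j
  proof (cases "norm x > R")
    case True
    then show ?thesis using out M by simp
  next
    case False
    have "\<bar>jacobian F (at x) $ i $ j\<bar> \<le> norm (jacobian F (at x) $ i)" by (rule component_le_norm_cart)
    also have "\<dots> \<le> norm (jacobian F (at x))" by (rule Finite_Cartesian_Product.norm_nth_le)
    also have "\<dots> \<le> M" using M False by simp
    finally show ?thesis .
  qed
  then show thesis using that[of R M] R out M by auto
qed

lemma has_derivative_directional_LIMSEQ:
  fixes f :: "'a::real_normed_vector \<Rightarrow> real"
  assumes "(f has_derivative f') (at x)"
  shows "(\<lambda>k. (f (x + (1 / real (Suc k)) *\<^sub>R v) - f x) / (1 / real (Suc k))) \<longlonglongrightarrow> f' v"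
proof -
  have "((\<lambda>s. f (x + s *\<^sub>R v)) has_derivative (\<lambda>h. f' (h *\<^sub>R v))) (at 0)"
  proof (rule has_derivative_compose[of "\<lambda>s. x + s *\<^sub>R v" "\<lambda>h. h *\<^sub>R v" 0 UNIV f f'])
    show "(f has_derivative f') (at (x + 0 *\<^sub>R v))" using assms by simp
  qed (auto intro!: derivative_eq_intros)
  moreover have "(\<lambda>h. f' (h *\<^sub>R v)) = (*) (f' v)"
    using has_derivative_linear[OF assms] by (auto simp: linear_cmul mult.commute)
  ultimately have "((\<lambda>s. f (x + s *\<^sub>R v)) has_real_derivative f' v) (at 0)"
    by (simp add: has_field_derivative_def)
  then have "(\<lambda>h. (f (x + h *\<^sub>R v) - f x) / h) \<midarrow>0\<rightarrow> f' v"
    by (simp add: DERIV_def)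
  moreover have "filterlim (\<lambda>k. 1 / real (Suc k)) (at 0) sequentially"
    unfolding filterlim_at using LIMSEQ_inverse_real_of_nat by (auto simp: field_simps)
  ultimately show ?thesis by (rule filterlim_compose)
qed

section \<open>Translation invariance and integration by parts\<close>

lemma lborel_distr_translate: "distr lborel borel (\<lambda>x. x + a) = (lborel :: 'a::euclidean_space measure)"
  using lborel_affine[of 1 a] by (simp add: density_1 add.commute)

lemma lborel_integral_translate:
  fixes f :: "'a::euclidean_space \<Rightarrow> 'b::{banach, second_countable_topology}"
  assumes "f \<in> borel_measurable borel"
  shows "(\<integral>x. f (x + a) \<partial>lborel) = (\<integral>x. f x \<partial>lborel)"
  by (subst (2) lborel_distr_translate[symmetric, of a], subst integral_distr) (use assms in auto)

lemma lborel_integrable_translate: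
  fixes f :: "'a::euclidean_space \<Rightarrow> 'b::{banach, second_countable_topology}"
  assumes "integrable lborel f"
  shows "integrable lborel (\<lambda>x. f (x + a))"
proof -
  have "integrable (distr lborel borel (\<lambda>x. x + a)) f" using assms by (simp add: lborel_distr_translate)
  then show ?thesis using assms by (subst (asm) integrable_distr_eq) auto
qed

lemma integrable_bounded_support:
  fixes f :: "'a::euclidean_space \<Rightarrow> 'b::{banach, second_countable_topology}"
  assumes [measurable]: "f \<in> borel_measurable borel" and "\<And>x. norm (f x) \<le> C" "\<And>x. norm x > R \<Longrightarrow> f x = 0"
  shows "integrable lborel f"
proof (rule Bochner_Integration.integrable_bound)
  show "integrable lborel (\<lambda>x. C * indicator (cball (0::'a) R) x)"
    by (intro integrable_mult_right integrable_real_indicator) (auto intro: emeasure_bounded_finite[OF bounded_cball, simplified])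
  have "0 \<le> C" using assms(2) norm_ge_zero order_trans by blast
  then show "AE x in lborel. norm (f x) \<le> norm (C * indicator (cball (0::'a) R) x)"
    using assms(2,3) by (auto simp: indicator_def not_le)
qed simp

text \<open>Translation invariance moves the difference quotient from \<open>f\<close> to \<phi>,
  reversing the direction \<open>v\<close>, and dominated convergence turns both quotients into
  derivatives. This asks of \<phi> a Lipschitz bound and differentiability almost everywhere, as is
  suited to \<open>cone_cutoff\<close>.\<close>

lemma integral_by_parts_partial:
  fixes f \<phi> :: "'a::euclidean_space \<Rightarrow> real"
  assumes f: "\<And>x. (f has_derivative f' x) (at x)" "\<And>x. norm x > R \<Longrightarrow> f x = 0" "\<And>x. \<bar>f x\<bar> \<le> 1"
    and f': "continuous_on UNIV (\<lambda>x. f' x v)" "\<And>x. norm x > R \<Longrightarrow> f' x v = 0" "\<And>x. \<bar>f' x v\<bar> \<le> M"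
    and lipf: "\<And>x t. \<bar>f (x + t *\<^sub>R v) - f x\<bar> \<le> M * \<bar>t\<bar>"
    and \<phi>: "\<And>x y. \<bar>\<phi> x - \<phi> y\<bar> \<le> L * norm (x - y)" "\<And>x. \<bar>\<phi> x\<bar> \<le> 1" "\<And>x. norm x > R' \<Longrightarrow> \<phi> x = 0"
    and g: "AE x in lborel. (\<phi> has_derivative (\<lambda>h. g x \<bullet> h)) (at x)" "g \<in> borel_measurable borel"
  shows "(\<integral>x. \<phi> x * f' x v \<partial>lborel) = - (\<integral>x. (g x \<bullet> v) * f x \<partial>lborel)"
proof -
  define t where "t k = 1 / real (Suc k)" for k
  have t: "t k > 0" for k by (simp add: t_def)
  have L0: "L * norm v \<ge> 0" using order_trans[OF abs_ge_zero \<phi>(1)[of v 0]] by simp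
  have M0: "M \<ge> 0" using order_trans[OF abs_ge_zero f'(3)] .
  have cf: "continuous_on UNIV f"
    using f(1) by (auto intro!: continuous_at_imp_continuous_on intro: has_derivative_continuous)
  have c\<phi>: "continuous_on UNIV \<phi>"
    unfolding continuous_on_iff
  proof (intro ballI allI impI)
    fix x :: 'a and e :: real assume e: "0 < e"
    show "\<exists>d>0. \<forall>x'\<in>UNIV. dist x' x < d \<longrightarrow> dist (\<phi> x') (\<phi> x) < e"
    proof (intro exI[of _ "e / (\<bar>L\<bar> + 1)"] conjI ballI impI)
      fix y assume "dist y x < e / (\<bar>L\<bar> + 1)"
      then have "norm (y - x) * (\<bar>L\<bar> + 1) < e" by (simp add: dist_norm pos_less_divide_eq)
      moreover have "L * norm (y - x) \<le> norm (y - x) * (\<bar>L\<bar> + 1)"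
        using mult_right_mono[of L "\<bar>L\<bar> + 1" "norm (y - x)"] by (simp add: mult.commute)
      ultimately show "dist (\<phi> y) (\<phi> x) < e" using \<phi>(1)[of y x] by (simp add: dist_real_def)
    qed (use e in auto)
  qed
  have [measurable]: "f \<in> borel_measurable borel" "\<phi> \<in> borel_measurable borel" "(\<lambda>x. f' x v) \<in> borel_measurable borel"
    using cf c\<phi> f'(1) by (auto intro: borel_measurable_continuous_onI)
  note g(2)[measurable]
  have int\<phi>: "integrable lborel \<phi>" by (rule integrable_bounded_support[of _ 1 R']) (use \<phi> in auto)
  have intf: "integrable lborel f" by (rule integrable_bounded_support[of _ 1 R]) (use f in auto)
  have int\<phi>f: "integrable lborel (\<lambda>x. \<phi> x * f (x + a))" for a
  proof (rule Bochner_Integration.integrable_bound[OF int\<phi>])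
    show "AE x in lborel. norm (\<phi> x * f (x + a)) \<le> norm (\<phi> x)"
      using f(3) by (auto simp: abs_mult mult_left_le)
  qed measurable
  have int\<phi>f': "integrable lborel (\<lambda>x. \<phi> (x - a) * f x)" for a
    using lborel_integrable_translate[OF int\<phi>f[of a], of "-a"] by simp
  have shift: "(\<integral>x. \<phi> x * ((f (x + t k *\<^sub>R v) - f x) / t k) \<partial>lborel) = (\<integral>x. ((\<phi> (x + t k *\<^sub>R (-v)) - \<phi> x) / t k) * f x \<partial>lborel)" for k
  proof -
    have "(\<integral>x. \<phi> x * ((f (x + t k *\<^sub>R v) - f x) / t k) \<partial>lborel)
        = ((\<integral>x. \<phi> x * f (x + t k *\<^sub>R v) \<partial>lborel) - (\<integral>x. \<phi> x * f x \<partial>lborel)) / t k"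
      using int\<phi>f[of "t k *\<^sub>R v"] int\<phi>f[of 0] by (simp add: right_diff_distrib diff_divide_distrib)
    also have "(\<integral>x. \<phi> x * f (x + t k *\<^sub>R v) \<partial>lborel) = (\<integral>x. \<phi> (x - t k *\<^sub>R v) * f x \<partial>lborel)"
      using lborel_integral_translate[of "\<lambda>x. \<phi> (x - t k *\<^sub>R v) * f x" "t k *\<^sub>R v"] by simp
    also have "((\<integral>x. \<phi> (x - t k *\<^sub>R v) * f x \<partial>lborel) - (\<integral>x. \<phi> x * f x \<partial>lborel)) / t k
        = (\<integral>x. ((\<phi> (x + t k *\<^sub>R (-v)) - \<phi> x) / t k) * f x \<partial>lborel)"
      using int\<phi>f'[of "t k *\<^sub>R v"] int\<phi>f'[of 0] by (simp add: left_diff_distrib diff_divide_distrib)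
    finally show ?thesis .
  qed
  \<comment> \<open>The Lipschitz bounds on \<open>f\<close> along \<open>v\<close> and on \<phi>
    bound the two difference quotients uniformly in \<open>k\<close>; the other factor supplies
    integrability of the dominating function.\<close>
  have l1: "(\<lambda>k. \<integral>x. \<phi> x * ((f (x + t k *\<^sub>R v) - f x) / t k) \<partial>lborel) \<longlonglongrightarrow> (\<integral>x. \<phi> x * f' x v \<partial>lborel)"
  proof (rule integral_dominated_convergence[where w="\<lambda>x. M * \<bar>\<phi> x\<bar>"])
    show "integrable lborel (\<lambda>x. M * \<bar>\<phi> x\<bar>)" using int\<phi> by auto
    show "AE x in lborel. (\<lambda>k. \<phi> x * ((f (x + t k *\<^sub>R v) - f x) / t k)) \<longlonglongrightarrow> \<phi> x * f' x v"
      unfolding t_def by (intro AE_I2 tendsto_mult_left has_derivative_directional_LIMSEQ f)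
    fix k
    have "\<bar>(f (x + t k *\<^sub>R v) - f x) / t k\<bar> \<le> M" for x
      using lipf[of x "t k"] t[of k] by (simp add: divide_le_eq)
    then show "AE x in lborel. norm (\<phi> x * ((f (x + t k *\<^sub>R v) - f x) / t k)) \<le> M * \<bar>\<phi> x\<bar>"
      by (intro AE_I2) (simp only: real_norm_def abs_mult, metis mult.commute mult_left_mono abs_ge_zero)
  qed measurable
  have l2: "(\<lambda>k. \<integral>x. ((\<phi> (x + t k *\<^sub>R (-v)) - \<phi> x) / t k) * f x \<partial>lborel) \<longlonglongrightarrow> (\<integral>x. (g x \<bullet> (-v)) * f x \<partial>lborel)"
  proof (rule integral_dominated_convergence[where w="\<lambda>x. (L * norm v) * \<bar>f x\<bar>"])
    show "integrable lborel (\<lambda>x. (L * norm v) * \<bar>f x\<bar>)" using intf by auto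
    show "AE x in lborel. (\<lambda>k. ((\<phi> (x + t k *\<^sub>R (-v)) - \<phi> x) / t k) * f x) \<longlonglongrightarrow> (g x \<bullet> (-v)) * f x"
      using g(1)
    proof eventually_elim
      case (elim x)
      show ?case unfolding t_def by (intro tendsto_mult_right has_derivative_directional_LIMSEQ[OF elim])
    qed
    fix k
    have "\<bar>(\<phi> (x + t k *\<^sub>R (-v)) - \<phi> x) / t k\<bar> \<le> L * norm v" for x
      using \<phi>(1)[of "x + t k *\<^sub>R (-v)" x] t[of k] by (simp add: divide_le_eq mult_ac)
    then show "AE x in lborel. norm (((\<phi> (x + t k *\<^sub>R (-v)) - \<phi> x) / t k) * f x) \<le> (L * norm v) * \<bar>f x\<bar>"
      by (intro AE_I2) (simp only: real_norm_def abs_mult mult_right_mono abs_ge_zero)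
  qed measurable
  have "(\<integral>x. \<phi> x * f' x v \<partial>lborel) = (\<integral>x. (g x \<bullet> (-v)) * f x \<partial>lborel)"
    using LIMSEQ_unique[OF l1] l2 unfolding shift by blast
  then show ?thesis by simp
qed

section \<open>Lipschitz cutoff of the unit ball\<close>

definition cone_cutoff :: "real \<Rightarrow> 'a::euclidean_space \<Rightarrow> real" where
  "cone_cutoff e x = max 0 (min 1 ((1 + e - norm x) / e))"

text \<open>The gradient of \<open>cone_cutoff\<close> for e > 0, set to 0 on the two spheres where
  the cutoff has a kink. They are null sets, so the derivative is correct almost everywhere.\<close>

definition cone_grad :: "real \<Rightarrow> 'a::euclidean_space \<Rightarrow> 'a" where
  "cone_grad e x = (if 1 < norm x \<and> norm x < 1 + e then - (1 / e) *\<^sub>R sgn x else 0)"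

lemma cone_cutoff_lipschitz:
  assumes "e > 0"
  shows "\<bar>cone_cutoff e x - cone_cutoff e y\<bar> \<le> (1 / e) * norm (x - y)"
proof -
  have "\<bar>cone_cutoff e x - cone_cutoff e y\<bar> \<le> \<bar>(1 + e - norm x) / e - (1 + e - norm y) / e\<bar>"
    unfolding cone_cutoff_def by linarith
  also have "\<dots> = \<bar>norm y - norm x\<bar> / e"
    using assms by (simp add: diff_divide_distrib[symmetric])
  also have "\<dots> \<le> norm (y - x) / e"
    using assms norm_triangle_ineq3[of y x] by (intro divide_right_mono) auto
  finally show ?thesis by (simp add: norm_minus_commute)
qed

lemma cone_cutoff_derivative:
  assumes "e > 0" "norm x \<noteq> 1" "norm x \<noteq> 1 + e"
  shows "(cone_cutoff e has_derivative (\<lambda>h. cone_grad e x \<bullet> h)) (at x)"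
proof -
  consider "norm x < 1" | "1 + e < norm x" | "1 < norm x" "norm x < 1 + e"
    using assms by linarith
  then show ?thesis
  proof cases
    case 1
    have "((\<lambda>_. 1) has_derivative (\<lambda>h. cone_grad e x \<bullet> h)) (at x)"
      using 1 by (simp add: cone_grad_def)
    then show ?thesis
      by (rule has_derivative_transform_within_open[of _ _ _ _ "ball 0 1"])
        (use 1 assms in \<open>auto simp: cone_cutoff_def field_simps min_def max_def\<close>)
  next
    case 2
    have "((\<lambda>_. 0) has_derivative (\<lambda>h. cone_grad e x \<bullet> h)) (at x)"
      using 2 by (simp add: cone_grad_def)
    then show ?thesis
      by (rule has_derivative_transform_within_open[of _ _ _ _ "- cball 0 (1 + e)"])
        (use 2 assms in \<open>auto simp: cone_cutoff_def field_simps min_def max_def\<close>)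
  next
    case 3
    then have "x \<noteq> 0" by auto
    then have "((\<lambda>x. (1 + e - norm x) / e) has_derivative (\<lambda>h. cone_grad e x \<bullet> h)) (at x)"
      using 3 by (auto intro!: derivative_eq_intros has_derivative_norm simp: cone_grad_def inner_commute)
    then show ?thesis
      by (rule has_derivative_transform_within_open[of _ _ _ _ "ball 0 (1 + e) - cball 0 1"])
        (use 3 assms in \<open>auto simp: cone_cutoff_def field_simps min_def max_def\<close>)
  qed
qed

lemma sphere_null_sets: "sphere a r \<in> null_sets (lborel :: 'a::euclidean_space measure)"
  using negligible_sphere[of a r] by (auto simp: negligible_iff_null_sets null_sets_completion_iff)

lemma measure_lborel_ball:
  assumes "r \<ge> 0"
  shows "measure lborel (ball (c::'a::euclidean_space) r) = r ^ DIM('a) * measure lborel (ball (0::'a) 1)"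
  using content_ball_conv_unit_ball[OF assms, of c] .

lemma norm_cone_grad_le: "e > 0 \<Longrightarrow> norm (cone_grad e x) \<le> (1 / e) * indicator (ball 0 (1 + e) - ball 0 1) x"
  by (auto simp: cone_grad_def indicator_def norm_sgn)

lemma measure_annulus:
  assumes "e \<ge> 0"
  shows "ball (0::'a::euclidean_space) (1 + e) - ball 0 1 \<in> fmeasurable lborel"
    "measure lborel (ball (0::'a) (1 + e) - ball 0 1) = ((1 + e) ^ DIM('a) - 1) * measure lborel (ball (0::'a) 1)"
proof -
  have fm: "ball (0::'a) r \<in> fmeasurable lborel" for r
    by (intro fmeasurable_lborel_bounded) auto
  show "ball (0::'a) (1 + e) - ball 0 1 \<in> fmeasurable lborel"
    by (intro fmeasurable.Diff fm)
  have "measure lborel (ball (0::'a) (1 + e) - ball 0 1) = measure lborel (ball (0::'a) (1 + e)) - measure lborel (ball (0::'a) 1)"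
    using assms fm[of "1 + e"] fm[of 1] by (intro measure_Diff) (auto simp: fmeasurable_def)
  also have "\<dots> = ((1 + e) ^ DIM('a) - 1) * measure lborel (ball (0::'a) 1)"
    using measure_lborel_ball[of "1 + e" "0::'a"] assms by (simp add: left_diff_distrib)
  finally show "measure lborel (ball (0::'a) (1 + e) - ball 0 1) = ((1 + e) ^ DIM('a) - 1) * measure lborel (ball (0::'a) 1)" .
qed

lemma sum_inner_axis: "(\<Sum>i\<in>UNIV. (u \<bullet> axis i 1) * (w :: real^'n) $ i) = u \<bullet> w"
  by (simp add: inner_vec_def[of u w] cart_eq_inner_axis)

lemma matrix_vector_mult_axis: "((A::real^'n^'n) *v axis i 1) $ i = A $ i $ i"
  by (simp add: matrix_vector_mult_basis column_def)

text \<open>Stands in for the divergence theorem on the ball: the indicator function is replaced by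
  a cutoff whose gradient has norm 1/e on an annulus of thickness e, so that the surface area
  appears as the limit of the volume of the annulus divided by e.\<close>

lemma divergence_ball_le:
  fixes F :: "real^'n \<Rightarrow> real^'n"
  assumes F: "C1_compact_support F" "\<And>x. norm (F x) \<le> 1"
  shows "(LINT x:ball 0 1|lebesgue. divergence F x) \<le> real CARD('n) * measure lborel (ball (0::real^'n) 1)"
proof -
  let ?w = "measure lborel (ball (0::real^'n) 1)"
  let ?n = "CARD('n)"
  obtain M R where MR: "0 < R" "\<And>x. norm x > R \<Longrightarrow> F x = 0 \<and> jacobian F (at x) = 0"
    "0 \<le> M" "\<And>x i j. \<bar>jacobian F (at x) $ i $ j\<bar> \<le> M"
    using C1_compact_support_bounds[OF F(1)] by metis
  note dF = C1_compact_supportD[OF F(1)]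
  have divF: "divergence F x = (\<Sum>i\<in>UNIV. jacobian F (at x) $ i $ i)" for x
    by (simp add: divergence_def trace_def)
  have divM: "\<bar>divergence F x\<bar> \<le> ?n * M" for x
    unfolding divF using sum_bounded_above[of UNIV "\<lambda>i. \<bar>jacobian F (at x) $ i $ i\<bar>" M] MR(4)
    by (intro order_trans[OF sum_abs]) auto
  have mdiv[measurable]: "divergence F \<in> borel_measurable borel"
    using dF(5) by (rule borel_measurable_continuous_onI)
  have mF[measurable]: "F \<in> borel_measurable borel"
    using dF(3) by (rule borel_measurable_continuous_onI)
  have mFi[measurable]: "(\<lambda>x. F x $ i) \<in> borel_measurable borel" for i
    by (intro borel_measurable_continuous_onI continuous_intros dF)
  \<comment> \<open>The mean value inequality along a coordinate line; it gives the uniform bound on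
    difference quotients that \<open>integral_by_parts_partial\<close> asks for.\<close>
  have lip: "\<bar>F (x + t *\<^sub>R axis i 1) $ i - F x $ i\<bar> \<le> M * \<bar>t\<bar>" for x t i
  proof -
    have "norm (F (x + t *\<^sub>R axis i 1) $ i - F (x + 0 *\<^sub>R axis i 1) $ i) \<le> M * norm (t - 0)"
    proof (rule differentiable_bound[of UNIV "\<lambda>s. F (x + s *\<^sub>R axis i 1) $ i" "\<lambda>s h. h * jacobian F (at (x + s *\<^sub>R axis i 1)) $ i $ i"])
      fix s
      have "((\<lambda>s. F (x + s *\<^sub>R axis i 1) $ i) has_derivative
          (\<lambda>h. (jacobian F (at (x + s *\<^sub>R axis i 1)) *v (h *\<^sub>R axis i 1)) $ i)) (at s)"
        by (rule has_derivative_compose[OF _ dF(2)]) (auto intro!: derivative_eq_intros)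
      then show "((\<lambda>s. F (x + s *\<^sub>R axis i 1) $ i) has_derivative (\<lambda>h. h * jacobian F (at (x + s *\<^sub>R axis i 1)) $ i $ i)) (at s within UNIV)"
        by (simp add: matrix_vector_mult_scaleR matrix_vector_mult_axis)
      show "onorm (\<lambda>h. h * jacobian F (at (x + s *\<^sub>R axis i 1)) $ i $ i) \<le> M"
        using MR(4)[of "x + s *\<^sub>R axis i 1" i i]
        by (intro onorm_bound MR) (auto simp: abs_mult mult.commute[of M] intro!: mult_left_mono)
    qed auto
    then show ?thesis by simp
  qed
  \<comment> \<open>The first term bounds the integral against the cutoff after integration by
    parts, namely 1/e times the volume of the annulus. The second is the error of replacing the
    indicator by the cutoff: they differ only on the closed annulus, where the divergence is at most
    n M in absolute value.\<close>
  have main: "(\<integral>x. indicator (ball 0 1) x * divergence F x \<partial>lborel)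
      \<le> ((1 + e) ^ ?n - 1) / e * ?w + ?n * M * (((1 + e) ^ ?n - 1) * ?w)" if e: "0 < e" for e
  proof -
    define \<phi> where "\<phi> = (cone_cutoff e :: real^'n \<Rightarrow> real)"
    define g where "g = (cone_grad e :: real^'n \<Rightarrow> real^'n)"
    define An where "An = ball (0::real^'n) (1 + e) - ball 0 1"
    have An[measurable]: "An \<in> fmeasurable lborel" "measure lborel An = ((1 + e) ^ ?n - 1) * ?w"
      using measure_annulus[of e, where 'a="real^'n"] e by (simp_all add: An_def)
    have intA: "integrable lborel (\<lambda>x. indicator An x :: real)"
      using An(1) by (auto simp: fmeasurable_def)
    have intAm: "(\<integral>x. indicator An x \<partial>lborel) = measure lborel An" by simp
    have gm[measurable]: "g \<in> borel_measurable borel"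
      unfolding g_def cone_grad_def[abs_def] sgn_div_norm by measurable
    have gA: "norm (g x) \<le> (1 / e) * indicator An x" for x
      using norm_cone_grad_le[OF e, of x] by (simp add: g_def An_def)
    have \<phi>01: "0 \<le> \<phi> x" "\<phi> x \<le> 1" for x by (auto simp: \<phi>_def cone_cutoff_def)
    have \<phi>out: "\<phi> x = 0" if "norm x > 1 + e" for x using that e by (auto simp: \<phi>_def cone_cutoff_def field_simps max_def)
    have \<phi>1: "\<phi> x = 1" if "norm x < 1" for x using that e by (auto simp: \<phi>_def cone_cutoff_def field_simps)
    have ibp: "(\<integral>x. \<phi> x * (jacobian F (at x) *v axis i 1) $ i \<partial>lborel) = - (\<integral>x. (g x \<bullet> axis i 1) * F x $ i \<partial>lborel)" for i
    proof (rule integral_by_parts_partial[where R=R and R'="1 + e" and L="1 / e" and M=M and f'="\<lambda>x h. (jacobian F (at x) *v h) $ i"])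
      have "AE x in lborel. x \<notin> sphere (0::real^'n) 1" "AE x in lborel. x \<notin> sphere (0::real^'n) (1 + e)"
        by (rule AE_not_in[OF sphere_null_sets])+
      then show "AE x in lborel. (\<phi> has_derivative (\<lambda>h. g x \<bullet> h)) (at x)"
      proof eventually_elim
        case (elim x)
        then show ?case unfolding \<phi>_def g_def by (intro cone_cutoff_derivative e) auto
      qed
      show "continuous_on UNIV (\<lambda>x. (jacobian F (at x) *v axis i 1) $ i)"
        by (simp add: matrix_vector_mult_axis) (intro continuous_intros dF)
      show "\<bar>F x $ i\<bar> \<le> 1" for x using component_le_norm_cart[of "F x" i] F(2)[of x] by simp
      show "\<bar>\<phi> x - \<phi> y\<bar> \<le> 1 / e * norm (x - y)" for x y unfolding \<phi>_def by (rule cone_cutoff_lipschitz[OF e])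
      show "\<bar>\<phi> x\<bar> \<le> 1" for x using \<phi>01[of x] by simp
    qed (use MR dF(2) lip \<phi>out gm in \<open>auto simp: matrix_vector_mult_axis\<close>)
    have m\<phi>[measurable]: "\<phi> \<in> borel_measurable borel" unfolding \<phi>_def cone_cutoff_def[abs_def] by measurable
    have mJ[measurable]: "(\<lambda>x. jacobian F (at x) $ i $ i) \<in> borel_measurable borel" for i
      by (intro borel_measurable_continuous_onI continuous_intros dF)
    have int1: "integrable lborel (\<lambda>x. \<phi> x * jacobian F (at x) $ i $ i)" for i
    proof (rule integrable_bounded_support[of _ M R])
      fix x
      have "\<bar>\<phi> x\<bar> * \<bar>jacobian F (at x) $ i $ i\<bar> \<le> 1 * M"
        using MR(3,4) \<phi>01[of x] by (intro mult_mono) auto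
      then show "norm (\<phi> x * jacobian F (at x) $ i $ i) \<le> M" by (simp add: abs_mult)
    qed (use MR(2) in auto)
    have int2: "integrable lborel (\<lambda>x. (g x \<bullet> axis i 1) * F x $ i)" for i
    proof (rule Bochner_Integration.integrable_bound[OF integrable_mult_right[OF intA]])
      show "AE x in lborel. norm ((g x \<bullet> axis i 1) * F x $ i) \<le> norm ((1 / e) * indicator An x)"
      proof (rule AE_I2)
        fix x
        have "\<bar>g x \<bullet> axis i 1\<bar> * \<bar>F x $ i\<bar> \<le> norm (g x) * 1"
        proof (intro mult_mono)
          show "\<bar>g x \<bullet> axis i 1\<bar> \<le> norm (g x)"
            by (simp add: cart_eq_inner_axis[symmetric] component_le_norm_cart)
          show "\<bar>F x $ i\<bar> \<le> 1" using component_le_norm_cart[of "F x" i] F(2)[of x] by linarith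
        qed simp_all
        also have "\<dots> \<le> norm ((1 / e) * indicator An x)" using gA[of x] e by simp
        finally show "norm ((g x \<bullet> axis i 1) * F x $ i) \<le> norm ((1 / e) * indicator An x)"
          by (simp add: abs_mult)
      qed
    qed measurable
    have "(\<integral>x. \<phi> x * divergence F x \<partial>lborel) = (\<Sum>i\<in>UNIV. \<integral>x. \<phi> x * jacobian F (at x) $ i $ i \<partial>lborel)"
      using int1 by (simp add: divF sum_distrib_left)
    also have "\<dots> = (\<Sum>i\<in>UNIV. - (\<integral>x. (g x \<bullet> axis i 1) * F x $ i \<partial>lborel))"
      using ibp by (simp add: matrix_vector_mult_axis)
    also have "\<dots> = - (\<integral>x. g x \<bullet> F x \<partial>lborel)"
      using int2 by (simp add: sum_negf Bochner_Integration.integral_sum[symmetric] sum_inner_axis)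
    also have "\<dots> \<le> (\<integral>x. (1 / e) * indicator An x \<partial>lborel)"
    proof -
      have "integrable lborel (\<lambda>x. g x \<bullet> F x)"
      proof -
        have "integrable lborel (\<lambda>x. \<Sum>i\<in>UNIV. (g x \<bullet> axis i 1) * F x $ i)"
          using int2 by (intro Bochner_Integration.integrable_sum) auto
        then show ?thesis by (simp only: sum_inner_axis)
      qed
      moreover have "- (g x \<bullet> F x) \<le> (1 / e) * indicator An x" for x
      proof -
        have "\<bar>g x \<bullet> F x\<bar> \<le> norm (g x) * norm (F x)" by (rule Cauchy_Schwarz_ineq2)
        also have "\<dots> \<le> norm (g x)" using F(2)[of x] by (simp add: mult_left_le)
        finally show ?thesis using gA[of x] by linarith
      qed
      ultimately show ?thesis
        using intA by (subst Bochner_Integration.integral_minus[symmetric], intro integral_mono) auto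
    qed
    also have "\<dots> = ((1 + e) ^ ?n - 1) / e * ?w" using intAm An(2) by simp
    finally have A: "(\<integral>x. \<phi> x * divergence F x \<partial>lborel) \<le> ((1 + e) ^ ?n - 1) / e * ?w" .
    have int3: "integrable lborel (\<lambda>x. \<phi> x * divergence F x)"
      using int1 by (simp add: divF sum_distrib_left)
    have int4: "integrable lborel (\<lambda>x. indicator (ball 0 1) x * divergence F x)"
      using MR divM by (intro integrable_bounded_support[of _ "?n * M" 1]) (auto simp: indicator_def)
    have "(\<integral>x. indicator (ball 0 1) x * divergence F x \<partial>lborel) - (\<integral>x. \<phi> x * divergence F x \<partial>lborel)
       = (\<integral>x. indicator (ball 0 1) x * divergence F x - \<phi> x * divergence F x \<partial>lborel)"
      using int3 int4 by simp
    also have "\<dots> \<le> (\<integral>x. ?n * M * indicator An x \<partial>lborel)"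
    proof (intro integral_mono integrable_mult_right intA Bochner_Integration.integrable_diff int3 int4)
      fix x
      consider "norm x < 1" | "x \<in> An" | "norm x > 1 + e" | "norm x = 1 + e" by (force simp: An_def)
      then show "indicator (ball 0 1) x * divergence F x - \<phi> x * divergence F x \<le> ?n * M * indicator An x"
      proof cases
        case 2
        have "- (\<phi> x * divergence F x) \<le> \<phi> x * \<bar>divergence F x\<bar>"
          using \<phi>01[of x] abs_ge_minus_self[of "\<phi> x * divergence F x"] by (simp add: abs_mult)
        also have "\<dots> \<le> 1 * \<bar>divergence F x\<bar>"
          using \<phi>01[of x] by (intro mult_right_mono) auto
        finally have "- (\<phi> x * divergence F x) \<le> \<bar>divergence F x\<bar>" by simp
        then show ?thesis using 2 divM[of x] by (simp add: An_def)
      next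
        case 4
        then have "\<phi> x = 0" by (simp add: \<phi>_def cone_cutoff_def)
        then show ?thesis using 4 e MR(3) by simp
      qed (use \<phi>1 \<phi>out e MR(3) in auto)
    qed
    also have "\<dots> = ?n * M * (((1 + e) ^ ?n - 1) * ?w)" using An(2) by simp
    finally show ?thesis using A by linarith
  qed
  \<comment> \<open>The quotient is the difference quotient of the n-th power at 1, so the first
    term tends to n |B_1| and the error term to 0.\<close>
  have lim: "((\<lambda>e. ((1 + e) ^ ?n - 1) / e * ?w + ?n * M * (((1 + e) ^ ?n - 1) * ?w)) \<longlongrightarrow>
      ?n * ?w + ?n * M * (((1 + 0) ^ ?n - 1) * ?w)) (at_right 0)"
  proof (intro tendsto_intros)
    have "((\<lambda>x. x ^ ?n) has_real_derivative ?n) (at (1::real))"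
      by (auto intro!: derivative_eq_intros)
    then have "((\<lambda>e. ((1 + e) ^ ?n - 1) / e) \<longlongrightarrow> ?n) (at (0::real))"
      by (simp add: DERIV_def)
    then show "((\<lambda>e. ((1 + e) ^ ?n - 1) / e) \<longlongrightarrow> ?n) (at_right (0::real))"
      by (rule tendsto_mono[rotated]) (simp add: at_le)
  qed
  have ev: "eventually (\<lambda>e. (\<integral>x. indicator (ball 0 1) x * divergence F x \<partial>lborel)
      \<le> ((1 + e) ^ ?n - 1) / e * ?w + ?n * M * (((1 + e) ^ ?n - 1) * ?w)) (at_right (0::real))"
    using main by (auto simp: eventually_at_right_field intro!: exI[of _ 1])
  have "(\<integral>x. indicator (ball 0 1) x * divergence F x \<partial>lborel) \<le> ?n * ?w + ?n * M * (((1 + 0) ^ ?n - 1) * ?w)"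
    by (rule tendsto_lowerbound[OF lim ev]) simp
  moreover have "(LINT x:ball 0 1|lebesgue. divergence F x) = (\<integral>x. indicator (ball 0 1) x *\<^sub>R divergence F x \<partial>lborel)"
    unfolding set_lebesgue_integral_def
    by (rule integral_completion) (intro borel_measurable_scaleR borel_measurable_indicator, use mdiv in simp_all)
  ultimately show ?thesis by simp
qed

theorem perimeter_unit_ball_le:
  "perimeter (ball (0::real^'n) 1) \<le> ereal (real CARD('n) * measure lborel (ball (0::real^'n) 1))"
  unfolding perimeter_def by (intro SUP_least) (auto intro: divergence_ball_le)

section \<open>Smoothing and the perimeter\<close>

text \<open>\<open>G\<close> is the gradient of \<rho>. It enters through a remainder bound that is
  quadratic in \<open>z\<close> and uniform in \<open>w\<close>, which can be integrated over
  \<Omega> directly; this gives both differentiability of convolutions and the growth estimate of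
  the smoothed indicator. Evenness makes averaging in either argument of \<rho>(x - y) the same
  operation.\<close>

locale smoothing_kernel =
  fixes \<rho> :: "'a::euclidean_space \<Rightarrow> real" and G :: "'a \<Rightarrow> 'a" and e C L :: real
  assumes e: "0 < e"
    and \<rho>_nonneg: "0 \<le> \<rho> w" and \<rho>_cont: "continuous_on UNIV \<rho>" and \<rho>_le: "\<rho> w \<le> C"
    and \<rho>_support: "e \<le> norm w \<Longrightarrow> \<rho> w = 0" and \<rho>_integral: "(\<integral>w. \<rho> w \<partial>lborel) = 1"
    and \<rho>_even: "\<rho> (- w) = \<rho> w"
    and G_cont: "continuous_on UNIV G" and G_le: "norm (G w) \<le> C" and G_support: "e \<le> norm w \<Longrightarrow> G w = 0"
    and taylor: "norm z \<le> 1 \<Longrightarrow> \<bar>\<rho> (w + z) - \<rho> w - G w \<bullet> z\<bar> \<le> L * (norm z)\<^sup>2"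

text \<open>The square of the positive part has a Lipschitz derivative although its second
  derivative jumps at 0, so the first-order remainder is still quadratic. This is the source of the
  bound \<open>taylor\<close> of the kernel.\<close>

lemma max_zero_square_taylor:
  fixes s t :: real
  shows "0 \<le> (max 0 t)\<^sup>2 - (max 0 s)\<^sup>2 - 2 * max 0 s * (t - s)"
    and "(max 0 t)\<^sup>2 - (max 0 s)\<^sup>2 - 2 * max 0 s * (t - s) \<le> (t - s)\<^sup>2"
proof -
  consider "0 \<le> s" "0 \<le> t" | "0 \<le> s" "t < 0" | "s < 0" "0 \<le> t" | "s < 0" "t < 0" by linarith
  moreover have sq: "(t - s)\<^sup>2 = t\<^sup>2 + s\<^sup>2 - 2 * (s * t)"
    by (simp add: power2_eq_square algebra_simps)
  ultimately have "0 \<le> (max 0 t)\<^sup>2 - (max 0 s)\<^sup>2 - 2 * max 0 s * (t - s) \<and>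
    (max 0 t)\<^sup>2 - (max 0 s)\<^sup>2 - 2 * max 0 s * (t - s) \<le> (t - s)\<^sup>2"
  proof cases
    case 1
    have "t\<^sup>2 - s\<^sup>2 - 2 * s * (t - s) = (t - s)\<^sup>2" by (simp add: power2_eq_square algebra_simps)
    then show ?thesis using 1 by simp
  next
    case 2
    have "s * t \<le> 0" "0 \<le> s\<^sup>2" "0 \<le> t\<^sup>2" using 2 by (auto simp: mult_le_0_iff)
    moreover have "(max 0 t)\<^sup>2 - (max 0 s)\<^sup>2 - 2 * max 0 s * (t - s) = s\<^sup>2 - 2 * (s * t)"
      using 2 by (simp add: power2_eq_square algebra_simps)
    ultimately show ?thesis unfolding sq by linarith
  next
    case 3
    have "s * t \<le> 0" "0 \<le> s\<^sup>2" "0 \<le> t\<^sup>2" using 3 by (auto simp: mult_le_0_iff)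
    moreover have "(max 0 t)\<^sup>2 - (max 0 s)\<^sup>2 - 2 * max 0 s * (t - s) = t\<^sup>2"
      using 3 by simp
    ultimately show ?thesis unfolding sq by linarith
  next
    case 4
    then show ?thesis by simp
  qed
  then show "0 \<le> (max 0 t)\<^sup>2 - (max 0 s)\<^sup>2 - 2 * max 0 s * (t - s)"
    "(max 0 t)\<^sup>2 - (max 0 s)\<^sup>2 - 2 * max 0 s * (t - s) \<le> (t - s)\<^sup>2" by auto
qed

lemma smoothing_kernel_exists:
  assumes e: "0 < e"
  shows "\<exists>(\<rho> :: 'a::euclidean_space \<Rightarrow> real) G C L. smoothing_kernel \<rho> G e C L"
proof -
  \<comment> \<open>A polynomial bump cut off at radius e; squaring the positive part makes it C^1
    with a Lipschitz gradient \<open>D\<close>.\<close>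
  define b where "b w = (max 0 (e\<^sup>2 - (norm w)\<^sup>2))\<^sup>2" for w :: 'a
  define D where "D w = (- 4 * max 0 (e\<^sup>2 - (norm w)\<^sup>2)) *\<^sub>R w" for w :: 'a
  \<comment> \<open>The term 2 e^2 comes from the quadratic part of the change of e^2 - |w|^2,
    weighted by \<open>2 * max 0 s\<close>. The term (2 e + 3)^2 comes from \<bar>t - s\<bar> \<le>
    (2 |w| + |z|) |z| with |w| <= e + 1 and |z| <= 1.\<close>
  define K where "K = 2 * e\<^sup>2 + (2 * e + 3)\<^sup>2"
  have out: "max 0 (e\<^sup>2 - (norm w)\<^sup>2) = 0" if "e \<le> norm w" for w :: 'a
    using power_mono[OF that, of 2] e by simp
  have b_nonneg: "0 \<le> b w" for w by (simp add: b_def)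
  have m: "0 \<le> max 0 (e\<^sup>2 - (norm w)\<^sup>2)" "max 0 (e\<^sup>2 - (norm w)\<^sup>2) \<le> e\<^sup>2" for w :: 'a by auto
  have b_le: "b w \<le> (e\<^sup>2)\<^sup>2" for w
    unfolding b_def by (intro power_mono m)
  have b_cont: "continuous_on UNIV b" unfolding b_def by (intro continuous_intros)
  have D_cont: "continuous_on UNIV D" unfolding D_def by (intro continuous_intros)
  have b_out: "b w = 0" "D w = 0" if "e \<le> norm w" for w using out[OF that] by (simp_all add: b_def D_def)
  have D_le: "norm (D w) \<le> 4 * e\<^sup>2 * e" for w
  proof (cases "e \<le> norm w")
    case True
    then show ?thesis using b_out e by simp
  next
    case False
    have "norm (D w) = 4 * max 0 (e\<^sup>2 - (norm w)\<^sup>2) * norm w" by (simp add: D_def)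
    also have "\<dots> \<le> 4 * e\<^sup>2 * e" using m[of w] False by (intro mult_mono mult_left_mono) auto
    finally show ?thesis .
  qed
  have tay: "\<bar>b (w + z) - b w - D w \<bullet> z\<bar> \<le> K * (norm z)\<^sup>2" if z: "norm z \<le> 1" for w z
  proof (cases "norm w \<le> e + 1")
    case False
    \<comment> \<open>For |w| > e + 1 and |z| <= 1 both \<open>w\<close> and \<open>w + z\<close>
      are outside the support, and the remainder is 0.\<close>
    have "norm w - norm z \<le> norm (w + z)" using norm_triangle_ineq4[of "w + z" z] by simp
    then show ?thesis using b_out[of w] b_out[of "w + z"] False z e
      by (simp add: K_def)
  next
    case True
    define s where "s = e\<^sup>2 - (norm w)\<^sup>2"
    define t where "t = e\<^sup>2 - (norm (w + z))\<^sup>2"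
    have ts: "t - s = - (2 * (w \<bullet> z) + (norm z)\<^sup>2)"
      by (simp add: s_def t_def power2_norm_eq_inner inner_simps inner_commute)
    define T where "T = (max 0 t)\<^sup>2 - (max 0 s)\<^sup>2 - 2 * max 0 s * (t - s)"
    have eq: "b (w + z) - b w - D w \<bullet> z = T - 2 * max 0 s * (norm z)\<^sup>2"
      unfolding T_def ts by (simp add: b_def D_def s_def t_def algebra_simps)
    have "\<bar>t - s\<bar> \<le> 2 * (norm w * norm z) + norm z * norm z"
      unfolding ts power2_eq_square using Cauchy_Schwarz_ineq2[of w z] mult_nonneg_nonneg[OF norm_ge_zero norm_ge_zero, of z z]
      by linarith
    also have "\<dots> \<le> (2 * e + 3) * norm z"
    proof -
      have "2 * norm w + norm z \<le> 2 * e + 3" using True z by simp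
      then have "(2 * norm w + norm z) * norm z \<le> (2 * e + 3) * norm z" by (rule mult_right_mono) simp
      then show ?thesis by (simp add: algebra_simps)
    qed
    finally have "(t - s)\<^sup>2 \<le> ((2 * e + 3) * norm z)\<^sup>2" by (rule abs_le_square_iff[THEN iffD1, OF order_trans]) simp
    then have T: "0 \<le> T" "T \<le> (2 * e + 3)\<^sup>2 * (norm z)\<^sup>2"
      using max_zero_square_taylor[of t s] by (auto simp: T_def power_mult_distrib)
    have "0 \<le> max 0 s * (norm z)\<^sup>2" by simp
    moreover have "max 0 s * (norm z)\<^sup>2 \<le> e\<^sup>2 * (norm z)\<^sup>2"
      using m(2)[of w] unfolding s_def by (intro mult_right_mono) auto
    moreover have "K * (norm z)\<^sup>2 = 2 * (e\<^sup>2 * (norm z)\<^sup>2) + (2 * e + 3)\<^sup>2 * (norm z)\<^sup>2"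
      by (simp add: K_def algebra_simps)
    moreover have "0 \<le> (2 * e + 3)\<^sup>2 * (norm z)\<^sup>2" "0 \<le> e\<^sup>2 * (norm z)\<^sup>2" by auto
    ultimately show ?thesis unfolding eq using T by linarith
  qed
  have b_int: "integrable lborel b"
    by (rule integrable_bounded_support[of _ "(e\<^sup>2)\<^sup>2" e])
      (use b_cont b_le b_out b_nonneg in \<open>auto intro: borel_measurable_continuous_onI\<close>)
  define c where "c = (\<integral>w. b w \<partial>lborel)"
  have c: "0 < c"
  proof -
    have "c \<noteq> 0"
    proof
      assume "c = 0"
      then have "AE w in lborel. b w = 0"
        using integral_nonneg_eq_0_iff_AE[OF b_int] b_nonneg by (simp add: c_def)
      moreover have "b w \<noteq> 0" if "w \<in> ball 0 e" for w
        using that e power_strict_mono[of "norm w" e 2] by (simp add: b_def)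
      ultimately have "AE w in lborel. w \<notin> ball (0::'a) e" by (auto elim: eventually_mono)
      then have "emeasure lborel (ball (0::'a) e) = 0"
        by (subst (asm) AE_iff_measurable[of "ball (0::'a) e"]) auto
      then show False using content_ball_pos[OF e, of "0::'a"] by (simp add: measure_def)
    qed
    moreover have "0 \<le> c" unfolding c_def by (intro integral_nonneg_AE) (simp add: b_nonneg)
    ultimately show ?thesis by simp
  qed
  define C where "C = ((e\<^sup>2)\<^sup>2 + 4 * e\<^sup>2 * e) / c"
  have "smoothing_kernel (\<lambda>w. b w / c) (\<lambda>w. (1 / c) *\<^sub>R D w) e C (K / c)"
  proof
    fix w z :: 'a
    have "(e\<^sup>2)\<^sup>2 \<ge> 0" "4 * e\<^sup>2 * e \<ge> 0" using e by auto
    then have "b w \<le> (e\<^sup>2)\<^sup>2 + 4 * e\<^sup>2 * e" "norm (D w) \<le> (e\<^sup>2)\<^sup>2 + 4 * e\<^sup>2 * e"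
      using b_le[of w] D_le[of w] by linarith+
    then show "b w / c \<le> C" "norm ((1 / c) *\<^sub>R D w) \<le> C"
      using c divide_right_mono[of _ "(e\<^sup>2)\<^sup>2 + 4 * e\<^sup>2 * e" c] by (auto simp: C_def)
    assume z: "norm z \<le> 1"
    have "b (w + z) / c - b w / c - ((1 / c) *\<^sub>R D w) \<bullet> z = (b (w + z) - b w - D w \<bullet> z) / c"
      by (simp add: diff_divide_distrib)
    then show "\<bar>b (w + z) / c - b w / c - ((1 / c) *\<^sub>R D w) \<bullet> z\<bar> \<le> K / c * (norm z)\<^sup>2"
      using tay[OF z, of w] c by (simp add: divide_right_mono)
  next
    show "(\<integral>w. b w / c \<partial>lborel) = 1" using c by (simp add: c_def)
  qed (use e c b_nonneg b_out b_cont D_cont in \<open>auto simp: b_def intro!: continuous_intros\<close>)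
  then show ?thesis by blast
qed

section \<open>Convolution with the kernel\<close>

lemma continuous_convolution:
  fixes g f :: "'a::euclidean_space \<Rightarrow> real"
  assumes g: "continuous_on UNIV g" "\<And>w. \<bar>g w\<bar> \<le> C" and f: "integrable lborel f"
  shows "continuous_on UNIV (\<lambda>x. \<integral>y. g (x - y) * f y \<partial>lborel)"
  unfolding continuous_on_sequentially comp_def
proof (intro ballI allI impI)
  fix X :: "nat \<Rightarrow> 'a" and a :: 'a
  assume "(\<forall>n. X n \<in> UNIV) \<and> X \<longlonglongrightarrow> a"
  then have X: "X \<longlonglongrightarrow> a" by simp
  have [measurable]: "g \<in> borel_measurable borel" "f \<in> borel_measurable borel"
    using g f by (auto intro: borel_measurable_continuous_onI)
  show "(\<lambda>n. \<integral>y. g (X n - y) * f y \<partial>lborel) \<longlonglongrightarrow> (\<integral>y. g (a - y) * f y \<partial>lborel)"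
  proof (rule integral_dominated_convergence[where w="\<lambda>y. C * \<bar>f y\<bar>"])
    show "integrable lborel (\<lambda>y. C * \<bar>f y\<bar>)" using f by auto
    show "AE y in lborel. (\<lambda>n. g (X n - y) * f y) \<longlonglongrightarrow> g (a - y) * f y"
    proof (intro AE_I2 tendsto_mult_right)
      fix y
      show "(\<lambda>n. g (X n - y)) \<longlonglongrightarrow> g (a - y)"
        by (rule continuous_on_tendsto_compose[OF g(1)]) (auto intro!: tendsto_intros X)
    qed
    show "AE y in lborel. norm (g (X n - y) * f y) \<le> C * \<bar>f y\<bar>" for n
      using g(2) by (auto simp: abs_mult intro!: mult_right_mono)
  qed measurable
qed

lemma has_derivative_quadratic:
  fixes f :: "'a::real_normed_vector \<Rightarrow> 'b::real_normed_vector"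
  assumes "bounded_linear f'" "\<And>h. norm h \<le> 1 \<Longrightarrow> norm (f (x + h) - f x - f' h) \<le> K * (norm h)\<^sup>2"
  shows "(f has_derivative f') (at x)"
proof (rule has_derivativeI_sandwich[of 1, OF _ assms(1)])
  show "((\<lambda>y. K * norm (y - x)) \<longlongrightarrow> 0) (at x)"
    by (auto intro!: tendsto_eq_intros)
  fix y assume y: "y \<noteq> x" "dist y x < 1"
  then have "norm (f y - f x - f' (y - x)) \<le> K * (norm (y - x))\<^sup>2"
    using assms(2)[of "y - x"] by (simp add: dist_norm)
  then show "norm (f y - f x - f' (y - x)) / norm (y - x) \<le> K * norm (y - x)"
    using y by (simp add: divide_le_eq power2_eq_square mult.assoc)
qed simp

lemma integrable_lborel_prod_bound:
  fixes f :: "'a::euclidean_space \<times> 'b::euclidean_space \<Rightarrow> 'c::{banach, second_countable_topology}"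
  assumes [measurable]: "f \<in> borel_measurable (lborel \<Otimes>\<^sub>M lborel)"
    and A: "A \<in> fmeasurable lborel" and B: "B \<in> fmeasurable lborel"
    and le: "\<And>x y. norm (f (x, y)) \<le> C * (indicator A x * indicator B y)"
  shows "integrable (lborel \<Otimes>\<^sub>M lborel) f"
proof -
  have [measurable]: "A \<in> sets borel" "B \<in> sets borel" using A B by (auto simp: fmeasurable_def)
  have iA: "integrable lborel (\<lambda>x. indicator A x :: real)" and iB: "integrable lborel (\<lambda>x. indicator B x :: real)"
    using A B by (auto simp: fmeasurable_def)
  have "integrable (lborel \<Otimes>\<^sub>M lborel) (\<lambda>p. C * (indicator A (fst p) * indicator B (snd p)) :: real)"
    by (rule lborel_pair.Fubini_integrable) (use iA iB in \<open>auto simp: abs_mult\<close>)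
  then show ?thesis
  proof (rule Bochner_Integration.integrable_bound)
    show "AE p in lborel \<Otimes>\<^sub>M lborel. norm (f p) \<le> norm (C * (indicator A (fst p) * indicator B (snd p)) :: real)"
    proof (rule AE_I2)
      fix p
      have "norm (f p) \<le> C * (indicator A (fst p) * indicator B (snd p))" using le[of "fst p" "snd p"] by simp
      then show "norm (f p) \<le> norm (C * (indicator A (fst p) * indicator B (snd p)) :: real)" by simp
    qed
  qed measurable
qed

context smoothing_kernel
begin

lemma C_nonneg: "0 \<le> C"
  using \<rho>_nonneg[of 0] \<rho>_le[of 0] by simp

lemma measurable_kernel [measurable]: "\<rho> \<in> borel_measurable borel" "G \<in> borel_measurable borel"
  using \<rho>_cont G_cont by (auto intro: borel_measurable_continuous_onI)

lemma \<rho>_abs: "\<bar>\<rho> w\<bar> \<le> C"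
  using \<rho>_nonneg[of w] \<rho>_le[of w] by simp

lemma \<rho>_integrable: "integrable lborel \<rho>"
  by (rule integrable_bounded_support[of _ C e]) (use \<rho>_abs \<rho>_support in auto)

lemma \<rho>_translate: "integrable lborel (\<lambda>y. \<rho> (x - y))" "(\<integral>y. \<rho> (x - y) \<partial>lborel) = 1"
proof -
  have eq: "\<rho> (x - y) = \<rho> (y + - x)" for y
    using \<rho>_even[of "x - y"] by simp
  show "integrable lborel (\<lambda>y. \<rho> (x - y))"
    unfolding eq using lborel_integrable_translate[OF \<rho>_integrable] .
  show "(\<integral>y. \<rho> (x - y) \<partial>lborel) = 1"
    unfolding eq using lborel_integral_translate[of \<rho> "- x"] \<rho>_integral by simp
qed

lemma integrable_kernel_mult:
  fixes f :: "'a \<Rightarrow> 'b::euclidean_space"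
  assumes f: "integrable lborel f"
  shows "integrable lborel (\<lambda>y. \<rho> (x - y) *\<^sub>R f y)" "integrable lborel (\<lambda>y. (G (x - y) \<bullet> h) *\<^sub>R f y)"
proof -
  have [measurable]: "f \<in> borel_measurable borel" using f by auto
  show "integrable lborel (\<lambda>y. \<rho> (x - y) *\<^sub>R f y)"
  proof (rule Bochner_Integration.integrable_bound[OF integrable_mult_right[OF integrable_norm[OF f], of C]])
    show "AE y in lborel. norm (\<rho> (x - y) *\<^sub>R f y) \<le> norm (C * norm (f y))"
      using \<rho>_abs C_nonneg by (auto simp: mult_right_mono)
  qed measurable
  show "integrable lborel (\<lambda>y. (G (x - y) \<bullet> h) *\<^sub>R f y)"
  proof (rule Bochner_Integration.integrable_bound[OF integrable_mult_right[OF integrable_norm[OF f], of "C * norm h"]])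
    have "\<bar>G (x - y) \<bullet> h\<bar> \<le> C * norm h" for y
      using order_trans[OF Cauchy_Schwarz_ineq2 mult_right_mono[OF G_le]] by auto
    then show "AE y in lborel. norm ((G (x - y) \<bullet> h) *\<^sub>R f y) \<le> norm (C * norm h * norm (f y))"
      using C_nonneg by (auto simp: abs_mult mult_right_mono)
  qed measurable
qed

text \<open>The Taylor remainder of the kernel, integrated against the norm of \<open>f\<close>, is
  already quadratic in \<open>h\<close>, so the derivative can be read off directly.\<close>

lemma convolution_has_derivative:
  fixes f :: "'a \<Rightarrow> 'b::euclidean_space"
  assumes f: "integrable lborel f"
  shows "((\<lambda>x. \<integral>y. \<rho> (x - y) *\<^sub>R f y \<partial>lborel) has_derivative
     (\<lambda>h. \<integral>y. (G (x - y) \<bullet> h) *\<^sub>R f y \<partial>lborel)) (at x)"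
proof (rule has_derivative_quadratic[where K="L * (\<integral>y. norm (f y) \<partial>lborel)"])
  note int = integrable_kernel_mult[OF f]
  show "bounded_linear (\<lambda>h. \<integral>y. (G (x - y) \<bullet> h) *\<^sub>R f y \<partial>lborel)"
  proof (rule bounded_linear_intro)
    fix h k and r :: real
    show "(\<integral>y. (G (x - y) \<bullet> (h + k)) *\<^sub>R f y \<partial>lborel) = (\<integral>y. (G (x - y) \<bullet> h) *\<^sub>R f y \<partial>lborel) + (\<integral>y. (G (x - y) \<bullet> k) *\<^sub>R f y \<partial>lborel)"
      using int(2) by (simp add: inner_add_right scaleR_add_left)
    show "(\<integral>y. (G (x - y) \<bullet> (r *\<^sub>R h)) *\<^sub>R f y \<partial>lborel) = r *\<^sub>R (\<integral>y. (G (x - y) \<bullet> h) *\<^sub>R f y \<partial>lborel)"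
      using int(2) by (simp add: scaleR_scaleR[symmetric] del: scaleR_scaleR)
    have "norm (\<integral>y. (G (x - y) \<bullet> h) *\<^sub>R f y \<partial>lborel) \<le> (\<integral>y. norm ((G (x - y) \<bullet> h) *\<^sub>R f y) \<partial>lborel)"
      by (rule integral_norm_bound)
    also have "\<dots> \<le> (\<integral>y. C * norm h * norm (f y) \<partial>lborel)"
    proof (rule integral_mono)
      show "integrable lborel (\<lambda>y. norm ((G (x - y) \<bullet> h) *\<^sub>R f y))" using int(2) by (rule integrable_norm)
      show "integrable lborel (\<lambda>y. C * norm h * norm (f y))" using f by auto
      fix y
      have "\<bar>G (x - y) \<bullet> h\<bar> \<le> C * norm h"
        using order_trans[OF Cauchy_Schwarz_ineq2 mult_right_mono[OF G_le]] by auto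
      then show "norm ((G (x - y) \<bullet> h) *\<^sub>R f y) \<le> C * norm h * norm (f y)"
        by (simp add: mult_right_mono)
    qed
    also have "\<dots> = norm h * (C * (\<integral>y. norm (f y) \<partial>lborel))" by simp
    finally show "norm (\<integral>y. (G (x - y) \<bullet> h) *\<^sub>R f y \<partial>lborel) \<le> norm h * (C * (\<integral>y. norm (f y) \<partial>lborel))" .
  qed
  fix h :: 'a assume h: "norm h \<le> 1"
  have "(\<integral>y. \<rho> (x + h - y) *\<^sub>R f y \<partial>lborel) - (\<integral>y. \<rho> (x - y) *\<^sub>R f y \<partial>lborel) - (\<integral>y. (G (x - y) \<bullet> h) *\<^sub>R f y \<partial>lborel)
      = (\<integral>y. (\<rho> (x + h - y) - \<rho> (x - y) - G (x - y) \<bullet> h) *\<^sub>R f y \<partial>lborel)"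
    using int by (simp add: scaleR_diff_left)
  also have "norm \<dots> \<le> (\<integral>y. norm ((\<rho> (x + h - y) - \<rho> (x - y) - G (x - y) \<bullet> h) *\<^sub>R f y) \<partial>lborel)"
    by (rule integral_norm_bound)
  also have "\<dots> \<le> (\<integral>y. L * (norm h)\<^sup>2 * norm (f y) \<partial>lborel)"
  proof (rule integral_mono)
    show "integrable lborel (\<lambda>y. norm ((\<rho> (x + h - y) - \<rho> (x - y) - G (x - y) \<bullet> h) *\<^sub>R f y))"
      unfolding scaleR_diff_left using int by (intro integrable_norm Bochner_Integration.integrable_diff) auto
    show "integrable lborel (\<lambda>y. L * (norm h)\<^sup>2 * norm (f y))" using f by auto
    fix y
    show "norm ((\<rho> (x + h - y) - \<rho> (x - y) - G (x - y) \<bullet> h) *\<^sub>R f y) \<le> L * (norm h)\<^sup>2 * norm (f y)"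
    proof -
      have "x + h - y = x - y + h" by simp
      then have "\<bar>\<rho> (x + h - y) - \<rho> (x - y) - G (x - y) \<bullet> h\<bar> \<le> L * (norm h)\<^sup>2"
        using taylor[OF h, of "x - y"] by metis
      then show ?thesis unfolding norm_scaleR by (rule mult_right_mono) simp
    qed
  qed
  also have "\<dots> = L * (\<integral>y. norm (f y) \<partial>lborel) * (norm h)\<^sup>2" by simp
  finally show "norm ((\<integral>y. \<rho> (x + h - y) *\<^sub>R f y \<partial>lborel) - (\<integral>y. \<rho> (x - y) *\<^sub>R f y \<partial>lborel) - (\<integral>y. (G (x - y) \<bullet> h) *\<^sub>R f y \<partial>lborel))
      \<le> L * (\<integral>y. norm (f y) \<partial>lborel) * (norm h)\<^sup>2" .
qed

end

lemma integral_vec_component: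
  fixes f :: "'a \<Rightarrow> real^'n"
  assumes "integrable M f"
  shows "(\<integral>x. f x \<partial>M) $ i = (\<integral>x. f x $ i \<partial>M)"
  by (rule integral_bounded_linear[OF bounded_linear_vec_nth assms, symmetric])

lemma convolution_C1_compact_support:
  fixes \<rho> :: "real^'n \<Rightarrow> real" and F :: "real^'n \<Rightarrow> real^'n"
  assumes "smoothing_kernel \<rho> G e C L"
    and [measurable]: "F \<in> borel_measurable borel" and F: "\<And>y. norm (F y) \<le> 1" "\<And>y. R < norm y \<Longrightarrow> F y = 0"
  defines "H \<equiv> \<lambda>x. \<integral>y. \<rho> (x - y) *\<^sub>R F y \<partial>lborel"
  shows "C1_compact_support H" "norm (H x) \<le> 1" "divergence H x = (\<integral>y. G (x - y) \<bullet> F y \<partial>lborel)"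
proof -
  interpret smoothing_kernel \<rho> G e C L by fact
  have intF: "integrable lborel F"
    by (rule integrable_bounded_support[of _ 1 R]) (use F in auto)
  note dH = convolution_has_derivative[OF intF]
  note int = integrable_kernel_mult[OF intF]
  have jac: "jacobian H (at x) $ i $ j = (\<integral>y. (G (x - y) $ j) * F y $ i \<partial>lborel)" for x i j
  proof -
    have "jacobian H (at x) = matrix (\<lambda>h. \<integral>y. (G (x - y) \<bullet> h) *\<^sub>R F y \<partial>lborel)"
      unfolding jacobian_def H_def using frechet_derivative_at[OF dH, of x] by simp
    then show ?thesis
      using int(2)[of x "axis j 1"] by (simp add: matrix_def integral_vec_component cart_eq_inner_axis[symmetric])
  qed
  have Gj: "\<bar>G w $ j\<bar> \<le> C" for w j
    using component_le_norm_cart[of "G w" j] G_le[of w] by linarith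
  have c: "continuous_on UNIV (\<lambda>x. \<integral>y. (G (x - y) $ j) * F y $ i \<partial>lborel)" for i j
    by (rule continuous_convolution[of "\<lambda>w. G w $ j" C])
      (use Gj integrable_bounded_linear[OF bounded_linear_vec_nth intF] in \<open>auto intro!: continuous_intros G_cont\<close>)
  have "continuous_on UNIV (\<lambda>x. \<chi> i j. \<integral>y. (G (x - y) $ j) * F y $ i \<partial>lborel)"
    by (intro continuous_on_vec_lambda c)
  then have cont: "continuous_on UNIV (\<lambda>x. jacobian H (at x))"
    by (rule iffD1[OF continuous_on_cong, rotated 2]) (simp_all add: vec_eq_iff jac)
  have "H x = 0" if "R + e < norm x" for x
  proof -
    have z: "\<rho> (x - y) *\<^sub>R F y = 0" for y
    proof (cases "R < norm y")
      case False
      then have "e \<le> norm (x - y)" using that norm_triangle_ineq2[of x y] by linarith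
      then show ?thesis using \<rho>_support by simp
    qed (use F in simp)
    have "H x = (\<integral>y. 0 \<partial>(lborel :: (real^'n) measure))"
      unfolding H_def by (rule Bochner_Integration.integral_cong[OF refl z])
    then show ?thesis by simp
  qed
  then have "{x. H x \<noteq> 0} \<subseteq> cball 0 (R + e)" by (force simp: not_less)
  then have "compact (closure {x. H x \<noteq> 0})"
    by (meson bounded_cball bounded_subset compact_closure)
  then show "C1_compact_support H"
    using cont dH unfolding C1_compact_support_def H_def differentiable_def by blast
  have "norm (H x) \<le> (\<integral>y. norm (\<rho> (x - y) *\<^sub>R F y) \<partial>lborel)"
    unfolding H_def by (rule integral_norm_bound)
  also have "\<dots> \<le> (\<integral>y. \<rho> (x - y) \<partial>lborel)"
    using int(1) F(1) \<rho>_nonneg by (intro integral_mono integrable_norm \<rho>_translate) (auto simp: mult_left_le)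
  finally show "norm (H x) \<le> 1" by (simp add: \<rho>_translate)
  have "divergence H x = (\<Sum>i\<in>UNIV. \<integral>y. (G (x - y) $ i) * F y $ i \<partial>lborel)"
    by (simp add: divergence_def trace_def jac)
  also have "\<dots> = (\<integral>y. (\<Sum>i\<in>UNIV. (G (x - y) $ i) * F y $ i) \<partial>lborel)"
  proof (rule Bochner_Integration.integral_sum[symmetric])
    show "integrable lborel (\<lambda>y. (G (x - y) $ i) * F y $ i)" for i
      using integrable_bounded_linear[OF bounded_linear_vec_nth int(2)[of x "axis i 1"], of i]
      by (simp add: cart_eq_inner_axis[symmetric])
  qed
  finally show "divergence H x = (\<integral>y. G (x - y) \<bullet> F y \<partial>lborel)"
    by (simp add: inner_vec_def)
qed

text \<open>\<open>V\<close> is minus the gradient of the smoothed indicator. By duality its L^1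
  norm is reached by the field \<open>sgn V\<close>, and Fubini transfers the smoothing from the set
  to this field, whose convolution is admissible in the definition of the perimeter.\<close>

lemma perimeter_ge_smoothed_gradient:
  fixes \<rho> :: "real^'n \<Rightarrow> real" and \<Omega> :: "(real^'n) set"
  assumes K: "smoothing_kernel \<rho> G e C L" and \<Omega>: "\<Omega> \<in> fmeasurable lborel" and P: "perimeter \<Omega> \<le> ereal P"
  defines "V \<equiv> \<lambda>y. \<integral>x. indicator \<Omega> x *\<^sub>R G (x - y) \<partial>lborel"
  shows "(\<integral>\<^sup>+y. norm (V y) \<partial>lborel) \<le> ennreal P"
proof -
  interpret smoothing_kernel \<rho> G e C L by fact
  have \<Omega>m[measurable]: "\<Omega> \<in> sets borel" using \<Omega> by (auto simp: fmeasurable_def)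
  have Vm[measurable]: "V \<in> borel_measurable borel" unfolding V_def by measurable
  have ind: "integrable lborel (\<lambda>x. indicator \<Omega> x :: real)" using \<Omega> by (auto simp: fmeasurable_def)
  have intV: "integrable lborel (\<lambda>x. indicator \<Omega> x *\<^sub>R G (x - y))" for y
  proof (rule Bochner_Integration.integrable_bound[OF integrable_mult_right[OF ind, of C]])
    show "AE x in lborel. norm (indicator \<Omega> x *\<^sub>R G (x - y)) \<le> norm (C * indicator \<Omega> x)"
      using G_le C_nonneg by (auto simp: indicator_def)
  qed measurable
  have V_le: "norm (V y) \<le> C * measure lborel \<Omega>" for y
  proof -
    have "norm (V y) \<le> (\<integral>x. norm (indicator \<Omega> x *\<^sub>R G (x - y)) \<partial>lborel)"
      unfolding V_def by (rule integral_norm_bound)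
    also have "\<dots> \<le> (\<integral>x. C * indicator \<Omega> x \<partial>lborel)"
      using intV G_le C_nonneg by (intro integral_mono integrable_norm integrable_mult_right ind) (auto simp: indicator_def)
    finally show ?thesis by simp
  qed
  \<comment> \<open>The truncation to a ball gives the test field bounded support; the ball is
    exhausted afterwards by monotone convergence.\<close>
  have ball: "(\<integral>\<^sup>+y. ennreal (norm (V y)) * indicator (ball 0 R) y \<partial>lborel) \<le> ennreal P" for R
  proof -
    define F where "F y = indicator (ball 0 R) y *\<^sub>R sgn (V y)" for y
    have bm[measurable]: "ball (0::real^'n) R \<in> sets borel" by simp
    have Fm[measurable]: "F \<in> borel_measurable borel"
      unfolding F_def sgn_div_norm by measurable
    have F1: "norm (F y) \<le> 1" for y by (simp add: F_def indicator_def norm_sgn)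
    have F0: "F y = 0" if "R < norm y" for y using that by (simp add: F_def)
    define H where "H x = (\<integral>y. \<rho> (x - y) *\<^sub>R F y \<partial>lborel)" for x
    note H = convolution_C1_compact_support[OF K Fm F1 F0, folded H_def]
    have Hm[measurable]: "divergence H \<in> borel_measurable borel"
      using C1_compact_supportD(5)[OF H(1)] by (rule borel_measurable_continuous_onI)
    have "ereal (LINT x:\<Omega>|lebesgue. divergence H x) \<le> perimeter \<Omega>"
      unfolding perimeter_def using H by (intro SUP_upper) auto
    then have le: "(LINT x:\<Omega>|lebesgue. divergence H x) \<le> P" using P order_trans by fastforce
    have FV: "F y \<bullet> V y = indicator (ball 0 R) y * norm (V y)" for y
      by (cases "V y = 0") (simp_all add: F_def sgn_div_norm dot_square_norm power2_eq_square)
    have "(LINT x:\<Omega>|lebesgue. divergence H x) = (\<integral>x. indicator \<Omega> x *\<^sub>R divergence H x \<partial>lborel)"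
      unfolding set_lebesgue_integral_def
      by (rule integral_completion) (intro borel_measurable_scaleR borel_measurable_indicator, use Hm \<Omega>m in simp_all)
    also have "\<dots> = (\<integral>x. (\<integral>y. indicator \<Omega> x * (G (x - y) \<bullet> F y) \<partial>lborel) \<partial>lborel)"
      by (simp add: H(3))
    also have "\<dots> = (\<integral>y. (\<integral>x. indicator \<Omega> x * (G (x - y) \<bullet> F y) \<partial>lborel) \<partial>lborel)"
    proof (rule lborel_pair.Fubini_integral[symmetric])
      show "integrable (lborel \<Otimes>\<^sub>M lborel) (\<lambda>(x, y). indicator \<Omega> x * (G (x - y) \<bullet> F y))"
      proof (rule integrable_lborel_prod_bound[OF _ \<Omega> fmeasurable_lborel_bounded[of "ball 0 R"]])
        fix x y
        have "\<bar>G (x - y) \<bullet> F y\<bar> \<le> norm (G (x - y)) * norm (F y)" by (rule Cauchy_Schwarz_ineq2)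
        also have "\<dots> \<le> C * indicator (ball 0 R) y"
          using G_le[of "x - y"] C_nonneg by (intro mult_mono) (auto simp: F_def indicator_def norm_sgn)
        finally show "norm (case (x, y) of (x, y) \<Rightarrow> indicator \<Omega> x * (G (x - y) \<bullet> F y)) \<le> C * (indicator \<Omega> x * indicator (ball 0 R) y)"
          by (cases "x \<in> \<Omega>") (simp_all add: abs_mult)
      qed simp_all
    qed
    also have "\<dots> = (\<integral>y. F y \<bullet> V y \<partial>lborel)"
    proof (rule Bochner_Integration.integral_cong[OF refl])
      fix y
      have "F y \<bullet> V y = (\<integral>x. F y \<bullet> (indicator \<Omega> x *\<^sub>R G (x - y)) \<partial>lborel)"
        unfolding V_def using integral_inner_right[of "F y", OF intV] by simp
      then show "(\<integral>x. indicator \<Omega> x * (G (x - y) \<bullet> F y) \<partial>lborel) = F y \<bullet> V y"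
        by (simp add: inner_commute)
    qed
    finally have eq: "(LINT x:\<Omega>|lebesgue. divergence H x) = (\<integral>y. norm (V y) * indicator (ball 0 R) y \<partial>lborel)"
      unfolding FV by (simp add: mult.commute)
    have intN: "integrable lborel (\<lambda>y. norm (V y) * indicator (ball 0 R) y)"
      by (rule integrable_bounded_support[of _ "C * measure lborel \<Omega>" R])
        (use V_le C_nonneg in \<open>auto simp: indicator_def\<close>)
    have "(\<integral>\<^sup>+y. ennreal (norm (V y)) * indicator (ball 0 R) y \<partial>lborel) = (\<integral>\<^sup>+y. ennreal (norm (V y) * indicator (ball 0 R) y) \<partial>lborel)"
      by (intro nn_integral_cong) (simp add: indicator_def)
    also have "\<dots> = ennreal (\<integral>y. norm (V y) * indicator (ball 0 R) y \<partial>lborel)"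
      by (rule nn_integral_eq_integral[OF intN]) simp
    also have "\<dots> \<le> ennreal P" using le eq by (simp add: ennreal_leI)
    finally show ?thesis .
  qed
  have bm[measurable]: "ball (0::real^'n) R \<in> sets borel" for R by simp
  have "(\<integral>\<^sup>+y. norm (V y) \<partial>lborel) = (\<integral>\<^sup>+y. (SUP R::nat. ennreal (norm (V y)) * indicator (ball (0::real^'n) (real R)) y) \<partial>lborel)"
  proof (rule nn_integral_cong)
    fix y :: "real^'n"
    obtain R0 :: nat where R0: "norm y < real R0" using reals_Archimedean2 by blast
    show "ennreal (norm (V y)) = (SUP R::nat. ennreal (norm (V y)) * indicator (ball (0::real^'n) (real R)) y)"
    proof (rule antisym)
      show "ennreal (norm (V y)) \<le> (SUP R::nat. ennreal (norm (V y)) * indicator (ball (0::real^'n) (real R)) y)"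
        by (rule SUP_upper2[of R0]) (use R0 in auto)
      show "(SUP R::nat. ennreal (norm (V y)) * indicator (ball (0::real^'n) (real R)) y) \<le> ennreal (norm (V y))"
        by (rule SUP_least) (simp add: indicator_def)
    qed
  qed
  also have "\<dots> = (SUP R::nat. \<integral>\<^sup>+y. ennreal (norm (V y)) * indicator (ball (0::real^'n) (real R)) y \<partial>lborel)"
  proof (rule nn_integral_monotone_convergence_SUP)
    show "incseq (\<lambda>(R::nat) (y::real^'n). ennreal (norm (V y)) * indicator (ball (0::real^'n) (real R)) y)"
      by (auto simp: incseq_def le_fun_def indicator_def)
  qed measurable
  also have "\<dots> \<le> ennreal P" by (intro SUP_least ball)
  finally show ?thesis .
qed

section \<open>Isoperimetric inequality\<close>

text \<open>Compactness is wanted because a compact subset of an open set has a whole neighbourhood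
  of fixed width inside it; that width becomes the radius of the kernel in
  \<open>isoperimetric_borel\<close>.\<close>

lemma fmeasurable_inner_compact:
  fixes \<Omega> :: "'a::euclidean_space set"
  assumes \<Omega>: "\<Omega> \<in> fmeasurable lborel" and "0 < \<eta>"
  obtains K where "compact K" "K \<subseteq> \<Omega>" "emeasure lborel (\<Omega> - K) < ennreal \<eta>"
proof -
  have \<Omega>m: "\<Omega> \<in> sets lborel" "emeasure lborel \<Omega> < \<infinity>" using \<Omega> by (auto simp: fmeasurable_def)
  have "\<Omega> \<in> sets lebesgue" using \<Omega>m by auto
  then obtain T where T: "closed T" "T \<subseteq> \<Omega>" "emeasure lebesgue (\<Omega> - T) < ennreal \<eta>"
    using sets_lebesgue_inner_closed[OF _ assms(2)] by metis
  have Tm: "emeasure lborel (\<Omega> - T) < ennreal \<eta>"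
    using T \<Omega>m by (simp add: emeasure_completion)
  define A where "A n = \<Omega> - (T \<inter> cball 0 (real n))" for n
  have "(\<lambda>n. emeasure lborel (A n)) \<longlonglongrightarrow> emeasure lborel (\<Inter>n. A n)"
  proof (rule Lim_emeasure_decseq)
    show "range A \<subseteq> sets lborel" using \<Omega>m T by (auto simp: A_def)
    show "decseq A" by (force simp: A_def decseq_def)
    fix n
    have "emeasure lborel (A n) \<le> emeasure lborel \<Omega>" using \<Omega>m by (intro emeasure_mono) (auto simp: A_def)
    then show "emeasure lborel (A n) \<noteq> \<infinity>" using \<Omega>m by (auto simp: top_unique)
  qed
  moreover have "(\<Inter>n. A n) = \<Omega> - T"
  proof -
    have "\<exists>n. x \<in> cball 0 (real n)" for x :: 'a using real_arch_simple[of "norm x"] by auto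
    then show ?thesis unfolding A_def by blast
  qed
  ultimately have "eventually (\<lambda>n. emeasure lborel (A n) < ennreal \<eta>) sequentially"
    using Tm by (auto intro: order_tendstoD(2))
  then obtain n where n: "emeasure lborel (A n) < ennreal \<eta>"
    using eventually_happens'[OF sequentially_bot] by blast
  show thesis
    by (rule that[of "T \<inter> cball 0 (real n)"]) (use T n in \<open>auto simp: A_def intro: closed_Int_compact\<close>)
qed

text \<open>Tonelli. It is applied to the kernel itself, and to the indicator of a ball, where it
  integrates the remainder term of the growth estimate.\<close>

lemma nn_integral_smoothed_set:
  fixes \<Omega> :: "'a::euclidean_space set" and k :: "'a \<Rightarrow> real"
  assumes [measurable]: "\<Omega> \<in> sets borel" "k \<in> borel_measurable borel"
    and c: "\<And>x. (\<integral>\<^sup>+y. ennreal (k (x - y)) \<partial>lborel) = c"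
  shows "(\<integral>\<^sup>+y. (\<integral>\<^sup>+x. indicator \<Omega> x * ennreal (k (x - y)) \<partial>lborel) \<partial>lborel) = c * emeasure lborel \<Omega>"
proof -
  have "(\<integral>\<^sup>+y. (\<integral>\<^sup>+x. indicator \<Omega> x * ennreal (k (x - y)) \<partial>lborel) \<partial>lborel)
      = (\<integral>\<^sup>+x. (\<integral>\<^sup>+y. indicator \<Omega> x * ennreal (k (x - y)) \<partial>lborel) \<partial>lborel)"
    by (rule lborel_pair.Fubini') measurable
  also have "\<dots> = (\<integral>\<^sup>+x. indicator \<Omega> x * c \<partial>lborel)"
    by (intro nn_integral_cong) (simp add: nn_integral_cmult c)
  also have "\<dots> = c * emeasure lborel \<Omega>"
    by (simp add: mult.commute[of _ c] nn_integral_cmult_indicator)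
  finally show ?thesis .
qed

section \<open>The smoothed indicator function\<close>

context smoothing_kernel
begin

definition smooth :: "'a set \<Rightarrow> 'a \<Rightarrow> real" where
  "smooth \<Omega> y = (\<integral>x. indicator \<Omega> x * \<rho> (x - y) \<partial>lborel)"

lemma \<rho>_translate_fst: "integrable lborel (\<lambda>x. \<rho> (x - y))" "(\<integral>x. \<rho> (x - y) \<partial>lborel) = 1"
  using lborel_integrable_translate[OF \<rho>_integrable, of "- y"] lborel_integral_translate[of \<rho> "- y"] \<rho>_integral
  by simp_all

lemma integrable_smooth:
  assumes [measurable]: "\<Omega> \<in> sets borel"
  shows "integrable lborel (\<lambda>x. indicator \<Omega> x * \<rho> (x - y))"
  by (rule Bochner_Integration.integrable_bound[OF \<rho>_translate_fst(1)[of y]]) (auto simp: indicator_def)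

lemma smooth_bounds:
  assumes [measurable]: "\<Omega> \<in> sets borel"
  shows "0 \<le> smooth \<Omega> y" "smooth \<Omega> y \<le> 1" "1 - smooth \<Omega> y = smooth (- \<Omega>) y"
proof -
  show nn: "0 \<le> smooth \<Omega> y" for \<Omega>
    unfolding smooth_def by (intro integral_nonneg_AE) (simp add: \<rho>_nonneg)
  have "smooth \<Omega> y + smooth (- \<Omega>) y = (\<integral>x. indicator \<Omega> x * \<rho> (x - y) + indicator (- \<Omega>) x * \<rho> (x - y) \<partial>lborel)"
    unfolding smooth_def by (subst Bochner_Integration.integral_add) (auto intro!: integrable_smooth)
  also have "\<dots> = (\<integral>x. \<rho> (x - y) \<partial>lborel)"
    by (intro Bochner_Integration.integral_cong) (auto simp: indicator_def)
  finally show "1 - smooth \<Omega> y = smooth (- \<Omega>) y" by (simp add: \<rho>_translate_fst)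
  then show "smooth \<Omega> y \<le> 1" using nn[of "- \<Omega>"] by simp
qed

lemma ennreal_smooth:
  assumes [measurable]: "\<Omega> \<in> sets borel"
  shows "ennreal (smooth \<Omega> y) = (\<integral>\<^sup>+x. indicator \<Omega> x * ennreal (\<rho> (x - y)) \<partial>lborel)"
proof -
  have "ennreal (smooth \<Omega> y) = (\<integral>\<^sup>+x. ennreal (indicator \<Omega> x * \<rho> (x - y)) \<partial>lborel)"
    unfolding smooth_def by (rule nn_integral_eq_integral[symmetric]) (auto simp: \<rho>_nonneg integrable_smooth)
  also have "\<dots> = (\<integral>\<^sup>+x. indicator \<Omega> x * ennreal (\<rho> (x - y)) \<partial>lborel)"
    by (intro nn_integral_cong) (auto simp: indicator_def)
  finally show ?thesis .
qed

lemma nn_integral_\<rho>: "(\<integral>\<^sup>+y. ennreal (\<rho> (x - y)) \<partial>lborel) = 1" "(\<integral>\<^sup>+x. ennreal (\<rho> (x - y)) \<partial>lborel) = 1"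
  using nn_integral_eq_integral[OF \<rho>_translate(1)[of x]] nn_integral_eq_integral[OF \<rho>_translate_fst(1)[of y]]
  by (simp_all add: \<rho>_nonneg \<rho>_translate \<rho>_translate_fst)

lemma nn_integral_smooth:
  assumes [measurable]: "\<Omega> \<in> sets borel"
  shows "(\<integral>\<^sup>+y. ennreal (smooth \<Omega> y) \<partial>lborel) = emeasure lborel \<Omega>"
  using nn_integral_smoothed_set[of \<Omega> \<rho> 1] by (simp add: ennreal_smooth nn_integral_\<rho>)

lemma smooth_measurable [measurable]:
  assumes [measurable]: "\<Omega> \<in> sets borel"
  shows "smooth \<Omega> \<in> borel_measurable borel"
  unfolding smooth_def[abs_def] by measurable

lemma smooth_continuous:
  assumes "\<Omega> \<in> fmeasurable lborel"
  shows "continuous_on UNIV (smooth \<Omega>)"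
proof -
  have "integrable lborel (indicator \<Omega> :: 'a \<Rightarrow> real)" using assms by (auto simp: fmeasurable_def)
  then have "continuous_on UNIV (\<lambda>x. \<integral>y. \<rho> (x - y) * indicator \<Omega> y \<partial>lborel)"
    using \<rho>_cont \<rho>_abs by (intro continuous_convolution) auto
  moreover have "\<rho> (x - y) * indicator \<Omega> y = indicator \<Omega> y * \<rho> (y - x)" for x y
    using \<rho>_even[of "y - x"] by simp
  ultimately show ?thesis unfolding smooth_def[abs_def] by simp
qed

text \<open>On \<Omega> the deficit \<open>1 - smooth \<Omega>\<close> has integral at most 2
  \<eta>. At points of \<open>K\<close> the kernel sees only \<open>U\<close>, so the deficit is
  bounded by the smoothed indicator of \<open>U - \<Omega>\<close>, whose total mass is at most
  \<eta>; on \<open>\<Omega> - K\<close> it is bounded by 1. Where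
  \<open>smooth \<Omega> y \<le> t\<close> the deficit is at least \<tau>, and Markov's inequality
  gives the loss 2 \<eta> / \<tau>.\<close>

lemma smooth_level_set:
  assumes \<Omega>: "\<Omega> \<in> fmeasurable lborel" and K: "compact K" "K \<subseteq> \<Omega>" "emeasure lborel (\<Omega> - K) \<le> ennreal \<eta>"
    and U: "open U" "\<And>x y. x \<in> K \<Longrightarrow> dist x y < e \<Longrightarrow> y \<in> U" "emeasure lborel (U - \<Omega>) \<le> ennreal \<eta>"
    and t: "0 < \<tau>" "t \<le> 1 - \<tau>" "0 \<le> \<eta>"
  shows "measure lborel \<Omega> - 2 * \<eta> / \<tau> \<le> measure lborel (\<Omega> \<inter> {y. t < smooth \<Omega> y})"
proof -
  have [measurable]: "\<Omega> \<in> sets borel" "K \<in> sets borel" "U \<in> sets borel"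
    using \<Omega> K U by (auto simp: fmeasurable_def compact_imp_closed)
  have "(\<integral>\<^sup>+y. indicator \<Omega> y * ennreal (1 - smooth \<Omega> y) \<partial>lborel)
      \<le> (\<integral>\<^sup>+y. indicator (\<Omega> - K) y + (\<integral>\<^sup>+x. indicator (U - \<Omega>) x * ennreal (\<rho> (x - y)) \<partial>lborel) \<partial>lborel)"
  proof (rule nn_integral_mono)
    fix y
    have le1: "ennreal (1 - smooth \<Omega> y) \<le> 1"
      using smooth_bounds(1)[of \<Omega> y] by (simp add: ennreal_le_1)
    show "indicator \<Omega> y * ennreal (1 - smooth \<Omega> y)
      \<le> indicator (\<Omega> - K) y + (\<integral>\<^sup>+x. indicator (U - \<Omega>) x * ennreal (\<rho> (x - y)) \<partial>lborel)"
    proof (cases "y \<in> K")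
      case True
      have "ennreal (1 - smooth \<Omega> y) = (\<integral>\<^sup>+x. indicator (- \<Omega>) x * ennreal (\<rho> (x - y)) \<partial>lborel)"
        by (simp add: smooth_bounds ennreal_smooth)
      also have "\<dots> \<le> (\<integral>\<^sup>+x. indicator (U - \<Omega>) x * ennreal (\<rho> (x - y)) \<partial>lborel)"
      proof (rule nn_integral_mono)
        fix x
        show "indicator (- \<Omega>) x * ennreal (\<rho> (x - y)) \<le> indicator (U - \<Omega>) x * ennreal (\<rho> (x - y))"
        proof (cases "e \<le> norm (x - y)")
          case True
          then show ?thesis by (simp add: \<rho>_support)
        next
          case False
          then have "x \<in> U" using U(2)[OF \<open>y \<in> K\<close>, of x] by (simp add: dist_norm norm_minus_commute)
          then show ?thesis by (auto simp: indicator_def)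
        qed
      qed
      finally show ?thesis using K True by (simp add: indicator_def subset_iff)
    next
      case False
      then show ?thesis using le1 by (auto simp: indicator_def intro: add_increasing2)
    qed
  qed
  also have "\<dots> = emeasure lborel (\<Omega> - K) + emeasure lborel (U - \<Omega>)"
    using nn_integral_smoothed_set[of "U - \<Omega>" \<rho> 1] by (subst nn_integral_add) (simp_all add: nn_integral_\<rho>)
  also have "\<dots> \<le> ennreal \<eta> + ennreal \<eta>" by (intro add_mono K U)
  also have "\<dots> = ennreal (2 * \<eta>)" using t by (simp add: ennreal_plus[symmetric] del: ennreal_plus)
  finally have total: "(\<integral>\<^sup>+y. indicator \<Omega> y * ennreal (1 - smooth \<Omega> y) \<partial>lborel) \<le> ennreal (2 * \<eta>)" .
  let ?B = "\<Omega> \<inter> {y. smooth \<Omega> y \<le> t}"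
  have [measurable]: "?B \<in> sets borel" by measurable
  have "ennreal \<tau> * emeasure lborel ?B = (\<integral>\<^sup>+y. ennreal \<tau> * indicator ?B y \<partial>lborel)"
    by (simp add: nn_integral_cmult_indicator)
  also have "\<dots> \<le> (\<integral>\<^sup>+y. indicator \<Omega> y * ennreal (1 - smooth \<Omega> y) \<partial>lborel)"
    using t by (intro nn_integral_mono) (auto simp: indicator_def intro!: ennreal_leI)
  finally have "ennreal \<tau> * emeasure lborel ?B \<le> ennreal (2 * \<eta>)" using total by simp
  moreover have Bf: "?B \<in> fmeasurable lborel"
    by (rule fmeasurableI2[OF \<Omega>]) auto
  ultimately have "\<tau> * measure lborel ?B \<le> 2 * \<eta>"
    using t by (simp add: emeasure_eq_measure2 ennreal_mult[symmetric])
  then have B: "measure lborel ?B \<le> 2 * \<eta> / \<tau>" using t by (simp add: field_simps)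
  have Af: "\<Omega> \<inter> {y. t < smooth \<Omega> y} \<in> fmeasurable lborel"
    by (rule fmeasurableI2[OF \<Omega>]) auto
  have "measure lborel \<Omega> \<le> measure lborel (\<Omega> \<inter> {y. t < smooth \<Omega> y} \<union> ?B)"
    by (rule measure_mono_fmeasurable) (auto intro!: fmeasurable.Un Af Bf)
  also have "\<dots> \<le> measure lborel (\<Omega> \<inter> {y. t < smooth \<Omega> y}) + measure lborel ?B"
    using Af Bf by (intro measure_Un_le) auto
  finally show ?thesis using B by linarith
qed

lemma L_nonneg: "0 \<le> L"
proof -
  obtain z :: 'a where "norm z = 1" using vector_choose_size[of 1] by auto
  then show ?thesis using order_trans[OF abs_ge_zero taylor[of z 0]] by simp
qed

text \<open>The Taylor bound of the kernel, integrated over \<Omega>. Since |z| <= 1, all terms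
  vanish for x farther than e + 1 from y. Keeping the remainder local in this way makes it
  integrable in y.\<close>

lemma smooth_growth:
  assumes \<Omega>: "\<Omega> \<in> fmeasurable lborel" and z: "norm z \<le> 1"
  defines "V \<equiv> \<lambda>y. \<integral>x. indicator \<Omega> x *\<^sub>R G (x - y) \<partial>lborel"
  shows "smooth \<Omega> (y + z) \<le> smooth \<Omega> y + norm z * norm (V y) + L * (norm z)\<^sup>2 * measure lborel (\<Omega> \<inter> cball y (e + 1))"
proof -
  have [measurable]: "\<Omega> \<in> sets borel" using \<Omega> by (auto simp: fmeasurable_def)
  have ind: "integrable lborel (\<lambda>x. indicator \<Omega> x :: real)" using \<Omega> by (auto simp: fmeasurable_def)
  have intV: "integrable lborel (\<lambda>x. indicator \<Omega> x *\<^sub>R G (x - y))"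
  proof (rule Bochner_Integration.integrable_bound[OF integrable_mult_right[OF ind, of C]])
    show "AE x in lborel. norm (indicator \<Omega> x *\<^sub>R G (x - y)) \<le> norm (C * indicator \<Omega> x)"
      using G_le C_nonneg by (auto simp: indicator_def)
  qed measurable
  have f: "\<Omega> \<inter> cball y (e + 1) \<in> fmeasurable lborel" by (rule fmeasurableI2[OF \<Omega>]) auto
  have intJ: "integrable lborel (\<lambda>x. indicator (\<Omega> \<inter> cball y (e + 1)) x :: real)"
    using f by (auto simp: fmeasurable_def)
  have Vz: "(\<integral>x. (indicator \<Omega> x *\<^sub>R G (x - y)) \<bullet> z \<partial>lborel) = V y \<bullet> z"
    unfolding V_def using integral_inner_left[of z, OF intV] by simp
  have intVz: "integrable lborel (\<lambda>x. (indicator \<Omega> x *\<^sub>R G (x - y)) \<bullet> z)"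
    using intV by (rule integrable_inner_left)
  have "smooth \<Omega> (y + z) \<le> (\<integral>x. indicator \<Omega> x * \<rho> (x - y) - (indicator \<Omega> x *\<^sub>R G (x - y)) \<bullet> z
      + L * (norm z)\<^sup>2 * indicator (\<Omega> \<inter> cball y (e + 1)) x \<partial>lborel)"
    unfolding smooth_def
  proof (rule integral_mono)
    show "integrable lborel (\<lambda>x. indicator \<Omega> x * \<rho> (x - (y + z)))" by (rule integrable_smooth) simp
    show "integrable lborel (\<lambda>x. indicator \<Omega> x * \<rho> (x - y) - (indicator \<Omega> x *\<^sub>R G (x - y)) \<bullet> z
      + L * (norm z)\<^sup>2 * indicator (\<Omega> \<inter> cball y (e + 1)) x)"
      by (intro Bochner_Integration.integrable_add Bochner_Integration.integrable_diff integrable_smooth intVz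
          integrable_mult_right intJ) simp
    fix x
    show "indicator \<Omega> x * \<rho> (x - (y + z)) \<le> indicator \<Omega> x * \<rho> (x - y) - (indicator \<Omega> x *\<^sub>R G (x - y)) \<bullet> z
      + L * (norm z)\<^sup>2 * indicator (\<Omega> \<inter> cball y (e + 1)) x"
    proof (cases "x \<in> \<Omega> \<and> norm (x - y) \<le> e + 1")
      case True
      have "x - (y + z) = (x - y) + (- z)" by simp
      then have "\<rho> (x - (y + z)) - \<rho> (x - y) - G (x - y) \<bullet> (- z) \<le> L * (norm z)\<^sup>2"
        using taylor[of "- z" "x - y"] z by (metis abs_le_D1 norm_minus_cancel)
      then show ?thesis using True by (simp add: dist_norm norm_minus_commute)
    next
      case False
      have "\<rho> (x - (y + z)) = 0" if "\<not> norm (x - y) \<le> e + 1"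
      proof -
        have "norm (x - y) - norm z \<le> norm (x - y - z)" by (rule norm_triangle_ineq2)
        then show ?thesis using that z by (intro \<rho>_support) (simp add: diff_diff_eq)
      qed
      moreover have "G (x - y) = 0" "\<rho> (x - y) = 0" if "\<not> norm (x - y) \<le> e + 1"
        using that by (auto intro!: G_support \<rho>_support)
      ultimately show ?thesis using False L_nonneg by (auto simp: indicator_def)
    qed
  qed
  also have "\<dots> = smooth \<Omega> y - V y \<bullet> z + L * (norm z)\<^sup>2 * measure lborel (\<Omega> \<inter> cball y (e + 1))"
    using integrable_smooth[of \<Omega> y] intVz intJ
    by (simp add: smooth_def Vz[symmetric] del: inner_scaleR_left)
  also have "\<dots> \<le> smooth \<Omega> y + norm z * norm (V y) + L * (norm z)\<^sup>2 * measure lborel (\<Omega> \<inter> cball y (e + 1))"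
    using Cauchy_Schwarz_ineq2[of "V y" z] by (simp add: mult.commute abs_le_iff)
  finally show ?thesis .
qed

end

section \<open>Growth of level sets and the gradient\<close>

lemma power_add_ge:
  fixes p q :: real
  assumes "0 \<le> p" "0 \<le> q"
  shows "p ^ n + real n * p ^ (n - 1) * q \<le> (p + q) ^ n"
proof (induction n)
  case (Suc n)
  have "p ^ Suc n + real (Suc n) * p ^ (Suc n - 1) * q \<le> (p + q) * (p ^ n + real n * p ^ (n - 1) * q)"
  proof (cases n)
    case 0
    then show ?thesis using assms by simp
  next
    case (Suc m)
    have "0 \<le> q * (real n * p ^ m * q)" using assms by (intro mult_nonneg_nonneg) auto
    then show ?thesis using Suc by (simp add: algebra_simps)
  qed
  also have "\<dots> \<le> (p + q) * (p + q) ^ n" using Suc.IH assms by (intro mult_left_mono) auto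
  finally show ?case by simp
qed simp

text \<open>Brunn-Minkowski with a ball of radius \<delta>, followed by the first two terms of the
  binomial expansion. The linear term uses the lower bound \<open>s\<close> in place of the volume
  of \<open>A\<close>, so that the increment is the same for all level sets. Extended values are
  kept because the neighbourhood may have infinite measure.\<close>

lemma emeasure_open_plus_ball:
  fixes A :: "'a::euclidean_space set"
  assumes A: "open A" "A \<in> fmeasurable lborel" and s: "0 < s" "s \<le> measure lborel A" and \<delta>: "0 < \<delta>"
  defines "n \<equiv> DIM('a)" and "w \<equiv> measure lborel (ball (0::'a) 1)"
  shows "emeasure lborel A + ennreal (\<delta> * (real n * w powr (1 / n) * (s powr (1 / n)) ^ (n - 1)))
    \<le> emeasure lborel (A + ball 0 \<delta>)"
proof (cases "emeasure lborel (A + ball 0 \<delta>) = \<infinity>")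
  case False
  have op: "open (A + ball 0 \<delta>)" using A by (intro open_set_plus)
  have fm: "A + ball 0 \<delta> \<in> fmeasurable lborel"
    using False op by (intro fmeasurableI) (auto simp: less_top)
  have n: "0 < n" by (simp add: n_def)
  have w: "0 < w" by (simp add: w_def content_ball_pos)
  define a where "a = measure lborel A"
  have a: "s \<le> a" "0 < a" using s by (auto simp: a_def)
  have "a + real n * (a powr (1 / n)) ^ (n - 1) * (\<delta> * w powr (1 / n)) \<le> (a powr (1 / n) + \<delta> * w powr (1 / n)) ^ n"
    using power_add_ge[of "a powr (1 / n)" "\<delta> * w powr (1 / n)" n] \<delta> a n by (simp add: powr_inverse_power)
  also have "\<dots> = bm_fun n a (measure lborel (ball (0::'a) \<delta>))"
  proof -
    have "(\<delta> ^ n * w) powr (1 / n) = \<delta> * w powr (1 / n)"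
      using \<delta> n w by (simp add: powr_mult powr_realpow[symmetric] powr_powr)
    then show ?thesis using measure_lborel_ball[of \<delta> "0::'a"] \<delta> by (simp add: bm_fun_def n_def w_def)
  qed
  also have "\<dots> \<le> measure lborel (A + ball 0 \<delta>)"
    unfolding n_def a_def
    by (rule brunn_minkowski_open) (use A \<delta> fm s fmeasurable_lborel_bounded[of "ball (0::'a) \<delta>"] in auto)
  finally have 1: "a + real n * (a powr (1 / n)) ^ (n - 1) * (\<delta> * w powr (1 / n)) \<le> measure lborel (A + ball 0 \<delta>)" .
  have "(s powr (1 / n)) ^ (n - 1) \<le> (a powr (1 / n)) ^ (n - 1)"
    using s a by (intro power_mono powr_mono2) auto
  then have "\<delta> * (real n * w powr (1 / n) * (s powr (1 / n)) ^ (n - 1)) \<le> \<delta> * (real n * w powr (1 / n) * (a powr (1 / n)) ^ (n - 1))"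
    using \<delta> by (intro mult_left_mono) auto
  with 1 have "a + \<delta> * (real n * w powr (1 / n) * (s powr (1 / n)) ^ (n - 1)) \<le> measure lborel (A + ball 0 \<delta>)"
    by (simp add: mult_ac)
  moreover have "0 \<le> \<delta> * (real n * w powr (1 / n) * (s powr (1 / n)) ^ (n - 1))"
    using \<delta> by simp
  ultimately show ?thesis
    using A fm a by (simp add: emeasure_eq_measure2 a_def ennreal_plus[symmetric] del: ennreal_plus)
qed simp


text \<open>Takes the place of the coarea formula. The subgraph of \<open>u\<close>, thickened
  horizontally by \<delta>, is measured in two ways. Over each point y its height grows by at most
  \<delta> |V y| plus a term of order \<delta>^2; at each level t below 1 - \<tau> its slice grows
  by at least \<delta> \<kappa>. The common part |\<Omega>| cancels, and division by \<delta> and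
  \<delta> \<rightarrow> 0 give the bound.\<close>

lemma (in smoothing_kernel) smoothed_gradient_lower_bound:
  fixes \<Omega> :: "'a set" and s \<tau> P :: real
  assumes \<Omega>: "\<Omega> \<in> fmeasurable lborel" and s: "0 < s" and \<tau>: "0 < \<tau>" "\<tau> < 1" and P: "0 \<le> P"
    and lev: "\<And>t. 0 < t \<Longrightarrow> t < 1 - \<tau> \<Longrightarrow> s \<le> measure lborel {y. t < smooth \<Omega> y}"
  defines "V \<equiv> \<lambda>y. \<integral>x. indicator \<Omega> x *\<^sub>R G (x - y) \<partial>lborel"
    and "n \<equiv> DIM('a)" and "w \<equiv> measure lborel (ball (0::'a) 1)"
  assumes VP: "(\<integral>\<^sup>+y. norm (V y) \<partial>lborel) \<le> ennreal P"
  shows "real n * w powr (1 / n) * (s powr (1 / n)) ^ (n - 1) * (1 - \<tau>) \<le> P"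
proof -
  have \<Omega>m[measurable]: "\<Omega> \<in> sets borel" using \<Omega> by (auto simp: fmeasurable_def)
  define u where "u = smooth \<Omega>"
  define \<kappa> where "\<kappa> = real n * w powr (1 / n) * (s powr (1 / n)) ^ (n - 1)"
  define J where "J y = measure lborel (\<Omega> \<inter> cball y (e + 1))" for y
  have \<kappa>: "0 \<le> \<kappa>" by (simp add: \<kappa>_def)
  have u_cont: "continuous_on UNIV u" unfolding u_def by (rule smooth_continuous[OF \<Omega>])
  have um[measurable]: "u \<in> borel_measurable borel" unfolding u_def by (rule smooth_measurable) simp
  have Vm[measurable]: "V \<in> borel_measurable borel" unfolding V_def by measurable
  have u_nonneg: "0 \<le> u y" for y unfolding u_def by (rule smooth_bounds) simp
  have intu: "(\<integral>\<^sup>+y. ennreal (u y) \<partial>lborel) = emeasure lborel \<Omega>" unfolding u_def by (rule nn_integral_smooth) simp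
  have cbm[measurable]: "cball (0::'a) (e + 1) \<in> sets borel" by simp
  have J_eq: "ennreal (J y) = (\<integral>\<^sup>+x. indicator \<Omega> x * ennreal (indicator (cball 0 (e + 1)) (x - y)) \<partial>lborel)" for y
  proof -
    have "\<Omega> \<inter> cball y (e + 1) \<in> fmeasurable lborel" by (rule fmeasurableI2[OF \<Omega>]) auto
    then have "ennreal (J y) = emeasure lborel (\<Omega> \<inter> cball y (e + 1))" by (simp add: J_def emeasure_eq_measure2)
    also have "\<dots> = (\<integral>\<^sup>+x. indicator (\<Omega> \<inter> cball y (e + 1)) x \<partial>lborel)" by simp
    also have "\<dots> = (\<integral>\<^sup>+x. indicator \<Omega> x * ennreal (indicator (cball 0 (e + 1)) (x - y)) \<partial>lborel)"
      by (intro nn_integral_cong) (auto simp: indicator_def dist_norm norm_minus_commute)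
    finally show ?thesis .
  qed
  have Jm[measurable]: "(\<lambda>y. ennreal (J y)) \<in> borel_measurable borel" unfolding J_eq by measurable
  define c where "c = measure lborel (cball (0::'a) (e + 1))"
  have intJ: "(\<integral>\<^sup>+y. ennreal (J y) \<partial>lborel) = ennreal (c * measure lborel \<Omega>)"
  proof -
    have "(\<integral>\<^sup>+y. ennreal (indicator (cball 0 (e + 1)) (x - y)) \<partial>lborel) = ennreal c" for x :: 'a
    proof -
      have "(\<integral>\<^sup>+y. ennreal (indicator (cball 0 (e + 1)) (x - y)) \<partial>lborel) = (\<integral>\<^sup>+y. indicator (cball x (e + 1)) y \<partial>lborel)"
        by (intro nn_integral_cong) (auto simp: indicator_def dist_norm norm_minus_commute)
      also have "\<dots> = emeasure lborel (cball x (e + 1))" by simp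
      also have "\<dots> = ennreal c"
        using fmeasurable_lborel_bounded[of "cball x (e + 1)"] e
        by (simp add: emeasure_eq_measure2 c_def content_cball)
      finally show ?thesis .
    qed
    then have "(\<integral>\<^sup>+y. ennreal (J y) \<partial>lborel) = ennreal c * emeasure lborel \<Omega>"
      unfolding J_eq by (intro nn_integral_smoothed_set) simp_all
    then show ?thesis using \<Omega> by (simp add: emeasure_eq_measure2 ennreal_mult' c_def)
  qed
  define A where "A t = {y. t < u y}" for t
  have A_open: "open (A t)" for t
    unfolding A_def using u_cont by (intro open_Collect_less continuous_intros)
  have A_fm: "A t \<in> fmeasurable lborel" if "0 < t" for t
  proof (rule fmeasurableI)
    show "A t \<in> sets lborel" using A_open by auto
    have "ennreal t * emeasure lborel (A t) = (\<integral>\<^sup>+y. ennreal t * indicator (A t) y \<partial>lborel)"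
      using A_open by (simp add: nn_integral_cmult_indicator)
    also have "\<dots> \<le> (\<integral>\<^sup>+y. ennreal (u y) \<partial>lborel)"
      by (intro nn_integral_mono) (auto simp: A_def indicator_def intro!: ennreal_leI)
    also have "\<dots> < \<infinity>" unfolding intu using \<Omega> by (auto simp: fmeasurable_def)
    finally show "emeasure lborel (A t) < \<infinity>"
      using that by (auto simp: ennreal_mult_less_top)
  qed
  have step: "\<kappa> * (1 - \<tau>) \<le> P + L * \<delta> * (c * measure lborel \<Omega>)" if \<delta>: "0 < \<delta>" "\<delta> \<le> 1" for \<delta>
  proof -
    \<comment> \<open>The subgraph of the supremum of \<open>u\<close> over balls of radius
      \<delta>, written as a union of open sets so that measurability is immediate.\<close>
    define S where "S = (\<Union>z\<in>ball 0 \<delta>. {p :: 'a \<times> real. 0 < snd p \<and> snd p < u (fst p + z)})"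
    define T where "T = {p :: 'a \<times> real. 0 < snd p \<and> snd p < u (fst p)}"
    have uc: "continuous_on UNIV (\<lambda>p::'a \<times> real. u (fst p + z))" for z
      by (rule continuous_on_compose2[OF u_cont]) (auto intro!: continuous_intros)
    have "open S"
      unfolding S_def by (intro open_UN ballI open_Collect_conj open_Collect_less continuous_intros uc)
    then have Sm[measurable]: "S \<in> sets (lborel \<Otimes>\<^sub>M lborel)" unfolding lborel_prod by simp
    have "open T"
      unfolding T_def using uc[of 0] by (intro open_Collect_conj open_Collect_less continuous_intros) simp
    then have Tm[measurable]: "T \<in> sets (lborel \<Otimes>\<^sub>M lborel)" unfolding lborel_prod by simp
    define b where "b y = u y + \<delta> * norm (V y) + L * \<delta>\<^sup>2 * J y" for y
    have J0: "0 \<le> J y" for y by (simp add: J_def)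
    have S_slice: "t < b y" if St: "(y, t) \<in> S" for y t
    proof -
      obtain z where z: "norm z < \<delta>" "t < u (y + z)" using St by (auto simp: S_def)
      have "u (y + z) \<le> u y + norm z * norm (V y) + L * (norm z)\<^sup>2 * J y"
        unfolding u_def V_def J_def using z \<delta> by (intro smooth_growth[OF \<Omega>]) simp
      also have "\<dots> \<le> b y"
        unfolding b_def using z L_nonneg J0 \<delta>
        by (intro add_mono mult_right_mono mult_left_mono power_mono) auto
      finally show ?thesis using z by simp
    qed
    have "(\<integral>\<^sup>+t. (\<integral>\<^sup>+y. indicator S (y, t) \<partial>lborel) \<partial>lborel) = (\<integral>\<^sup>+y. (\<integral>\<^sup>+t. indicator S (y, t) \<partial>lborel) \<partial>lborel)"
      by (rule lborel_pair.Fubini') measurable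
    also have "\<dots> \<le> (\<integral>\<^sup>+y. ennreal (b y) \<partial>lborel)"
    proof (rule nn_integral_mono)
      fix y
      have "(\<integral>\<^sup>+t. indicator S (y, t) \<partial>lborel) \<le> (\<integral>\<^sup>+t. indicator {0<..<b y} t \<partial>lborel)"
        using S_slice[of y] by (intro nn_integral_mono) (auto simp: indicator_def S_def)
      also have "\<dots> = ennreal (b y)"
        using u_nonneg[of y] \<delta> L_nonneg J0[of y] by (simp add: b_def)
      finally show "(\<integral>\<^sup>+t. indicator S (y, t) \<partial>lborel) \<le> ennreal (b y)" .
    qed
    also have "\<dots> = (\<integral>\<^sup>+y. ennreal (u y) + (ennreal \<delta> * ennreal (norm (V y)) + ennreal (L * \<delta>\<^sup>2) * ennreal (J y)) \<partial>lborel)"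
      using u_nonneg \<delta> L_nonneg J0
      by (intro nn_integral_cong) (simp add: b_def ennreal_mult'[symmetric] ennreal_plus[symmetric] add.assoc del: ennreal_plus)
    also have "\<dots> = (\<integral>\<^sup>+y. ennreal (u y) \<partial>lborel) + (ennreal \<delta> * (\<integral>\<^sup>+y. ennreal (norm (V y)) \<partial>lborel)
        + ennreal (L * \<delta>\<^sup>2) * (\<integral>\<^sup>+y. ennreal (J y) \<partial>lborel))"
      by (simp add: nn_integral_add nn_integral_cmult)
    also have "\<dots> \<le> emeasure lborel \<Omega> + (ennreal \<delta> * ennreal P + ennreal (L * \<delta>\<^sup>2) * ennreal (c * measure lborel \<Omega>))"
      unfolding intu intJ using VP by (intro add_mono mult_left_mono) auto
    also have "ennreal \<delta> * ennreal P + ennreal (L * \<delta>\<^sup>2) * ennreal (c * measure lborel \<Omega>)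
        = ennreal (\<delta> * P + L * \<delta>\<^sup>2 * (c * measure lborel \<Omega>))"
      using \<delta> P L_nonneg by (simp add: c_def ennreal_mult'[symmetric] ennreal_plus[symmetric] del: ennreal_plus)
    finally have upper: "(\<integral>\<^sup>+t. (\<integral>\<^sup>+y. indicator S (y, t) \<partial>lborel) \<partial>lborel)
       \<le> emeasure lborel \<Omega> + ennreal (\<delta> * P + L * \<delta>\<^sup>2 * (c * measure lborel \<Omega>))" .
    have "emeasure lborel \<Omega> = (\<integral>\<^sup>+y. (\<integral>\<^sup>+t. indicator T (y, t) \<partial>lborel) \<partial>lborel)"
    proof -
      have "(\<integral>\<^sup>+t. indicator T (y, t) \<partial>lborel) = ennreal (u y)" for y
      proof -
        have "(\<integral>\<^sup>+t. indicator T (y, t) \<partial>lborel) = (\<integral>\<^sup>+t. indicator {0<..<u y} t \<partial>lborel)"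
          by (intro nn_integral_cong) (auto simp: indicator_def T_def)
        then show ?thesis using u_nonneg[of y] by simp
      qed
      then show ?thesis using intu by simp
    qed
    also have "\<dots> = (\<integral>\<^sup>+t. (\<integral>\<^sup>+y. indicator T (y, t) \<partial>lborel) \<partial>lborel)"
      by (rule lborel_pair.Fubini'[symmetric]) measurable
    finally have em: "emeasure lborel \<Omega> = (\<integral>\<^sup>+t. (\<integral>\<^sup>+y. indicator T (y, t) \<partial>lborel) \<partial>lborel)" .
    have "emeasure lborel \<Omega> + ennreal (\<delta> * \<kappa>) * ennreal (1 - \<tau>)
        = (\<integral>\<^sup>+t. (\<integral>\<^sup>+y. indicator T (y, t) \<partial>lborel) + ennreal (\<delta> * \<kappa>) * indicator {0<..<1 - \<tau>} t \<partial>lborel)"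
      unfolding em using \<tau> by (subst nn_integral_add) (simp_all add: nn_integral_cmult_indicator)
    also have "\<dots> \<le> (\<integral>\<^sup>+t. (\<integral>\<^sup>+y. indicator S (y, t) \<partial>lborel) \<partial>lborel)"
    proof (rule nn_integral_mono)
      fix t :: real
      show "(\<integral>\<^sup>+y. indicator T (y, t) \<partial>lborel) + ennreal (\<delta> * \<kappa>) * indicator {0<..<1 - \<tau>} t
          \<le> (\<integral>\<^sup>+y. indicator S (y, t) \<partial>lborel)"
      proof (cases "0 < t")
        case False
        then have "(\<integral>\<^sup>+y. indicator T (y, t) \<partial>lborel) = 0" by (simp add: T_def)
        then show ?thesis using False by simp
      next
        case True
        \<comment> \<open>The translation in \<open>S\<close> goes the opposite way from the one in
          the sumset; the ball is symmetric, so \<open>z\<close> is replaced by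
          \<open>- z\<close>.\<close>
        have S_eq: "(y, t) \<in> S \<longleftrightarrow> y \<in> A t + ball 0 \<delta>" for y
        proof
          assume "(y, t) \<in> S"
          then obtain z where z: "norm z < \<delta>" "t < u (y + z)" by (auto simp: S_def)
          then have "y + z \<in> A t" "- z \<in> ball 0 \<delta>" by (auto simp: A_def)
          then have "(y + z) + (- z) \<in> A t + ball 0 \<delta>" by (rule set_plus_intro)
          then show "y \<in> A t + ball 0 \<delta>" by simp
        next
          assume "y \<in> A t + ball 0 \<delta>"
          then obtain x z where "y = x + z" "x \<in> A t" "z \<in> ball 0 \<delta>" by (auto simp: set_plus_def)
          then show "(y, t) \<in> S" using True by (auto simp: S_def A_def intro!: bexI[of _ "- z"])
        qed
        have opS: "open (A t + ball 0 \<delta>)" by (intro open_set_plus A_open)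
        have "(\<integral>\<^sup>+y. indicator T (y, t) \<partial>lborel) = (\<integral>\<^sup>+y. indicator (A t) y \<partial>lborel)"
          using True by (intro nn_integral_cong) (simp add: indicator_def T_def A_def)
        also have "\<dots> = emeasure lborel (A t)" using A_open by simp
        finally have T_em: "(\<integral>\<^sup>+y. indicator T (y, t) \<partial>lborel) = emeasure lborel (A t)" .
        have "(\<integral>\<^sup>+y. indicator S (y, t) \<partial>lborel) = (\<integral>\<^sup>+y. indicator (A t + ball 0 \<delta>) y \<partial>lborel)"
          by (intro nn_integral_cong) (simp add: indicator_def S_eq)
        also have "\<dots> = emeasure lborel (A t + ball 0 \<delta>)" using opS by simp
        finally have S_em: "(\<integral>\<^sup>+y. indicator S (y, t) \<partial>lborel) = emeasure lborel (A t + ball 0 \<delta>)" .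
        show ?thesis
        proof (cases "t < 1 - \<tau>")
          case t: True
          have "emeasure lborel (A t) + ennreal (\<delta> * \<kappa>) \<le> emeasure lborel (A t + ball 0 \<delta>)"
            unfolding \<kappa>_def n_def w_def
            by (rule emeasure_open_plus_ball[OF A_open A_fm[OF True] s _ \<delta>(1)])
              (use lev[OF True t] in \<open>simp add: A_def u_def\<close>)
          then show ?thesis using True t by (simp add: T_em S_em)
        next
          case False
          have "x \<in> A t + ball 0 \<delta>" if "x \<in> A t" for x
            using set_plus_intro[OF that, of 0 "ball 0 \<delta>"] \<delta> by simp
          then have "emeasure lborel (A t) \<le> emeasure lborel (A t + ball 0 \<delta>)"
            using opS by (intro emeasure_mono) auto
          then show ?thesis using False by (simp add: T_em S_em)
        qed
      qed
    qed
    also note upper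
    finally have "ennreal (\<delta> * \<kappa> * (1 - \<tau>)) \<le> ennreal (\<delta> * P + L * \<delta>\<^sup>2 * (c * measure lborel \<Omega>))"
      using \<Omega> \<delta> \<kappa> \<tau> by (simp add: emeasure_eq_measure2 ennreal_add_left_cancel_le ennreal_mult'[symmetric])
    then have "\<delta> * (\<kappa> * (1 - \<tau>)) \<le> \<delta> * (P + L * \<delta> * (c * measure lborel \<Omega>))"
      using \<delta> P L_nonneg by (subst (asm) ennreal_le_iff) (auto simp: c_def power2_eq_square algebra_simps)
    then show ?thesis using \<delta> by simp
  qed
  have "((\<lambda>\<delta>. P + L * \<delta> * (c * measure lborel \<Omega>)) \<longlongrightarrow> P + L * 0 * (c * measure lborel \<Omega>)) (at_right 0)"
    by (intro tendsto_intros)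
  moreover have "eventually (\<lambda>\<delta>. \<kappa> * (1 - \<tau>) \<le> P + L * \<delta> * (c * measure lborel \<Omega>)) (at_right 0)"
    using step by (auto simp: eventually_at_right_field intro!: exI[of _ 1])
  ultimately have "\<kappa> * (1 - \<tau>) \<le> P + L * 0 * (c * measure lborel \<Omega>)"
    by (rule tendsto_lowerbound) simp
  then show ?thesis by (simp add: \<kappa>_def)
qed

section \<open>The isoperimetric inequality for Borel and for Lebesgue measurable sets\<close>

lemma perimeter_nonneg:
  fixes \<Omega> :: "(real^'n) set"
  shows "0 \<le> perimeter \<Omega>"
proof -
  have c: "C1_compact_support (\<lambda>x::real^'n. 0::real^'n)"
    by (simp add: C1_compact_support_def jacobian_def frechet_derivative_const)
  have "divergence (\<lambda>x::real^'n. 0::real^'n) = (\<lambda>x. 0)"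
    by (simp add: fun_eq_iff divergence_def jacobian_def frechet_derivative_const matrix_def trace_def)
  then have 0: "ereal (LINT x:\<Omega>|lebesgue. divergence (\<lambda>x::real^'n. 0::real^'n) x) = 0"
    by (simp add: set_lebesgue_integral_def zero_ereal_def)
  show ?thesis
    unfolding perimeter_def using c by (subst 0[symmetric], intro SUP_upper) simp
qed

lemma isoperimetric_borel:
  fixes \<Omega> :: "(real^'n) set"
  assumes \<Omega>: "\<Omega> \<in> fmeasurable lborel" and pos: "0 < measure lborel \<Omega>"
  defines "n \<equiv> CARD('n)" and "w \<equiv> measure lborel (ball (0::real^'n) 1)"
  shows "ereal (real n * w powr (1 / n) * (measure lborel \<Omega> powr (1 / n)) ^ (n - 1)) \<le> perimeter \<Omega>"
proof (cases "perimeter \<Omega> = \<infinity>")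
  case False
  then obtain P where P: "perimeter \<Omega> = ereal P" "0 \<le> P"
    using perimeter_nonneg[of \<Omega>] by (cases "perimeter \<Omega>") auto
  \<comment> \<open>The one parameter \<open>r\<close> governs both losses: the level sets are used
    up to height r and have volume at least r |\<Omega>|. The sharp bound is the limit r
    \<rightarrow> 1.\<close>
  have main: "real n * w powr (1 / n) * ((r * measure lborel \<Omega>) powr (1 / n)) ^ (n - 1) * r \<le> P" if r: "0 < r" "r < 1" for r
  proof -
    define \<tau> where "\<tau> = 1 - r"
    \<comment> \<open>Chosen so that the loss 2 \<eta> / \<tau> of \<open>smooth_level_set\<close>
      is exactly (1 - r) |\<Omega>|.\<close>
    define \<eta> where "\<eta> = \<tau> * ((1 - r) * measure lborel \<Omega>) / 2"
    have \<tau>: "0 < \<tau>" "\<tau> < 1" and \<eta>: "0 < \<eta>" using r pos by (auto simp: \<tau>_def \<eta>_def)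
    obtain K where K: "compact K" "K \<subseteq> \<Omega>" "emeasure lborel (\<Omega> - K) < ennreal \<eta>"
      using fmeasurable_inner_compact[OF \<Omega> \<eta>] by metis
    have "\<Omega> \<in> sets lebesgue" using \<Omega> by (auto simp: fmeasurable_def)
    then obtain U where U: "open U" "\<Omega> \<subseteq> U" "emeasure lebesgue (U - \<Omega>) < ennreal \<eta>"
      using sets_lebesgue_outer_open[OF _ \<eta>] by metis
    have U': "emeasure lborel (U - \<Omega>) < ennreal \<eta>" 
    proof -
      have "U - \<Omega> \<in> sets lborel" using U(1) \<Omega> by (auto simp: fmeasurable_def)
      then show ?thesis using U(3) by simp
    qed
    obtain \<epsilon> where \<epsilon>: "0 < \<epsilon>" "(\<Union>x\<in>K. ball x \<epsilon>) \<subseteq> U"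
      using compact_subset_open_imp_ball_epsilon_subset[OF K(1) U(1)] K(2) U(2) by blast
    obtain \<rho> :: "real^'n \<Rightarrow> real" and G C L where ker: "smoothing_kernel \<rho> G \<epsilon> C L"
      using smoothing_kernel_exists[OF \<epsilon>(1)] by metis
    interpret smoothing_kernel \<rho> G \<epsilon> C L by fact
    have lev: "r * measure lborel \<Omega> \<le> measure lborel {y. t < smooth \<Omega> y}" if t: "0 < t" "t < 1 - \<tau>" for t
    proof -
      have [measurable]: "\<Omega> \<in> sets borel" using \<Omega> by (auto simp: fmeasurable_def)
      have "measure lborel \<Omega> - 2 * \<eta> / \<tau> \<le> measure lborel (\<Omega> \<inter> {y. t < smooth \<Omega> y})"
      proof (rule smooth_level_set[OF \<Omega> K(1,2) less_imp_le[OF K(3)] U(1) _ less_imp_le[OF U'] \<tau>(1)])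
        show "y \<in> U" if "x \<in> K" "dist x y < \<epsilon>" for x y
        proof -
          have "y \<in> ball x \<epsilon>" using that(2) by simp
          then show ?thesis using that(1) \<epsilon>(2) by blast
        qed
      qed (use t \<eta> in auto)
      moreover have "measure lborel (\<Omega> \<inter> {y. t < smooth \<Omega> y}) \<le> measure lborel {y. t < smooth \<Omega> y}"
      proof (rule measure_mono_fmeasurable)
        show "{y. t < smooth \<Omega> y} \<in> fmeasurable lborel"
        proof (rule fmeasurableI)
          show "{y. t < smooth \<Omega> y} \<in> sets lborel" by measurable
          have "ennreal t * emeasure lborel {y. t < smooth \<Omega> y} = (\<integral>\<^sup>+y. ennreal t * indicator {y. t < smooth \<Omega> y} y \<partial>lborel)"
            by (simp add: nn_integral_cmult_indicator)
          also have "\<dots> \<le> (\<integral>\<^sup>+y. ennreal (smooth \<Omega> y) \<partial>lborel)"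
            by (intro nn_integral_mono) (auto simp: indicator_def intro!: ennreal_leI)
          also have "\<dots> < \<infinity>" using \<Omega> by (simp add: nn_integral_smooth fmeasurable_def)
          finally show "emeasure lborel {y. t < smooth \<Omega> y} < \<infinity>"
            using t by (auto simp: ennreal_mult_less_top)
        qed
      qed auto
      moreover have "2 * \<eta> / \<tau> = measure lborel \<Omega> - r * measure lborel \<Omega>"
        using \<tau> by (simp add: \<eta>_def left_diff_distrib)
      ultimately show ?thesis by linarith
    qed
    have "real n * w powr (1 / n) * ((r * measure lborel \<Omega>) powr (1 / n)) ^ (n - 1) * (1 - \<tau>) \<le> P"
      using smoothed_gradient_lower_bound[OF \<Omega> _ \<tau> P(2) lev perimeter_ge_smoothed_gradient[OF ker \<Omega>]] r pos P
      by (simp add: n_def w_def)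
    then show ?thesis by (simp add: \<tau>_def)
  qed
  have "((\<lambda>r. real n * w powr (1 / n) * ((r * measure lborel \<Omega>) powr (1 / n)) ^ (n - 1) * r) \<longlongrightarrow>
      real n * w powr (1 / n) * ((1 * measure lborel \<Omega>) powr (1 / n)) ^ (n - 1) * 1) (at_left 1)"
    using pos by (intro tendsto_intros) auto
  moreover have "eventually (\<lambda>r. real n * w powr (1 / n) * ((r * measure lborel \<Omega>) powr (1 / n)) ^ (n - 1) * r \<le> P) (at_left 1)"
    using eventually_at_left[of 0 "1::real"] main by (auto intro!: exI[of _ 0])
  ultimately have "real n * w powr (1 / n) * ((1 * measure lborel \<Omega>) powr (1 / n)) ^ (n - 1) * 1 \<le> P"
    by (rule tendsto_upperbound) simp
  then show ?thesis using P by simp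
qed simp

text \<open>Carries the isoperimetric inequality from a Borel set to a Lebesgue measurable set that
  differs from it by a null set.\<close>

lemma perimeter_AE_cong:
  fixes A B :: "(real^'n) set"
  assumes AB: "A \<in> sets lebesgue" "B \<in> sets lebesgue" "AE x in lebesgue. x \<in> A \<longleftrightarrow> x \<in> B"
  shows "perimeter A = perimeter B"
proof -
  have "(LINT x:A|lebesgue. divergence F x) = (LINT x:B|lebesgue. divergence F x)" if F: "C1_compact_support F" for F
    unfolding set_lebesgue_integral_def
  proof (rule integral_cong_AE)
    have "divergence F \<in> borel_measurable borel"
      using C1_compact_supportD(5)[OF F] by (rule borel_measurable_continuous_onI)
    then have [measurable]: "divergence F \<in> borel_measurable lebesgue"
      by (simp add: measurable_completion)
    show "(\<lambda>x. indicator A x *\<^sub>R divergence F x) \<in> borel_measurable lebesgue"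
      "(\<lambda>x. indicator B x *\<^sub>R divergence F x) \<in> borel_measurable lebesgue"
      using AB(1,2) by (intro borel_measurable_scaleR borel_measurable_indicator; measurable)+
    show "AE x in lebesgue. indicator A x *\<^sub>R divergence F x = indicator B x *\<^sub>R divergence F x"
      using AB(3) by eventually_elim (simp add: indicator_def)
  qed
  then show ?thesis unfolding perimeter_def by (intro SUP_cong) auto
qed

theorem isoperimetric_inequality:
  fixes \<Omega> :: "(real^'n) set"
  assumes \<Omega>: "\<Omega> \<in> sets lebesgue" "emeasure lebesgue \<Omega> = ennreal m" "0 < m"
  defines "n \<equiv> CARD('n)" and "w \<equiv> measure lborel (ball (0::real^'n) 1)"
  shows "ereal (real n * w powr (1 / n) * (m powr (1 / n)) ^ (n - 1)) \<le> perimeter \<Omega>"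
proof -
  obtain A N N' where A: "\<Omega> = A \<union> N" "N \<subseteq> N'" "N' \<in> null_sets lborel" "A \<in> sets lborel"
    using sets_completionE[OF \<Omega>(1)] by metis
  have "AE x in lebesgue. x \<notin> N'"
    using AE_completion[OF AE_not_in[OF A(3)]] .
  then have ae: "AE x in lebesgue. x \<in> \<Omega> \<longleftrightarrow> x \<in> A"
    by eventually_elim (use A in auto)
  have As: "A \<in> sets lebesgue" using A(4) by auto
  have "emeasure lebesgue A = ennreal m"
    using emeasure_eq_AE[OF ae \<Omega>(1) As] \<Omega>(2) by simp
  then have em: "emeasure lborel A = ennreal m" using A(4) by simp
  then have fm: "A \<in> fmeasurable lborel" using A(4) by (simp add: fmeasurable_def)
  have "measure lborel A = m" using em \<Omega>(3) by (simp add: measure_def)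
  then show ?thesis
    using isoperimetric_borel[OF fm] \<Omega>(3) unfolding perimeter_AE_cong[OF \<Omega>(1) As ae] n_def w_def by simp
qed

section \<open>Scaling and binding\<close>

lemma lebesgue_scale_density:
  assumes "r \<noteq> 0"
  shows "(lebesgue :: 'a::euclidean_space measure) = density (distr lebesgue lebesgue ((*\<^sub>R) r)) (\<lambda>_. ennreal (\<bar>r\<bar> ^ DIM('a)))"
proof -
  have "(\<lambda>x::'a. 0 + (\<Sum>j\<in>Basis. (r * (x \<bullet> j)) *\<^sub>R j)) = (*\<^sub>R) r"
    unfolding scaleR_scaleR[symmetric] scaleR_sum_right[symmetric] euclidean_representation by auto
  then show ?thesis
    using lebesgue_affine_euclidean[of "\<lambda>_::'a. r" 0] assms by simp
qed

lemma lebesgue_nn_integral_scale: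
  fixes f :: "'a::euclidean_space \<Rightarrow> ennreal"
  assumes [measurable]: "f \<in> borel_measurable lebesgue" and r: "0 < r"
  shows "(\<integral>\<^sup>+x. f x \<partial>lebesgue) = ennreal (r ^ DIM('a)) * (\<integral>\<^sup>+x. f (r *\<^sub>R x) \<partial>lebesgue)"
proof -
  have "(\<integral>\<^sup>+x. f x \<partial>lebesgue) = (\<integral>\<^sup>+x. f x \<partial>density (distr lebesgue lebesgue ((*\<^sub>R) r)) (\<lambda>_. ennreal (\<bar>r\<bar> ^ DIM('a))))"
    using lebesgue_scale_density[of r, where 'a='a] r by simp
  also have "\<dots> = (\<integral>\<^sup>+x. ennreal (\<bar>r\<bar> ^ DIM('a)) * f x \<partial>distr lebesgue lebesgue ((*\<^sub>R) r))"
    by (rule nn_integral_density) auto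
  also have "\<dots> = (\<integral>\<^sup>+x. ennreal (\<bar>r\<bar> ^ DIM('a)) * f (r *\<^sub>R x) \<partial>lebesgue)"
    by (rule nn_integral_distr) auto
  also have "\<dots> = ennreal (\<bar>r\<bar> ^ DIM('a)) * (\<integral>\<^sup>+x. f (r *\<^sub>R x) \<partial>lebesgue)"
    by (rule nn_integral_cmult) (rule measurable_compose[OF lebesgue_measurable_scaling assms(1)])
  finally show ?thesis using r by simp
qed

lemma lebesgue_integral_scale:
  fixes f :: "'a::euclidean_space \<Rightarrow> real"
  assumes [measurable]: "f \<in> borel_measurable lebesgue" and r: "0 < r"
  shows "(\<integral>x. f x \<partial>lebesgue) = r ^ DIM('a) * (\<integral>x. f (r *\<^sub>R x) \<partial>lebesgue)"
proof -
  have "(\<integral>x. f x \<partial>lebesgue) = (\<integral>x. f x \<partial>density (distr lebesgue lebesgue ((*\<^sub>R) r)) (\<lambda>_. ennreal (\<bar>r\<bar> ^ DIM('a))))"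
    using lebesgue_scale_density[of r, where 'a='a] r by simp
  also have "\<dots> = (\<integral>x. (\<bar>r\<bar> ^ DIM('a)) *\<^sub>R f x \<partial>distr lebesgue lebesgue ((*\<^sub>R) r))"
    by (rule integral_density) auto
  also have "\<dots> = (\<integral>x. (\<bar>r\<bar> ^ DIM('a)) *\<^sub>R f (r *\<^sub>R x) \<partial>lebesgue)"
    by (rule integral_distr) auto
  also have "\<dots> = r ^ DIM('a) * (\<integral>x. f (r *\<^sub>R x) \<partial>lebesgue)" using r by simp
  finally show ?thesis .
qed

lemma sets_lebesgue_scale:
  fixes \<Omega> :: "'a::euclidean_space set"
  assumes "\<Omega> \<in> sets lebesgue" "0 < r"
  shows "(*\<^sub>R) r ` \<Omega> \<in> sets lebesgue"
proof -
  have "(*\<^sub>R) r ` \<Omega> = (*\<^sub>R) (1 / r) -` \<Omega> \<inter> space lebesgue"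
    using assms(2) by (auto simp: image_iff intro!: bexI[of _ "(1 / r) *\<^sub>R _"])
  also have "\<dots> \<in> sets lebesgue"
    by (rule measurable_sets[OF lebesgue_measurable_scaling assms(1)])
  finally show ?thesis .
qed

lemma indicator_scale:
  fixes x :: "'a::real_vector"
  assumes "0 < r"
  shows "indicator ((*\<^sub>R) r ` \<Omega>) (r *\<^sub>R x) = indicator \<Omega> x"
  using assms by (auto simp: indicator_def)

lemma C1_compact_support_scale:
  fixes F :: "real^'n \<Rightarrow> real^'n"
  assumes F: "C1_compact_support F" and r: "0 < r"
  shows "C1_compact_support (\<lambda>x. F (r *\<^sub>R x))" "divergence (\<lambda>x. F (r *\<^sub>R x)) x = r * divergence F (r *\<^sub>R x)"
proof -
  have der: "((\<lambda>x. F (r *\<^sub>R x)) has_derivative (\<lambda>h. (r *\<^sub>R jacobian F (at (r *\<^sub>R x))) *v h)) (at x)" for x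
  proof -
    have "((\<lambda>x. F (r *\<^sub>R x)) has_derivative (\<lambda>h. jacobian F (at (r *\<^sub>R x)) *v (r *\<^sub>R h))) (at x)"
      by (rule has_derivative_compose[OF _ C1_compact_supportD(1)[OF F]]) (auto intro!: derivative_eq_intros)
    then show ?thesis by (simp add: matrix_vector_mult_scaleR scaleR_matrix_vector_assoc)
  qed
  have jac: "jacobian (\<lambda>x. F (r *\<^sub>R x)) (at x) = r *\<^sub>R jacobian F (at (r *\<^sub>R x))" for x
    unfolding jacobian_def[of "\<lambda>x. F (r *\<^sub>R x)"] frechet_derivative_at[OF der, symmetric] by simp
  have "continuous_on UNIV (\<lambda>x. jacobian (\<lambda>x. F (r *\<^sub>R x)) (at x))"
    unfolding jac
    by (intro continuous_intros continuous_on_compose2[OF C1_compact_supportD(4)[OF F]]) auto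
  moreover obtain R where R: "\<And>x. norm x > R \<Longrightarrow> F x = 0"
    using C1_compact_support_bounds[OF F] by metis
  have "{x. F (r *\<^sub>R x) \<noteq> 0} \<subseteq> cball 0 (R / r)"
  proof
    fix x assume "x \<in> {x. F (r *\<^sub>R x) \<noteq> 0}"
    then have "\<not> norm (r *\<^sub>R x) > R" using R by auto
    then show "x \<in> cball 0 (R / r)" using r by (simp add: field_simps)
  qed
  then have "compact (closure {x. F (r *\<^sub>R x) \<noteq> 0})"
    by (meson bounded_cball bounded_subset compact_closure)
  ultimately show "C1_compact_support (\<lambda>x. F (r *\<^sub>R x))"
    using der unfolding C1_compact_support_def differentiable_def by blast
  show "divergence (\<lambda>x. F (r *\<^sub>R x)) x = r * divergence F (r *\<^sub>R x)"
    by (simp add: divergence_def jac trace_def sum_distrib_left)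
qed

text \<open>A test field F on the scaled set is pulled back to F(r x) on \<Omega>. The change of
  variables contributes r^N, and the divergence of the pulled-back field absorbs one factor
  r.\<close>

lemma perimeter_scale_le:
  fixes \<Omega> :: "(real^'n) set"
  assumes \<Omega>: "\<Omega> \<in> sets lebesgue" and r: "0 < r" and P: "perimeter \<Omega> \<le> ereal P"
  shows "perimeter ((*\<^sub>R) r ` \<Omega>) \<le> ereal (r ^ (CARD('n) - 1) * P)"
  unfolding perimeter_def
proof (rule SUP_least)
  fix F :: "real^'n \<Rightarrow> real^'n"
  assume "F \<in> {F. C1_compact_support F \<and> (\<forall>x. norm (F x) \<le> 1)}"
  then have F: "C1_compact_support F" "\<And>x. norm (F x) \<le> 1" by auto
  note F' = C1_compact_support_scale[OF F(1) r]
  have "ereal (LINT x:\<Omega>|lebesgue. divergence (\<lambda>x. F (r *\<^sub>R x)) x) \<le> perimeter \<Omega>"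
    unfolding perimeter_def using F' F by (intro SUP_upper) auto
  then have le: "(LINT x:\<Omega>|lebesgue. divergence (\<lambda>x. F (r *\<^sub>R x)) x) \<le> P"
    using P order_trans by fastforce
  have "divergence F \<in> borel_measurable borel"
    using C1_compact_supportD(5)[OF F(1)] by (rule borel_measurable_continuous_onI)
  then have [measurable]: "divergence F \<in> borel_measurable lebesgue"
    by (simp add: measurable_completion)
  have "(LINT x:(*\<^sub>R) r ` \<Omega>|lebesgue. divergence F x)
      = r ^ CARD('n) * (\<integral>x. indicator ((*\<^sub>R) r ` \<Omega>) (r *\<^sub>R x) * divergence F (r *\<^sub>R x) \<partial>lebesgue)"
    unfolding set_lebesgue_integral_def
    using lebesgue_integral_scale[of "\<lambda>x. indicator ((*\<^sub>R) r ` \<Omega>) x * divergence F x", OF _ r]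
      sets_lebesgue_scale[OF \<Omega> r] by simp
  also have "\<dots> = r ^ (CARD('n) - 1) * (r * (\<integral>x. indicator \<Omega> x * divergence F (r *\<^sub>R x) \<partial>lebesgue))"
    by (simp add: indicator_scale[OF r] power_eq_if)
  also have "r * (\<integral>x. indicator \<Omega> x * divergence F (r *\<^sub>R x) \<partial>lebesgue) = (LINT x:\<Omega>|lebesgue. divergence (\<lambda>x. F (r *\<^sub>R x)) x)"
    by (simp add: set_lebesgue_integral_def F'(2) integral_mult_right_zero[symmetric] mult.left_commute del: integral_mult_right_zero)
  finally show "ereal (LINT x:(*\<^sub>R) r ` \<Omega>|lebesgue. divergence F x) \<le> ereal (r ^ (CARD('n) - 1) * P)"
    using le r by (simp add: mult_left_mono)
qed

lemma sigma_finite_lebesgue: "sigma_finite_measure (lebesgue :: 'a::euclidean_space measure)"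
proof -
  obtain A :: "'a set set" where "countable A" "A \<subseteq> sets lborel" "\<Union>A = space lborel" "\<forall>a\<in>A. emeasure lborel a \<noteq> \<infinity>"
    using lborel.sigma_finite_countable by blast
  then show ?thesis
    by (intro sigma_finite_measure.intro exI[of _ A]) (auto simp: subset_iff)
qed

lemma riesz_energy_scale:
  fixes \<Omega> :: "(real^'n) set"
  assumes \<Omega>: "\<Omega> \<in> sets lebesgue" and r: "0 < r"
  shows "riesz_energy lam ((*\<^sub>R) r ` \<Omega>) = ennreal (r powr (2 * real CARD('n) - lam)) * riesz_energy lam \<Omega>"
proof -
  let ?n = "CARD('n)"
  interpret sigma_finite_measure "lebesgue :: (real^'n) measure" by (rule sigma_finite_lebesgue)
  define f where "f A x y = ennreal (1 / norm (x - y) powr lam) * indicator A x * indicator A y" for A and x y :: "real^'n"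
  have idm: "(\<lambda>x. x) \<in> lebesgue \<rightarrow>\<^sub>M (borel :: (real^'n) measure)" by (simp add: measurable_completion)
  have fm: "(\<lambda>p. f A (fst p) (snd p)) \<in> borel_measurable (lebesgue \<Otimes>\<^sub>M lebesgue)" if A: "A \<in> sets lebesgue" for A
  proof -
    have [measurable]: "(fst :: (real^'n) \<times> (real^'n) \<Rightarrow> _) \<in> lebesgue \<Otimes>\<^sub>M lebesgue \<rightarrow>\<^sub>M borel"
      "(snd :: (real^'n) \<times> (real^'n) \<Rightarrow> _) \<in> lebesgue \<Otimes>\<^sub>M lebesgue \<rightarrow>\<^sub>M borel"
      using measurable_compose[OF measurable_fst idm] measurable_compose[OF measurable_snd idm] by auto
    have "(\<lambda>p. indicator A (fst p) :: ennreal) \<in> borel_measurable (lebesgue \<Otimes>\<^sub>M lebesgue)"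
      "(\<lambda>p. indicator A (snd p) :: ennreal) \<in> borel_measurable (lebesgue \<Otimes>\<^sub>M lebesgue)"
      using A by (auto intro!: measurable_compose[OF measurable_fst] measurable_compose[OF measurable_snd])
    then show ?thesis unfolding f_def by measurable
  qed
  \<comment> \<open>In iterated form the scaling of the Lebesgue measure can be applied to one
    variable at a time.\<close>
  have iter: "riesz_energy lam A = (1/2) * (\<integral>\<^sup>+x. (\<integral>\<^sup>+y. f A x y \<partial>lebesgue) \<partial>lebesgue)" if A: "A \<in> sets lebesgue" for A
  proof -
    have "(\<integral>\<^sup>+p\<in>A \<times> A. ennreal (1 / norm (fst p - snd p) powr lam) \<partial>(lebesgue \<Otimes>\<^sub>M lebesgue))
        = (\<integral>\<^sup>+p. f A (fst p) (snd p) \<partial>(lebesgue \<Otimes>\<^sub>M lebesgue))"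
      by (intro nn_integral_cong) (auto simp: f_def indicator_def)
    also have "\<dots> = (\<integral>\<^sup>+x. (\<integral>\<^sup>+y. f A x y \<partial>lebesgue) \<partial>lebesgue)"
      using nn_integral_fst[OF fm[OF A]] by simp
    finally show ?thesis by (simp add: riesz_energy_def)
  qed
  have \<Omega>r: "(*\<^sub>R) r ` \<Omega> \<in> sets lebesgue" by (rule sets_lebesgue_scale[OF \<Omega> r])
  \<comment> \<open>Homogeneity of the kernel holds on the diagonal as well, where the default
    values make both sides 0.\<close>
  have f_scale: "f ((*\<^sub>R) r ` \<Omega>) (r *\<^sub>R x) (r *\<^sub>R y) = ennreal (r powr (- lam)) * f \<Omega> x y" for x y
  proof -
    have "norm (r *\<^sub>R x - r *\<^sub>R y) = r * norm (x - y)"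
      using r by (simp add: scaleR_diff_right[symmetric])
    then have eq: "1 / norm (r *\<^sub>R x - r *\<^sub>R y) powr lam = r powr (- lam) * (1 / norm (x - y) powr lam)"
      using r by (simp add: powr_mult powr_minus_divide)
    show ?thesis
      unfolding f_def indicator_scale[OF r] eq by (subst ennreal_mult') (simp_all add: mult.assoc)
  qed
  have fm1: "f A x \<in> borel_measurable lebesgue" if "A \<in> sets lebesgue" for A x
    using measurable_Pair2[OF fm[OF that], of x] by simp
  have fm2: "(\<lambda>x. \<integral>\<^sup>+y. f A x y \<partial>lebesgue) \<in> borel_measurable lebesgue" if "A \<in> sets lebesgue" for A
    using borel_measurable_nn_integral_fst[OF fm[OF that]] by simp
  have "(\<integral>\<^sup>+x. (\<integral>\<^sup>+y. f ((*\<^sub>R) r ` \<Omega>) x y \<partial>lebesgue) \<partial>lebesgue)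
      = ennreal (r ^ ?n) * (\<integral>\<^sup>+x. (\<integral>\<^sup>+y. f ((*\<^sub>R) r ` \<Omega>) (r *\<^sub>R x) y \<partial>lebesgue) \<partial>lebesgue)"
    using lebesgue_nn_integral_scale[OF fm2[OF \<Omega>r] r] by simp
  also have "\<dots> = ennreal (r ^ ?n) * (\<integral>\<^sup>+x. ennreal (r ^ ?n) * (\<integral>\<^sup>+y. f ((*\<^sub>R) r ` \<Omega>) (r *\<^sub>R x) (r *\<^sub>R y) \<partial>lebesgue) \<partial>lebesgue)"
    using lebesgue_nn_integral_scale[OF fm1[OF \<Omega>r] r] by simp
  also have "\<dots> = ennreal (r ^ ?n) * (\<integral>\<^sup>+x. ennreal (r ^ ?n) * (ennreal (r powr (- lam)) * (\<integral>\<^sup>+y. f \<Omega> x y \<partial>lebesgue)) \<partial>lebesgue)"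
    unfolding f_scale by (simp only: nn_integral_cmult[OF fm1[OF \<Omega>]])
  also have "\<dots> = ennreal (r ^ ?n) * (ennreal (r ^ ?n) * (ennreal (r powr (- lam)) * (\<integral>\<^sup>+x. (\<integral>\<^sup>+y. f \<Omega> x y \<partial>lebesgue) \<partial>lebesgue)))"
    using fm2[OF \<Omega>] by (simp add: nn_integral_cmult)
  also have "\<dots> = ennreal (r ^ ?n * (r ^ ?n * r powr (- lam))) * (\<integral>\<^sup>+x. (\<integral>\<^sup>+y. f \<Omega> x y \<partial>lebesgue) \<partial>lebesgue)"
    using r by (simp add: ennreal_mult' mult.assoc)
  also have "r ^ ?n * (r ^ ?n * r powr (- lam)) = r powr (2 * real ?n - lam)"
    using r by (simp add: powr_realpow[symmetric] powr_add[symmetric])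
  finally show ?thesis
    unfolding iter[OF \<Omega>r] iter[OF \<Omega>] by (simp add: mult.left_commute)
qed

text \<open>Serves in two ways: with the unit ball it bounds the minimal energy at every positive
  mass, and with a competitor of smaller mass, blown up, it bounds E(m).\<close>

lemma min_energy_le_scaled:
  fixes \<Omega> :: "(real^'n) set"
  assumes \<Omega>: "\<Omega> \<in> sets lebesgue" "emeasure lebesgue \<Omega> = ennreal \<mu>" "0 \<le> \<mu>" and t: "0 < t"
    and P: "perimeter \<Omega> = ereal P" and D: "riesz_energy lam \<Omega> = ennreal D" "0 \<le> D"
  shows "min_energy TYPE('n) lam (t ^ CARD('n) * \<mu>)
      \<le> ereal (t ^ (CARD('n) - 1) * P + t powr (2 * real CARD('n) - lam) * D)"
proof -
  let ?S = "(*\<^sub>R) t ` \<Omega>"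
  have "emeasure lebesgue ?S = ennreal (t ^ CARD('n) * \<mu>)"
    using emeasure_lebesgue_affine[of t 0 \<Omega>] t \<Omega> by (simp add: ennreal_mult')
  then have "min_energy TYPE('n) lam (t ^ CARD('n) * \<mu>) \<le> drop_energy lam ?S"
    unfolding min_energy_def using sets_lebesgue_scale[OF \<Omega>(1) t] by (intro INF_lower) simp
  also have "\<dots> \<le> ereal (t ^ (CARD('n) - 1) * P) + ereal (t powr (2 * real CARD('n) - lam) * D)"
    unfolding drop_energy_def
    using perimeter_scale_le[OF \<Omega>(1) t, of P] P riesz_energy_scale[OF \<Omega>(1) t, of lam] D
    by (intro add_mono) (simp_all add: ennreal_mult'[symmetric])
  finally show ?thesis by simp
qed

text \<open>The sum is f p - g d with f = \<theta>^a + (1 - \<theta>)^a - 1 and g = 1 - \<theta>^b -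
  (1 - \<theta>)^b > 0. The quotient f / g is at least its value at \<theta> = 1/2, which is the
  factor of p in the assumption on d.\<close>

lemma split_gain_pos:
  fixes a b \<theta> p d :: real
  assumes ab: "0 < a" "a < 1" "1 < b" "b \<le> 2" and \<theta>: "0 < \<theta>" "\<theta> < 1" and p: "0 \<le> p"
    and d: "d < (2 powr (1 - a) - 1) / (1 - 2 powr (1 - b)) * p"
  shows "0 < ((\<theta> powr a - \<theta>) * p - (\<theta> - \<theta> powr b) * d)
      + (((1 - \<theta>) powr a - (1 - \<theta>)) * p - ((1 - \<theta>) - (1 - \<theta>) powr b) * d)"
proof -
  define f where "f = \<theta> powr a + (1 - \<theta>) powr a - 1"
  define g where "g = 1 - \<theta> powr b - (1 - \<theta>) powr b"
  define q where "q = (2 powr (1 - a) - 1 :: real)"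
  define k where "k = (1 - 2 powr (1 - b) :: real)"
  have k: "0 < k" using two_powr_facts[OF ab(1-3)] by (simp add: k_def)
  \<comment> \<open>f and g are symmetric under \<theta> \<mapsto> 1 - \<theta>, so
    \<open>half_split_extremal\<close> applies with s the distance of \<theta> from 1/2.\<close>
  have ineq: "q * g \<le> k * f"
  proof (cases "\<theta> \<le> 1/2")
    case True
    have eq: "1/2 - (1/2 - \<theta>) = \<theta>" "1/2 + (1/2 - \<theta>) = 1 - \<theta>" by auto
    show ?thesis using half_split_extremal[OF ab, of "1/2 - \<theta>"] True \<theta> unfolding eq q_def g_def k_def f_def by simp
  next
    case False
    have eq: "1/2 - (\<theta> - 1/2) = 1 - \<theta>" "1/2 + (\<theta> - 1/2) = \<theta>" by auto
    show ?thesis using half_split_extremal[OF ab, of "\<theta> - 1/2"] False \<theta> unfolding eq q_def g_def k_def f_def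
      by (simp add: algebra_simps)
  qed
  have "x powr b < x" if "0 < x" "x < 1" for x :: real
    using powr_less_mono'[of x 1 b] that ab by simp
  from this[of \<theta>] this[of "1 - \<theta>"] have g: "0 < g" using \<theta> by (simp add: g_def)
  have "k * d < q * p" using d k by (simp add: q_def[symmetric] k_def[symmetric] field_simps)
  then have "g * (k * d) < g * (q * p)" using g by simp
  also have "\<dots> = q * g * p" by simp
  also have "\<dots> \<le> k * f * p" using ineq p by (rule mult_right_mono)
  finally have "k * (g * d) < k * (f * p)" by (simp add: mult_ac)
  then have "g * d < f * p" using k by simp
  then show ?thesis by (simp add: f_def g_def algebra_simps)
qed

theorem theorem4:
  fixes lam m m1 :: real
  assumes "CARD('n::finite) \<ge> 2"
    and "0 < lam" and "lam < real CARD('n)"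
    and "0 < m" and "m < critical_mass TYPE('n) lam"
    and "0 < m1" and "m1 < m"
  shows "min_energy TYPE('n) lam m
           < min_energy TYPE('n) lam m1 + min_energy TYPE('n) lam (m - m1)"
proof -
  define N where "N = real CARD('n)"
  define B where "B = ball (0::real^'n) 1"
  define w where "w = measure lborel B"
  define P1 where "P1 = real_of_ereal (perimeter B)"
  define D1 where "D1 = enn2real (riesz_energy lam B)"
  define a where "a = (N - 1) / N"
  define b where "b = (2 * N - lam) / N"
  define q where "q = (2 powr (1 - a) - 1) / (1 - 2 powr (1 - b))"
  have N: "2 \<le> N" using assms(1) by (simp add: N_def)
  have ab: "0 < a" "a < 1" "1 < b" "b \<le> 2" using N assms(2,3) by (auto simp: a_def b_def N_def field_simps)
  have ab': "1 - a = 1 / N" "1 - b = (lam - N) / N" "1 / (b - a) = N / (N + 1 - lam)" "0 < b - a"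
  proof -
    show "1 - a = 1 / N" "1 - b = (lam - N) / N" using N by (simp_all add: a_def b_def field_simps)
    have ba: "b - a = (N + 1 - lam) / N" using N by (simp add: a_def b_def diff_divide_distrib[symmetric])
    show "1 / (b - a) = N / (N + 1 - lam)" unfolding ba by simp
    show "0 < b - a" using N assms(3) unfolding ba by (simp add: N_def)
  qed
  have w: "0 < w" by (simp add: w_def B_def content_ball_pos)
  have crit: "critical_mass TYPE('n) lam = (q * (P1 / D1)) powr (N / (N + 1 - lam)) * w"
    by (simp add: critical_mass_def Let_def q_def ab' P1_def D1_def w_def B_def N_def)
  \<comment> \<open>An infinite perimeter or Riesz energy of the ball is converted to the real number \<open>0\<close>, and then
    the critical mass would be \<open>0\<close>.\<close>
  have nz: "P1 / D1 \<noteq> 0"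
  proof
    assume "P1 / D1 = 0"
    then have "critical_mass TYPE('n) lam = 0" unfolding crit by simp
    then show False using assms(4,5) by simp
  qed
  have P1: "perimeter B = ereal P1" "0 < P1"
    using nz perimeter_nonneg[of B] by (cases "perimeter B"; simp add: P1_def)+
  have D1: "riesz_energy lam B = ennreal D1" "0 < D1"
    using nz by (cases "riesz_energy lam B"; simp add: D1_def less_le)+
  \<comment> \<open>\<open>p\<close> and \<open>d\<close> are the perimeter and the Riesz energy
    that scaling assigns to the ball of mass \<mu>.\<close>
  define p where "p \<mu> = P1 * (\<mu> / w) powr a" for \<mu>
  define d where "d \<mu> = D1 * (\<mu> / w) powr b" for \<mu>
  have Bl: "B \<in> sets lebesgue" "emeasure lebesgue B = ennreal w"
    using fmeasurable_lborel_bounded[of B] by (auto simp: B_def w_def emeasure_eq_measure2)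
  have scale_exps: "(x powr (1 / N)) ^ CARD('n) = x" "(x powr (1 / N)) ^ (CARD('n) - 1) = x powr a"
    "(x powr (1 / N)) powr (2 * real CARD('n) - lam) = x powr b" if "0 < x" for x :: real
    using that N assms(1)
    by (simp_all add: powr_realpow[symmetric] powr_powr a_def b_def N_def of_nat_diff)
  have upper: "min_energy TYPE('n) lam \<mu> \<le> ereal (p \<mu> + d \<mu>)" if "0 < \<mu>" for \<mu>
  proof -
    have x: "0 < \<mu> / w" using that w by simp
    have t: "0 < (\<mu> / w) powr (1 / N)" using that w by simp
    show ?thesis
      using min_energy_le_scaled[OF Bl less_imp_le[OF w] t P1(1) D1(1) less_imp_le[OF D1(2)]] w
      unfolding scale_exps[OF x] by (simp add: p_def d_def mult.commute)
  qed
  have iso: "ereal (p \<mu>) \<le> perimeter \<Omega>" if \<mu>: "0 < \<mu>" "\<Omega> \<in> sets lebesgue" "emeasure lebesgue \<Omega> = ennreal \<mu>"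
    for \<mu> and \<Omega> :: "(real^'n) set"
  proof -
    \<comment> \<open>This replaces the explicit isoperimetric constant by the perimeter of the ball
      that occurs in the critical mass.\<close>
    have "P1 \<le> N * w" using perimeter_unit_ball_le[where 'n='n] P1(1) by (simp add: B_def w_def N_def)
    then have "p \<mu> \<le> N * w * (\<mu> / w) powr a" unfolding p_def by (intro mult_right_mono) auto
    also have "\<dots> = N * (w * w powr (- a)) * \<mu> powr a"
      using w \<mu> by (simp add: powr_divide powr_minus_divide)
    also have "w * w powr (- a) = w powr (1 / N)"
      using w ab'(1) powr_mult_base[of w "- a"] by simp
    also have "N * w powr (1 / N) * \<mu> powr a = N * w powr (1 / N) * (\<mu> powr (1 / N)) ^ (CARD('n) - 1)"
      using scale_exps(2)[OF \<mu>(1)] by simp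
    finally have "ereal (p \<mu>) \<le> ereal (N * w powr (1 / N) * (\<mu> powr (1 / N)) ^ (CARD('n) - 1))" by simp
    also have "\<dots> \<le> perimeter \<Omega>"
      using isoperimetric_inequality[OF \<mu>(2,3,1)] by (simp add: N_def w_def B_def)
    finally show ?thesis .
  qed
  have "0 \<le> min_energy TYPE('n) lam m"
    unfolding min_energy_def drop_energy_def by (intro INF_greatest add_nonneg_nonneg perimeter_nonneg) simp
  then obtain E where E: "min_energy TYPE('n) lam m = ereal E"
    using upper[OF assms(4)] by (cases "min_energy TYPE('n) lam m") auto
  have E_le: "E \<le> p m + d m" using upper[OF assms(4)] E by simp
  \<comment> \<open>The surplus over \<theta> E(m). It is chosen so that \<theta> (p m + d m) + X
    \<theta> equals p (\<theta> m) + d (\<theta> m), the energy of the ball of mass \<theta>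
    m.\<close>
  define X where "X \<theta> = (\<theta> powr a - \<theta>) * p m - (\<theta> - \<theta> powr b) * d m" for \<theta>
  have lower: "ereal (\<theta> * E + X \<theta>) \<le> min_energy TYPE('n) lam (\<theta> * m)" if \<theta>: "0 < \<theta>" "\<theta> < 1" for \<theta>
    unfolding min_energy_def
  proof (rule INF_greatest)
    fix \<Omega> :: "(real^'n) set"
    assume "\<Omega> \<in> {\<Omega>. \<Omega> \<in> sets lebesgue \<and> emeasure lebesgue \<Omega> = ennreal (\<theta> * m)}"
    then have \<Omega>: "\<Omega> \<in> sets lebesgue" "emeasure lebesgue \<Omega> = ennreal (\<theta> * m)" by auto
    have \<mu>: "0 < \<theta> * m" using \<theta> assms(4) by simp
    have pd: "p (\<theta> * m) = \<theta> powr a * p m" "d (\<theta> * m) = \<theta> powr b * d m"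
      using \<theta> assms(4) w by (simp_all add: p_def d_def powr_mult powr_divide)
    show "ereal (\<theta> * E + X \<theta>) \<le> drop_energy lam \<Omega>"
    proof (cases "drop_energy lam \<Omega> \<le> ereal (p (\<theta> * m) + d (\<theta> * m))")
      case False
      \<comment> \<open>A competitor with more energy than the ball needs no scaling: the bound on E
        by the ball of mass m already yields the claim.\<close>
      have "\<theta> * E \<le> \<theta> * (p m + d m)" using E_le \<theta> by (intro mult_left_mono) auto
      then have "ereal (\<theta> * E + X \<theta>) \<le> ereal (p (\<theta> * m) + d (\<theta> * m))"
        unfolding pd X_def by (simp add: algebra_simps)
      also have "\<dots> \<le> drop_energy lam \<Omega>" using False by simp
      finally show ?thesis .
    next
      case True
      obtain P where P: "perimeter \<Omega> = ereal P"
        using True perimeter_nonneg[of \<Omega>] by (cases "perimeter \<Omega>") (auto simp: drop_energy_def)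
      obtain D where D: "riesz_energy lam \<Omega> = ennreal D" "0 \<le> D"
        using True P by (cases "riesz_energy lam \<Omega>") (auto simp: drop_energy_def)
      have sum: "drop_energy lam \<Omega> = ereal (P + D)" using P D by (simp add: drop_energy_def)
      have Pp: "p (\<theta> * m) \<le> P" using iso[OF \<mu> \<Omega>] P by simp
      then have Dd: "D \<le> d (\<theta> * m)" using True sum by simp
      \<comment> \<open>The competitor is dilated by the factor
        \<open>(1 / \<theta>) powr (1 / N)\<close>, which takes its mass from \<theta> m to
        m.\<close>
      have "min_energy TYPE('n) lam m \<le> ereal ((1 / \<theta>) powr a * P + (1 / \<theta>) powr b * D)"
      proof -
        have x: "0 < 1 / \<theta>" using \<theta> by simp
        then have t: "0 < (1 / \<theta>) powr (1 / N)" by simp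
        show ?thesis
          using min_energy_le_scaled[OF \<Omega> less_imp_le[OF \<mu>] t P D] \<theta> unfolding scale_exps[OF x] by simp
      qed
      then have "E \<le> \<theta> powr (- a) * P + \<theta> powr (- b) * D"
        using E \<theta> by (simp add: powr_divide powr_minus_divide)
      then have "\<theta> * E \<le> \<theta> * (\<theta> powr (- a) * P + \<theta> powr (- b) * D)"
        using \<theta> by (intro mult_left_mono) auto
      also have "\<dots> = (\<theta> * \<theta> powr (- a)) * P + (\<theta> * \<theta> powr (- b)) * D" by (simp add: algebra_simps)
      also have "\<dots> = \<theta> powr (1 - a) * P + \<theta> powr (1 - b) * D"
        using \<theta> powr_mult_base[of \<theta> "- a"] powr_mult_base[of \<theta> "- b"] by simp
      finally have 1: "\<theta> * E \<le> \<theta> powr (1 - a) * P + \<theta> powr (1 - b) * D" .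
      \<comment> \<open>The signs of the two coefficients decide which bound is wanted: 1 -
        \<theta>^(1 - a) is nonnegative and goes with the lower bound on \<open>P\<close>, while
        \<theta>^(1 - b) - 1 is nonnegative and goes with the upper bound on
        \<open>D\<close>.\<close>
      have "\<theta> powr (1 - a) \<le> 1" using \<theta> ab by (simp add: powr_le1)
      then have 2: "(1 - \<theta> powr (1 - a)) * p (\<theta> * m) \<le> (1 - \<theta> powr (1 - a)) * P"
        using Pp by (intro mult_left_mono) auto
      have "1 \<le> \<theta> powr (1 - b)" using \<theta> ab powr_mono'[of "1 - b" 0 \<theta>] by simp
      then have 3: "(\<theta> powr (1 - b) - 1) * D \<le> (\<theta> powr (1 - b) - 1) * d (\<theta> * m)"
        using Dd by (intro mult_left_mono) auto
      have "\<theta> powr (1 - a) * \<theta> powr a = \<theta>" "\<theta> powr (1 - b) * \<theta> powr b = \<theta>"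
        using \<theta> by (simp_all add: powr_add[symmetric])
      then have "X \<theta> = (1 - \<theta> powr (1 - a)) * p (\<theta> * m) - (\<theta> powr (1 - b) - 1) * d (\<theta> * m)"
        unfolding X_def pd by (simp add: left_diff_distrib mult.assoc[symmetric])
      then have "\<theta> * E + X \<theta> \<le> P + D" using 1 2 3 by (simp add: left_diff_distrib)
      then show ?thesis by (simp add: sum)
    qed
  qed
  define \<theta> where "\<theta> = m1 / m"
  have \<theta>: "0 < \<theta>" "\<theta> < 1" "m1 = \<theta> * m" "m - m1 = (1 - \<theta>) * m"
    using assms(4,6,7) by (auto simp: \<theta>_def field_simps)
  have p: "0 < p m" using P1 assms(4) w by (simp add: p_def)
  have q: "0 < q" using two_powr_facts[OF ab(1-3)] by (simp add: q_def)
  \<comment> \<open>The ratio of d m to p m is (D1 / P1) (m / w)^(b - a). The critical mass is the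
    mass at which it equals \<open>q\<close>, and this explains its exponent 1 / (b - a).\<close>
  have "m / w < (q * (P1 / D1)) powr (1 / (b - a))"
    using assms(5) w unfolding crit ab' by (simp add: pos_divide_less_eq)
  then have "(m / w) powr (b - a) < ((q * (P1 / D1)) powr (1 / (b - a))) powr (b - a)"
    using assms(4) w ab' by (intro powr_less_mono2) auto
  also have "\<dots> = q * (P1 / D1)" using q P1 D1 ab'(4) by (simp add: powr_powr)
  finally have "D1 * (m / w) powr (b - a) * (m / w) powr a < q * P1 * (m / w) powr a"
    using D1 assms(4) w by (simp add: field_simps)
  then have "d m < q * p m"
    by (simp add: d_def p_def mult.assoc powr_add[symmetric])
  then have gain: "0 < X \<theta> + X (1 - \<theta>)"
    unfolding X_def using split_gain_pos[OF ab \<theta>(1,2) less_imp_le[OF p]] by (simp add: q_def)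
  have "ereal E < ereal ((\<theta> * E + X \<theta>) + ((1 - \<theta>) * E + X (1 - \<theta>)))"
    using gain by (simp add: algebra_simps)
  also have "\<dots> = ereal (\<theta> * E + X \<theta>) + ereal ((1 - \<theta>) * E + X (1 - \<theta>))" by simp
  also have "\<dots> \<le> min_energy TYPE('n) lam (\<theta> * m) + min_energy TYPE('n) lam ((1 - \<theta>) * m)"
    using \<theta> by (intro add_mono lower) auto
  finally show ?thesis unfolding E \<theta>(4) unfolding \<theta>(3) .
qed

end
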